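(* Let $Y$ be a symmetric transient Borel right process with state space $T$ (a locally compact space with a countable base), and with continuous potential densities $u(x,y)$, $x,y\in T$, with respect to some locally bounded reference measure $m$ on $T$. Then for any finite excessive functions $g$ and $f$ for $Y$ and any $\alpha>0$, the function $$u_{g,f}(x,y)=u(x,y)+g(x)f(y),\qquad x,y\in T,$$ is the kernel of an $\alpha$-permanental process.
   Context: For $\alpha>0$, an $\alpha$-permanental process with kernel $K=\{K(s,t),s,t\in T\}$ is a nonnegative stochastic process $X_\alpha=\{X_\alpha(t),t\in T\}$ such that for all $n$, all $t_1,\dots,t_n\in T$ and all $s_1,\dots,s_n>0$, $$E\Big(e^{-\sum_{i=1}^n s_iX_\alpha(t_i)}\Big)=\frac{1}{|I+\mathbf K S|^{\alpha}},$$ where $\mathbf K$ is the $n\times n$ matrix $\{K(t_i,t_j)\}$, $S$ is the diagonal matrix with entries $s_1,\dots,s_n$, and $|\cdot|$ denotes the determinant. To say that $K$ is the kernel of an $\alpha$-permanental process means that such a process exists. $Y$ has potential densities $u(x,y)$ with respect to $m$ if $E^x\big(\int_0^\infty h(Y_t)\,dt\big)=\int_T u(x,y)h(y)\,dm(y)$ for all $x\in T$ and all positive measurable $h$ on $T$ (with $h(\Delta)=0$ at the cemetery state $\Delta$). Since $Y$ is symmetric, $u(x,y)=u(y,x)$. A nonnegative function $f$ on $T$ is excessive for $Y$ if $E^x(f(Y_t))\uparrow f(x)$ as $t\downarrow0$ for all $x\in T$. *)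

theory Defs
  imports "HOL-Probability.Probability" "Jordan_Normal_Form.Determinant"
begin

section \<open>Permanental processes\<close>

text \<open>
  The vectors \<open>t\<close> and \<open>s\<close> are indexed by \<open>{0..<n}\<close>; the points \<open>t i\<close> need not be distinct.
  Positivity of the determinant is part of the definition so that the real power is a
  genuine one.  It is no extra restriction: the determinant depends continuously on \<open>s\<close>, tends
  to 1 as \<open>s\<close> tends to 0, and cannot vanish because the Laplace transform is finite and positive.
\<close>

definition permanental_process ::
  "real \<Rightarrow> ('a \<Rightarrow> 'a \<Rightarrow> real) \<Rightarrow> 'p measure \<Rightarrow> ('a \<Rightarrow> 'p \<Rightarrow> real) \<Rightarrow> bool" where
  "permanental_process \<alpha> K M X \<longleftrightarrow>
     prob_space M \<and>
     (\<forall>t. X t \<in> borel_measurable M) \<and>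
     (\<forall>t. \<forall>\<omega>\<in>space M. 0 \<le> X t \<omega>) \<and>
     (\<forall>n (t :: nat \<Rightarrow> 'a) (s :: nat \<Rightarrow> real). (\<forall>i<n. 0 < s i) \<longrightarrow>
        (let d = Determinant.det (1\<^sub>m n + Matrix.mat n n (\<lambda>(i, j). K (t i) (t j)) * mat_diag n s)
         in 0 < d \<and> (\<integral>\<omega>. exp (- (\<Sum>i<n. s i * X (t i) \<omega>)) \<partial>M) = 1 / d powr \<alpha>))"

text \<open>
  A process with index set \<open>'a\<close> may always be realised on the path space \<open>'a \<Rightarrow> real\<close>
  (with the product sigma-algebra), so taking the sample space of this type loses nothing.
\<close>

definition permanental_kernel :: "real \<Rightarrow> ('a \<Rightarrow> 'a \<Rightarrow> real) \<Rightarrow> bool" where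
  "permanental_kernel \<alpha> K \<longleftrightarrow>
     (\<exists>(M :: ('a \<Rightarrow> real) measure) X. permanental_process \<alpha> K M X)"

section \<open>Borel right processes\<close>

text \<open>
  The state space is the type \<open>'a\<close>; the cemetery \<open>\<Delta>\<close> is \<open>None\<close>, and \<open>'a option\<close> carries the
  one-point compactification (in which \<open>\<Delta>\<close> is isolated if the state space is compact).
\<close>

abbreviation cemetery_topology :: "'a :: topological_space option topology" where
  "cemetery_topology \<equiv> Alexandroff_compactification euclidean"

definition cemetery_borel :: "'a :: topological_space option measure" where
  "cemetery_borel = sigma UNIV {V. openin cemetery_topology V}"

text \<open>Functions on the state space vanish at the cemetery.\<close>

definition ext0 :: "('a \<Rightarrow> ennreal) \<Rightarrow> 'a option \<Rightarrow> ennreal" where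
  "ext0 h z = (case z of None \<Rightarrow> 0 | Some y \<Rightarrow> h y)"

text \<open>
  Time is \<open>[0, \<infinity>]\<close>, with the usual convention \<open>Y\<^sub>\<infinity> = \<Delta>\<close>; \<open>G t\<close> for \<open>t < \<infinity>\<close> is the
  filtration, \<open>G \<infinity>\<close> is the sigma-algebra on which the laws \<open>P z\<close>, \<open>z \<in> T \<union> {\<Delta>}\<close>, live.
  A Borel right process is a right continuous strong Markov process with respect to a right
  continuous filtration whose transition function maps Borel functions to Borel functions.
  Completeness of the filtration is not required (augmented filtrations are covered).
  For \<open>\<tau> = \<infinity>\<close> both sides of \<open>strong_markov\<close> concern the point \<open>\<Delta>\<close> only, so the condition
  is the customary one on \<open>{\<tau> < \<infinity>}\<close>.
\<close>

locale borel_right_process = filtration \<Omega> G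
  for \<Omega> :: "'w set" and G :: "ennreal \<Rightarrow> 'w measure" +
  fixes Y :: "ennreal \<Rightarrow> 'w \<Rightarrow> 'a :: {t2_space, second_countable_topology} option"
    and \<theta> :: "ennreal \<Rightarrow> 'w \<Rightarrow> 'w"
    and P :: "'a option \<Rightarrow> 'w measure"
  assumes filtration_right_continuous: "t < \<infinity> \<Longrightarrow> sets (G t) = (\<Inter>s\<in>{t<..}. sets (G s))"
    and adapted: "Y t \<in> measurable (G t) cemetery_borel"
    and infinity: "\<omega> \<in> \<Omega> \<Longrightarrow> Y \<infinity> \<omega> = None"
    and absorbing: "\<omega> \<in> \<Omega> \<Longrightarrow> s \<le> t \<Longrightarrow> Y s \<omega> = None \<Longrightarrow> Y t \<omega> = None"
    and paths_right_continuous: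
      "\<omega> \<in> \<Omega> \<Longrightarrow> t < \<infinity> \<Longrightarrow> limitin cemetery_topology (\<lambda>s. Y s \<omega>) (Y t \<omega>) (at_right t)"
    and shift_into: "\<omega> \<in> \<Omega> \<Longrightarrow> t < \<infinity> \<Longrightarrow> \<theta> t \<omega> \<in> \<Omega>"
    and shift: "\<omega> \<in> \<Omega> \<Longrightarrow> t < \<infinity> \<Longrightarrow> Y s (\<theta> t \<omega>) = Y (s + t) \<omega>"
    and law_prob_space: "prob_space (P z)"
    and law_sets: "sets (P z) = sets (G \<infinity>)"
    and normal: "AE \<omega> in P z. Y 0 \<omega> = z"
    and borel_transition:
      "B \<in> sets cemetery_borel \<Longrightarrow>
        (\<lambda>z. emeasure (P z) {\<omega> \<in> \<Omega>. Y t \<omega> \<in> B}) \<in> borel_measurable cemetery_borel"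
    and strong_markov:
      "stopping_time G \<tau> \<Longrightarrow> A \<in> sets (pre_sigma \<tau>) \<Longrightarrow> B \<in> sets cemetery_borel \<Longrightarrow>
        emeasure (P z) {\<omega> \<in> A. Y (\<tau> \<omega> + t) \<omega> \<in> B} =
          (\<integral>\<^sup>+\<omega>\<in>A. emeasure (P (Y (\<tau> \<omega>) \<omega>)) {\<omega>' \<in> \<Omega>. Y t \<omega>' \<in> B} \<partial>P z)"

definition transition ::
  "(ennreal \<Rightarrow> 'w \<Rightarrow> 'a option) \<Rightarrow> ('a option \<Rightarrow> 'w measure) \<Rightarrow> ennreal \<Rightarrow> ('a \<Rightarrow> ennreal) \<Rightarrow> 'a \<Rightarrow> ennreal"
  where "transition Y P t h x = (\<integral>\<^sup>+\<omega>. ext0 h (Y t \<omega>) \<partial>P (Some x))"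

definition potential ::
  "(ennreal \<Rightarrow> 'w \<Rightarrow> 'a option) \<Rightarrow> ('a option \<Rightarrow> 'w measure) \<Rightarrow> ('a \<Rightarrow> ennreal) \<Rightarrow> 'a \<Rightarrow> ennreal"
  where "potential Y P h x =
    (\<integral>\<^sup>+\<omega>. (\<integral>\<^sup>+t\<in>{0..}. ext0 h (Y (ennreal t) \<omega>) \<partial>lborel) \<partial>P (Some x))"

text \<open>Transience in the sense of Getoor: the potential kernel is proper.\<close>

definition transient ::
  "(ennreal \<Rightarrow> 'w \<Rightarrow> 'a :: topological_space option) \<Rightarrow> ('a option \<Rightarrow> 'w measure) \<Rightarrow> bool" where
  "transient Y P \<longleftrightarrow>
     (\<exists>h \<in> borel_measurable borel. (\<forall>x. 0 < h x) \<and> (\<forall>x. potential Y P h x < \<infinity>))"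

definition locally_bounded_measure :: "'a :: topological_space measure \<Rightarrow> bool" where
  "locally_bounded_measure m \<longleftrightarrow> (\<forall>x. \<exists>V. open V \<and> x \<in> V \<and> emeasure m V < \<infinity>)"

text \<open>
  Only the absolute continuity of the potentials is demanded; the notion requiring also that sets
  of potential zero be null is thereby covered.
\<close>

definition reference_measure ::
  "(ennreal \<Rightarrow> 'w \<Rightarrow> 'a :: topological_space option) \<Rightarrow> ('a option \<Rightarrow> 'w measure) \<Rightarrow> 'a measure \<Rightarrow> bool"
  where "reference_measure Y P m \<longleftrightarrow>
    sets m = sets borel \<and> (\<forall>A\<in>null_sets m. \<forall>x. potential Y P (indicator A) x = 0)"

definition symmetric_process ::
  "(ennreal \<Rightarrow> 'w \<Rightarrow> 'a :: topological_space option) \<Rightarrow> ('a option \<Rightarrow> 'w measure) \<Rightarrow> 'a measure \<Rightarrow> bool"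
  where "symmetric_process Y P m \<longleftrightarrow>
    (\<forall>t<\<infinity>. \<forall>h\<in>borel_measurable borel. \<forall>k\<in>borel_measurable borel.
       (\<integral>\<^sup>+x. h x * transition Y P t k x \<partial>m) = (\<integral>\<^sup>+x. transition Y P t h x * k x \<partial>m))"

definition potential_density ::
  "(ennreal \<Rightarrow> 'w \<Rightarrow> 'a :: topological_space option) \<Rightarrow> ('a option \<Rightarrow> 'w measure) \<Rightarrow> 'a measure \<Rightarrow>
    ('a \<Rightarrow> 'a \<Rightarrow> real) \<Rightarrow> bool"
  where "potential_density Y P m u \<longleftrightarrow>
    (\<forall>x y. 0 \<le> u x y) \<and>
    (\<forall>h\<in>borel_measurable borel. \<forall>x.
       potential Y P h x = (\<integral>\<^sup>+y. ennreal (u x y) * h y \<partial>m))"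

text \<open>
  Excessive functions are only required to be universally measurable, as is customary.
  The integral of such a function with respect to a measure and to its completion agree
  (\<open>nn_integral_completion\<close>), so \<open>transition\<close> is the intended expectation.
\<close>

definition universally_measurable :: "('a :: topological_space \<Rightarrow> ennreal) \<Rightarrow> bool" where
  "universally_measurable f \<longleftrightarrow>
     (\<forall>\<mu>. finite_measure \<mu> \<and> sets \<mu> = sets borel \<longrightarrow> f \<in> borel_measurable (completion \<mu>))"

definition excessive ::
  "(ennreal \<Rightarrow> 'w \<Rightarrow> 'a :: topological_space option) \<Rightarrow> ('a option \<Rightarrow> 'w measure) \<Rightarrow> ('a \<Rightarrow> ennreal) \<Rightarrow> bool"
  where "excessive Y P f \<longleftrightarrow>
    universally_measurable f \<and>
    (\<forall>x. (\<forall>s t. 0 < s \<longrightarrow> s \<le> t \<longrightarrow> transition Y P t f x \<le> transition Y P s f x) \<and>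
         ((\<lambda>t. transition Y P t f x) \<longlongrightarrow> f x) (at_right 0))"

end

theory Submission imports Defs begin

text \<open>
  By the energy inequality for charges, a potential of a nonnegative combination of point masses that
  is bounded by an excessive function \<open>f\<close> at the charged points is bounded by \<open>f\<close> everywhere, and
  \<open>u\<close> is strictly positive definite.  Hence for distinct points the inverse of the matrix
  \<open>u(x\<^sub>i, x\<^sub>j)\<close> is a Z-matrix and maps the restrictions of \<open>f\<close> and \<open>g\<close> to nonnegative vectors, so the
  inverse of \<open>K = (u(x\<^sub>i, x\<^sub>j) + g(x\<^sub>i) f(x\<^sub>j))\<close>, a rank one update, is again a Z-matrix \<open>A\<close>, with
  \<open>A (K 1) > 0\<close>.  For such \<open>A\<close> every power \<open>det (A + S) powr - \<alpha>\<close> is the Laplace transform of a measure on the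
  orthant, and \<open>det (1 + K S) = det (A + S) / det A\<close>.  The resulting laws are consistent by uniqueness of
  Laplace transforms, and Kolmogorov's theorem gives the process.
\<close>

section \<open>Multivariate Laplace transforms\<close>

text \<open>The kernel need not be a covariance, since it is not symmetric in general; the argument
  therefore rests on signs in the inverse matrix, which give every power \<alpha> at once. The signs
  come from domination and strict positivity at every point, while symmetry and the potential
  formula are only statements integrated against \<open>m\<close>, point masses have no density, and
  excessive functions are only universally measurable. Three devices bridge this gap. Positivity of
  the energy comes from splitting \<open>T s\<close> into two symmetric halves, hence for functions
  first. A point mass at \<open>x\<close> is smeared into the time average of the transition
  measures from \<open>x\<close>, which has a density; integrals of supermedian functions decrease
  under smearing and converge back for lower semicontinuous ones. Right continuity of the paths
  makes \<open>m\<close> positive on nonempty open sets, so an integrated inequality of a lower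
  semicontinuous function against a continuous one holds everywhere. Subtraction in
  \<open>ennreal\<close> needs finite terms; hence the strictly positive \<open>\<eta>\<close> of
  finite potential, supplied by transience.\<close>

text \<open>A series of Laplace transforms will be represented by the sum of the representing
  measures. Space and sigma-algebra are read off from \<open>N 0\<close>; the lemmas assume that all
  \<open>N k\<close> share them.\<close>

definition suminf_measure :: "(nat \<Rightarrow> 'a measure) \<Rightarrow> 'a measure" where
  "suminf_measure N = measure_of (space (N 0)) (sets (N 0)) (\<lambda>A. \<Sum>k. emeasure (N k) A)"

lemma space_suminf_measure [simp]: "space (suminf_measure N) = space (N 0)"
  and sets_suminf_measure [simp, measurable_cong]: "sets (suminf_measure N) = sets (N 0)"
  by (simp_all add: suminf_measure_def)

lemma emeasure_suminf_measure:
  assumes N: "\<And>k. sets (N k) = sets M" and A: "A \<in> sets M"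
  shows "emeasure (suminf_measure N) A = (\<Sum>k. emeasure (N k) A)"
proof (rule emeasure_measure_of[OF suminf_measure_def])
  show "countably_additive (sets (suminf_measure N)) (\<lambda>A. \<Sum>k. emeasure (N k) A)"
  proof (rule countably_additiveI)
    fix F :: "nat \<Rightarrow> 'a set"
    assume F: "range F \<subseteq> sets (suminf_measure N)" "disjoint_family F"
    have "(\<Sum>i. \<Sum>k. emeasure (N k) (F i)) = (\<Sum>k. \<Sum>i. emeasure (N k) (F i))"
      \<comment> \<open>Both sums become integrals for the counting measure, and Tonelli exchanges
        them.\<close>
      unfolding nn_integral_count_space_nat[symmetric]
      by (rule pair_sigma_finite.Fubini')
         (auto simp: pair_sigma_finite_def intro!: sigma_finite_measure_count_space
           borel_measurable_count_space simp: pair_measure_countable)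
    also have "\<dots> = (\<Sum>k. emeasure (N k) (\<Union> (range F)))"
      using F N by (intro suminf_cong suminf_emeasure) auto
    finally show "(\<Sum>i. \<Sum>k. emeasure (N k) (F i)) = (\<Sum>k. emeasure (N k) (\<Union> (range F)))" .
  qed
qed (use assms in \<open>auto simp: positive_def dest: sets.sets_into_space\<close>)

lemma nn_integral_suminf_measure:
  assumes N: "\<And>k. sets (N k) = sets M" and f: "f \<in> borel_measurable M"
  shows "(\<integral>\<^sup>+x. f x \<partial>suminf_measure N) = (\<Sum>k. \<integral>\<^sup>+x. f x \<partial>N k)"
proof -
  have s: "sets (suminf_measure N) = sets M" by (simp add: N)
  have m: "f \<in> borel_measurable (N k)" "f \<in> borel_measurable (suminf_measure N)"
    if "f \<in> borel_measurable M" for f :: "'a \<Rightarrow> ennreal" and k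
    using that measurable_cong_sets[OF N[of k] refl] measurable_cong_sets[OF s refl] by auto
  have sp: "space (N k) = space M" for k
    using N by (rule sets_eq_imp_space_eq)
  show ?thesis using f
  proof (induction rule: borel_measurable_induct)
    case (cong f g)
    have "(\<integral>\<^sup>+x. f x \<partial>suminf_measure N) = (\<integral>\<^sup>+x. g x \<partial>suminf_measure N)"
      using cong by (intro nn_integral_cong) (simp add: sp)
    moreover have "(\<integral>\<^sup>+x. f x \<partial>N k) = (\<integral>\<^sup>+x. g x \<partial>N k)" for k
      using cong by (intro nn_integral_cong) (simp add: sp)
    ultimately show ?case
      using cong by simp
  next
    case (set A)
    then show ?case
      by (simp add: N emeasure_suminf_measure[OF N])
  next
    case (mult u c)
    then show ?case
      by (simp add: nn_integral_cmult m)
  next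
    case (add u v)
    then show ?case
      by (simp add: nn_integral_add m suminf_add)
  next
    case (seq U)
    have "(\<integral>\<^sup>+x. (SUP i. U i) x \<partial>suminf_measure N) = (SUP i. \<integral>\<^sup>+x. U i x \<partial>suminf_measure N)"
      using seq unfolding SUP_apply by (intro nn_integral_monotone_convergence_SUP m)
    also have "\<dots> = (SUP i. \<Sum>k. \<integral>\<^sup>+x. U i x \<partial>N k)"
      using seq by simp
    also have "\<dots> = (\<Sum>k. SUP i. \<integral>\<^sup>+x. U i x \<partial>N k)"
      using seq(3) by (intro ennreal_suminf_SUP_eq[symmetric])
        (auto simp: incseq_def le_fun_def intro!: nn_integral_mono)
    also have "\<dots> = (\<Sum>k. \<integral>\<^sup>+x. (SUP i. U i) x \<partial>N k)"
      unfolding SUP_apply using seq(1,3)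
      by (intro suminf_cong nn_integral_monotone_convergence_SUP[symmetric] m)
    finally show ?case .
  qed
qed

section \<open>Laplace transforms of finite measures on the orthant and their closure
  properties\<close>

definition laplace_rep :: "nat \<Rightarrow> (nat \<Rightarrow> real) measure \<Rightarrow> ((nat \<Rightarrow> real) \<Rightarrow> real) \<Rightarrow> bool" where
  "laplace_rep n M \<psi> \<longleftrightarrow> sets M = sets (\<Pi>\<^sub>M i\<in>UNIV. borel) \<and> (AE x in M. \<forall>i. 0 \<le> x i) \<and>
     (\<forall>s. (\<forall>i. 0 \<le> s i) \<longrightarrow> 0 \<le> \<psi> s \<and>
        (\<integral>\<^sup>+x. ennreal (exp (- (\<Sum>i<n. s i * x i))) \<partial>M) = ennreal (\<psi> s))"

definition laplace_class :: "nat \<Rightarrow> ((nat \<Rightarrow> real) \<Rightarrow> real) set" where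
  "laplace_class n = {\<psi>. \<exists>M. laplace_rep n M \<psi>}"

lemma laplace_repD:
  assumes "laplace_rep n M \<psi>"
  shows "sets M = sets (\<Pi>\<^sub>M i\<in>UNIV. borel)" "AE x in M. \<forall>i. 0 \<le> x i"
    "\<And>s. (\<And>i. 0 \<le> s i) \<Longrightarrow> 0 \<le> \<psi> s"
    "\<And>s. (\<And>i. 0 \<le> s i) \<Longrightarrow> (\<integral>\<^sup>+x. ennreal (exp (- (\<Sum>i<n. s i * x i))) \<partial>M) = ennreal (\<psi> s)"
  using assms by (auto simp: laplace_rep_def)

lemma laplace_classI: "laplace_rep n M \<psi> \<Longrightarrow> \<psi> \<in> laplace_class n"
  by (auto simp: laplace_class_def)

lemma laplace_classE:
  assumes "\<psi> \<in> laplace_class n"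
  obtains M where "laplace_rep n M \<psi>"
  using assms by (auto simp: laplace_class_def)

lemma laplace_rep_finite_measure:
  assumes "laplace_rep n M \<psi>"
  shows "finite_measure M"
proof (rule finite_measureI)
  have "emeasure M (space M) = ennreal (\<psi> (\<lambda>_. 0))"
    using laplace_repD(4)[OF assms, of "\<lambda>_. 0"] by simp
  then show "emeasure M (space M) \<noteq> \<infinity>" by simp
qed

lemma laplace_class_nonneg: "\<psi> \<in> laplace_class n \<Longrightarrow> (\<And>i. 0 \<le> s i) \<Longrightarrow> 0 \<le> \<psi> s"
  by (auto simp: laplace_class_def laplace_rep_def)

text \<open>The integrand is at most 1 on the orthant, where the measure lives. A strict inequality
  at \<open>s = 0\<close> thereby controls a transform at all \<open>s\<close>.\<close>

lemma laplace_class_le: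
  assumes "\<psi> \<in> laplace_class n" "\<And>i. 0 \<le> s i"
  shows "\<psi> s \<le> \<psi> (\<lambda>_. 0)"
proof -
  obtain M where M: "laplace_rep n M \<psi>"
    using assms(1) by (rule laplace_classE)
  have "ennreal (\<psi> s) = (\<integral>\<^sup>+x. ennreal (exp (- (\<Sum>i<n. s i * x i))) \<partial>M)"
    using laplace_repD(4)[OF M assms(2)] by simp
  also have "\<dots> \<le> (\<integral>\<^sup>+x. ennreal (exp (- (\<Sum>i<n. 0 * x i))) \<partial>M)"
    using laplace_repD(2)[OF M]
    by (intro nn_integral_mono_AE) (auto intro!: sum_nonneg mult_nonneg_nonneg assms)
  also have "\<dots> = ennreal (\<psi> (\<lambda>_. 0))"
    by (rule laplace_repD(4)[OF M]) simp
  finally show ?thesis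
    using laplace_class_nonneg[OF assms(1), of "\<lambda>_. 0"] by (simp add: ennreal_le_iff)
qed

lemma laplace_class_cong:
  assumes "\<psi> \<in> laplace_class n" "\<And>s. (\<And>i. 0 \<le> s i) \<Longrightarrow> \<phi> s = \<psi> s"
  shows "\<phi> \<in> laplace_class n"
  using assms by (auto simp: laplace_class_def laplace_rep_def)

lemma borel_measurable_exp_sum:
  "(\<lambda>x :: nat \<Rightarrow> real. ennreal (exp (- (\<Sum>i<n. s i * x i)))) \<in> borel_measurable (\<Pi>\<^sub>M i\<in>UNIV. borel)"
  by measurable

text \<open>The representing measure is the sum of the \<open>M k\<close>. Convergence at
  \<open>s = 0\<close> keeps its total mass finite.\<close>

lemma laplace_class_suminf:
  assumes \<psi>: "\<And>k. \<psi> k \<in> laplace_class n"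
    and sums: "\<And>s. (\<And>i. 0 \<le> s i) \<Longrightarrow> (\<lambda>k. \<psi> k s) sums \<phi> s"
  shows "\<phi> \<in> laplace_class n"
proof -
  obtain M where "\<And>k. laplace_rep n (M k) (\<psi> k)"
    using \<psi> unfolding laplace_class_def mem_Collect_eq by metis
  note M = laplace_repD[OF this]
  let ?B = "(\<Pi>\<^sub>M i\<in>UNIV. borel) :: (nat \<Rightarrow> real) measure"
  have sets: "sets (suminf_measure M) = sets ?B"
    by (simp add: M(1))
  have space: "space (M k) = UNIV" "space (suminf_measure M) = UNIV" for k
    using sets_eq_imp_space_eq[OF M(1)] by (simp_all add: space_PiM)
  have N: "{x. \<exists>i. x i < (0::real)} \<in> sets ?B"
  proof -
    have "{x \<in> space ?B. \<exists>i. x i < 0} \<in> sets ?B" by measurable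
    then show ?thesis by (simp add: space_PiM)
  qed
  have "emeasure (M k) {x. \<exists>i. x i < 0} = 0" for k
    using M(2)[of k] by (subst (asm) AE_iff_measurable[OF _ refl]) (use N in \<open>auto simp: space M(1) not_le\<close>)
  then have null: "{x. \<exists>i. x i < (0::real)} \<in> null_sets (suminf_measure M)"
    using emeasure_suminf_measure[OF M(1) N] N by (simp add: null_sets_def M(1))
  have "laplace_rep n (suminf_measure M) \<phi>"
    unfolding laplace_rep_def
  proof (intro conjI allI impI)
    show "AE x in suminf_measure M. \<forall>i. 0 \<le> x i"
      by (rule AE_I'[OF null]) (auto simp: not_le)
    show "sets (suminf_measure M) = sets ?B" by (rule sets)
  next
    fix s :: "nat \<Rightarrow> real" assume "\<forall>i. 0 \<le> s i"
    then have s0: "\<And>i. 0 \<le> s i" by simp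
    show "0 \<le> \<phi> s"
      by (rule sums_le[OF M(3)[of s, OF s0] sums_zero sums[of s, OF s0]])
    have "(\<integral>\<^sup>+x. ennreal (exp (- (\<Sum>i<n. s i * x i))) \<partial>suminf_measure M) = (\<Sum>k. ennreal (\<psi> k s))"
      unfolding nn_integral_suminf_measure[OF M(1) borel_measurable_exp_sum]
      by (intro suminf_cong M(4) s0)
    also have "\<dots> = ennreal (\<phi> s)"
      unfolding sums_unique[OF sums[of s, OF s0]]
      by (rule suminf_ennreal2[OF M(3)[of s, OF s0] sums_summable[OF sums[of s, OF s0]]])
    finally show "(\<integral>\<^sup>+x. ennreal (exp (- (\<Sum>i<n. s i * x i))) \<partial>suminf_measure M) = ennreal (\<phi> s)" .
  qed
  then show ?thesis by (rule laplace_classI)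
qed

lemma laplace_class_0: "(\<lambda>_. 0) \<in> laplace_class n"
proof (rule laplace_classI)
  let ?M = "null_measure (\<Pi>\<^sub>M i\<in>UNIV. borel) :: (nat \<Rightarrow> real) measure"
  have "AE x in ?M. \<forall>i. 0 \<le> x i"
    by (rule AE_I'[where N="space ?M"]) (simp_all add: null_sets_def)
  then show "laplace_rep n ?M (\<lambda>_. 0)"
    by (simp add: laplace_rep_def)
qed

lemma laplace_class_add:
  assumes "\<psi> \<in> laplace_class n" "\<phi> \<in> laplace_class n"
  shows "(\<lambda>s. \<psi> s + \<phi> s) \<in> laplace_class n"
proof (rule laplace_class_suminf)
  let ?f = "\<lambda>k::nat. if k = 0 then \<psi> else if k = 1 then \<phi> else (\<lambda>_. 0)"
  show "?f k \<in> laplace_class n" for k using assms by (auto simp: laplace_class_0)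
  show "(\<lambda>k. ?f k s) sums (\<psi> s + \<phi> s)" for s
    using sums_finite[of "{0,1}" "\<lambda>k. ?f k s"] by auto
qed

lemma laplace_class_cmult:
  assumes "\<psi> \<in> laplace_class n" "0 \<le> c"
  shows "(\<lambda>s. c * \<psi> s) \<in> laplace_class n"
proof -
  obtain M where M: "laplace_rep n M \<psi>"
    using assms(1) by (rule laplace_classE)
  have [measurable_cong]: "sets M = sets (\<Pi>\<^sub>M i\<in>UNIV. borel)"
    using M by (rule laplace_repD)
  show ?thesis
  proof (intro laplace_classI[where M="density M (\<lambda>_. ennreal c)"] laplace_rep_def[THEN iffD2] conjI allI impI)
    show "AE x in density M (\<lambda>_. ennreal c). \<forall>i. 0 \<le> x i"
      using laplace_repD(2)[OF M] by (auto simp: AE_density)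
    fix s :: "nat \<Rightarrow> real" assume s: "\<forall>i. 0 \<le> s i"
    show "0 \<le> c * \<psi> s"
      using assms s by (simp add: laplace_class_nonneg)
    show "(\<integral>\<^sup>+x. ennreal (exp (- (\<Sum>i<n. s i * x i))) \<partial>density M (\<lambda>_. ennreal c)) = ennreal (c * \<psi> s)"
      using s assms laplace_repD(3,4)[OF M, of s]
      by (subst nn_integral_density) (simp_all add: nn_integral_cmult ennreal_mult)
  qed (simp add: laplace_repD(1)[OF M])
qed

lemma laplace_class_sum:
  "finite A \<Longrightarrow> (\<And>k. k \<in> A \<Longrightarrow> \<psi> k \<in> laplace_class n) \<Longrightarrow> (\<lambda>s. \<Sum>k\<in>A. \<psi> k s) \<in> laplace_class n"
  by (induction A rule: finite_induct) (auto simp: laplace_class_0 intro!: laplace_class_add)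

text \<open>Addition of independent vectors: the image of the product measure under the sum, that is
  the convolution, has the product as its transform.\<close>

lemma laplace_class_mult:
  assumes "\<psi> \<in> laplace_class n" "\<phi> \<in> laplace_class n"
  shows "(\<lambda>s. \<psi> s * \<phi> s) \<in> laplace_class n"
proof -
  obtain M N where MN: "laplace_rep n M \<psi>" "laplace_rep n N \<phi>"
    using assms by (auto simp: laplace_class_def)
  note M = laplace_repD[OF MN(1)] and N = laplace_repD[OF MN(2)]
  interpret M: finite_measure M using MN(1) by (rule laplace_rep_finite_measure)
  interpret N: finite_measure N using MN(2) by (rule laplace_rep_finite_measure)
  interpret pair_sigma_finite M N ..
  note [measurable_cong] = M(1) N(1)
  let ?D = "distr (M \<Otimes>\<^sub>M N) (\<Pi>\<^sub>M i\<in>UNIV. borel) (\<lambda>(x, y) i. x i + y i :: real)"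
  have [measurable]: "(\<lambda>(x, y) i. x i + y i :: real) \<in> measurable (M \<Otimes>\<^sub>M N) (\<Pi>\<^sub>M i\<in>(UNIV::nat set). borel)"
    by (rule measurable_PiM_single') (auto simp: split_beta')
  show ?thesis
  proof (intro laplace_classI[of n ?D] laplace_rep_def[THEN iffD2] conjI allI impI)
    have "AE z in M \<Otimes>\<^sub>M N. \<forall>i. 0 \<le> fst z i + snd z i"
    proof (rule AE_pair_measure)
      show "{x \<in> space (M \<Otimes>\<^sub>M N). \<forall>i. 0 \<le> fst x i + snd x i} \<in> sets (M \<Otimes>\<^sub>M N)" by measurable
      show "AE x in M. AE y in N. \<forall>i. 0 \<le> fst (x, y) i + snd (x, y) i"
        using M(2)
      proof eventually_elim
        case (elim x)
        show ?case using N(2) by eventually_elim (use elim in auto)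
      qed
    qed
    then show "AE x in ?D. \<forall>i. 0 \<le> x i"
      by (subst AE_distr_iff) (auto simp: split_beta')
  next
    fix s :: "nat \<Rightarrow> real" assume "\<forall>i. 0 \<le> s i"
    then have s0: "\<And>i. 0 \<le> s i" by simp
    show "0 \<le> \<psi> s * \<phi> s"
      using assms s0 by (simp add: laplace_class_nonneg)
    have "(\<integral>\<^sup>+x. ennreal (exp (- (\<Sum>i<n. s i * x i))) \<partial>?D)
      = (\<integral>\<^sup>+z. ennreal (exp (- (\<Sum>i<n. s i * fst z i))) * ennreal (exp (- (\<Sum>i<n. s i * snd z i))) \<partial>(M \<Otimes>\<^sub>M N))"
      by (subst nn_integral_distr)
         (auto simp: split_beta' ennreal_mult'[symmetric] exp_add[symmetric] distrib_left sum.distrib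
           intro!: nn_integral_cong)
    also have "\<dots> = (\<integral>\<^sup>+x. \<integral>\<^sup>+y. ennreal (exp (- (\<Sum>i<n. s i * x i))) * ennreal (exp (- (\<Sum>i<n. s i * y i))) \<partial>N \<partial>M)"
      by (subst N.nn_integral_fst[symmetric]) auto
    also have "\<dots> = ennreal (\<psi> s * \<phi> s)"
      using s0 assms
      by (simp add: nn_integral_cmult nn_integral_multc M(4) N(4) ennreal_mult laplace_class_nonneg)
    finally show "(\<integral>\<^sup>+x. ennreal (exp (- (\<Sum>i<n. s i * x i))) \<partial>?D) = ennreal (\<psi> s * \<phi> s)" .
  qed simp
qed

lemma laplace_class_1: "(\<lambda>_. 1) \<in> laplace_class n"
proof -
  let ?M = "return (\<Pi>\<^sub>M i\<in>UNIV. borel) (\<lambda>_. 0::real) :: (nat \<Rightarrow> real) measure"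
  show ?thesis unfolding laplace_class_def
    by (intro CollectI exI[of _ ?M] laplace_rep_def[THEN iffD2] conjI allI impI)
       (auto simp: nn_integral_return[OF _ borel_measurable_exp_sum] space_PiM AE_return)
qed

lemma laplace_class_power: "\<psi> \<in> laplace_class n \<Longrightarrow> (\<lambda>s. \<psi> s ^ k) \<in> laplace_class n"
  by (induction k) (auto simp: laplace_class_1 intro: laplace_class_mult)

text \<open>The representing measure is the gamma law of shape \<open>b\<close> and rate
  \<open>a\<close>, divided by \<open>a powr b\<close> and carried by the \<open>j\<close>-th
  axis.\<close>

lemma laplace_class_gamma:
  assumes "j < n" "0 < a" "0 < b"
  shows "(\<lambda>s. (a + s j) powr - b) \<in> laplace_class n"
proof -
  define D :: "real measure" where "D = density lborel (\<lambda>x. ennreal (indicator {0..} x * (x powr (b - 1) * exp (- a * x) / Gamma b)))"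
  have [measurable_cong, simp]: "sets D = sets borel" by (simp add: D_def)
  have [simp]: "space D = UNIV" by (simp add: D_def)
  define f :: "real \<Rightarrow> nat \<Rightarrow> real" where "f x i = (if i = j then x else 0)" for x i
  have [measurable]: "f \<in> measurable D (\<Pi>\<^sub>M i\<in>UNIV. borel)"
    by (rule measurable_PiM_single') (auto simp: f_def)
  have G: "0 < Gamma b" using assms by (rule_tac Gamma_real_pos) auto
  have lap: "(\<integral>\<^sup>+x. ennreal (exp (- (s * x))) \<partial>D) = ennreal ((a + s) powr - b)" if "0 \<le> s" for s
  proof -
    have c: "0 < a + s" using that assms by simp
    have "(\<integral>\<^sup>+x. ennreal (indicator {0..} x * (x powr (b - 1) / exp x)) \<partial>lborel) = ennreal (Gamma b)"
    proof (rule nn_integral_has_integral_lborel)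
      have "((\<lambda>x. if x \<in> {0..} then x powr (b - 1) / exp x else 0) has_integral Gamma b) UNIV"
        using Gamma_integral_real[OF assms(3)] by (subst has_integral_restrict_UNIV)
      then show "((\<lambda>x. indicator {0..} x * (x powr (b - 1) / exp x)) has_integral Gamma b) UNIV"
        by (rule has_integral_eq[rotated]) auto
    qed (auto simp: indicator_def)
    \<comment> \<open>Substitution of \<open>(a + s) * x\<close> for the variable in the Gamma
      integral.\<close>
    then have "ennreal (Gamma b) = ennreal (a + s) * (\<integral>\<^sup>+x. ennreal (indicator {0..} ((a + s) * x) * (((a + s) * x) powr (b - 1) / exp ((a + s) * x))) \<partial>lborel)"
      using c by (subst (asm) nn_integral_real_affine[where c="a + s" and t=0]) simp_all
    also have "\<dots> = (\<integral>\<^sup>+x. ennreal (Gamma b * (a + s) powr b) * ennreal (indicator {0..} x * (x powr (b - 1) * exp (- (a + s) * x) / Gamma b)) \<partial>lborel)"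
    proof (subst nn_integral_cmult[symmetric], simp, intro nn_integral_cong)
      fix x :: real
      have "(a + s) * (indicator {0..} ((a + s) * x) * (((a + s) * x) powr (b - 1) / exp ((a + s) * x)))
        = Gamma b * (a + s) powr b * (indicator {0..} x * (x powr (b - 1) * exp (- (a + s) * x) / Gamma b))"
      proof (cases "0 \<le> x")
        case True
        have "(a + s) * (a + s) powr (b - 1) = (a + s) powr b"
          using c by (simp add: powr_mult_base)
        moreover have "((a + s) * x) powr (b - 1) = (a + s) powr (b - 1) * x powr (b - 1)"
          using c True by (simp add: powr_mult)
        moreover have "0 \<le> (a + s) * x" using c True by simp
        moreover have "exp (- (a + s) * x) = inverse (exp ((a + s) * x))"
          by (simp add: exp_minus[symmetric] algebra_simps)
        ultimately show ?thesis
          using True G by (simp add: divide_inverse mult_ac)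
      qed (use c in \<open>simp add: zero_le_mult_iff\<close>)
      then show "ennreal (a + s) * ennreal (indicator {0..} ((a + s) * x) * (((a + s) * x) powr (b - 1) / exp ((a + s) * x)))
        = ennreal (Gamma b * (a + s) powr b) * ennreal (indicator {0..} x * (x powr (b - 1) * exp (- (a + s) * x) / Gamma b))"
        using c G by (simp add: ennreal_mult'[symmetric])
    qed
    also have "\<dots> = ennreal (Gamma b * (a + s) powr b) * (\<integral>\<^sup>+x. ennreal (indicator {0..} x * (x powr (b - 1) * exp (- (a + s) * x) / Gamma b)) \<partial>lborel)"
      by (rule nn_integral_cmult) simp
    finally have *: "ennreal (Gamma b) = ennreal (Gamma b * (a + s) powr b) * (\<integral>\<^sup>+x. ennreal (indicator {0..} x * (x powr (b - 1) * exp (- (a + s) * x) / Gamma b)) \<partial>lborel)"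
      (is "_ = _ * ?I") .
    \<comment> \<open>The factor in front of \<open>?I\<close> is positive and finite, so
      multiplying by its reciprocal isolates \<open>?I\<close>.\<close>
    have "?I = ennreal ((a + s) powr - b / Gamma b) * ennreal (Gamma b * (a + s) powr b) * ?I"
      using c G by (simp add: ennreal_mult'[symmetric] powr_minus)
    also have "\<dots> = ennreal ((a + s) powr - b / Gamma b) * ennreal (Gamma b)"
      unfolding mult.assoc *[symmetric] ..
    also have "\<dots> = ennreal ((a + s) powr - b)"
      using c G by (simp add: ennreal_mult'[symmetric])
    finally have I: "?I = ennreal ((a + s) powr - b)" .
    have "(\<integral>\<^sup>+x. ennreal (exp (- (s * x))) \<partial>D) = ?I"
      unfolding D_def
    proof (subst nn_integral_density, simp, simp, intro nn_integral_cong)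
      fix x :: real
      have "exp (- a * x) * exp (- (s * x)) = exp (- (a + s) * x)"
        by (simp add: exp_add[symmetric] algebra_simps)
      then have "indicator {0..} x * (x powr (b - 1) * exp (- a * x) / Gamma b) * exp (- (s * x))
          = indicator {0..} x * (x powr (b - 1) * exp (- (a + s) * x) / Gamma b)"
        by (metis (no_types) mult.assoc times_divide_eq_left)
      then show "ennreal (indicator {0..} x * (x powr (b - 1) * exp (- a * x) / Gamma b)) * ennreal (exp (- (s * x)))
        = ennreal (indicator {0..} x * (x powr (b - 1) * exp (- (a + s) * x) / Gamma b))"
        by (simp only: ennreal_mult''[OF exp_ge_zero, symmetric])
    qed
    then show ?thesis using I by simp
  qed
  show ?thesis
  proof (intro laplace_classI[where M="distr D (\<Pi>\<^sub>M i\<in>UNIV. borel) f"] laplace_rep_def[THEN iffD2] conjI allI impI)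
    have "AE x in D. 0 \<le> x"
      unfolding D_def by (subst AE_density) (simp_all add: indicator_def)
    then show "AE x in distr D (Pi\<^sub>M UNIV (\<lambda>i. borel)) f. \<forall>i. 0 \<le> x i"
      by (subst AE_distr_iff) (auto simp: f_def)
  next
    fix s :: "nat \<Rightarrow> real" assume s: "\<forall>i. 0 \<le> s i"
    show "0 \<le> (a + s j) powr - b" by simp
    have "(\<Sum>i<n. s i * f x i) = s j * x" for x
      using assms by (simp add: f_def if_distrib cong: if_cong)
    then show "(\<integral>\<^sup>+x. ennreal (exp (- (\<Sum>i<n. s i * x i))) \<partial>distr D (Pi\<^sub>M UNIV (\<lambda>i. borel)) f) = ennreal ((a + s j) powr - b)"
      using lap[of "s j"] s by (subst nn_integral_distr) auto
  qed simp
qed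

text \<open>With \<open>c = a + s j\<close>, the binomial series of
  \<open>(c - \<sigma> s) powr - b\<close> has the terms \<open>pochhammer b k / fact k * (\<sigma>
  s ^ k * c powr - (b + k))\<close>: a nonnegative coefficient, a power of a transform and a gamma
  transform. It converges since
  \<open>\<sigma> s \<le> \<sigma> (\<lambda>_. 0) < a \<le> c\<close>.\<close>

lemma laplace_class_powr_diff:
  assumes \<sigma>: "\<sigma> \<in> laplace_class n" and j: "j < n" and a: "\<sigma> (\<lambda>_. 0) < a" and b: "0 < b"
  shows "(\<lambda>s. (a + s j - \<sigma> s) powr - b) \<in> laplace_class n"
proof (rule laplace_class_suminf)
  have a0: "0 < a" using laplace_class_nonneg[OF \<sigma>, of "\<lambda>_. 0"] a by simp
  let ?f = "\<lambda>k s. pochhammer b k / fact k * (\<sigma> s ^ k * (a + s j) powr - (b + real k))"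
  show "?f k \<in> laplace_class n" for k
    using a0 b j \<sigma>
    by (intro laplace_class_cmult laplace_class_mult laplace_class_power laplace_class_gamma)
       (auto intro!: divide_nonneg_nonneg pochhammer_nonneg)
  fix s :: "nat \<Rightarrow> real" assume s: "\<And>i. 0 \<le> s i"
  have \<sigma>s: "0 \<le> \<sigma> s" "\<sigma> s < a + s j"
    using laplace_class_nonneg[OF \<sigma>, of s, OF s] laplace_class_le[OF \<sigma>, of s, OF s] a s[of j] by auto
  let ?c = "a + s j"
  have c: "0 < ?c" using a0 s[of j] by simp
  \<comment> \<open>The sign of \<open>z\<close> cancels the alternating sign of the generalised
    binomial coefficient at \<open>- b\<close>.\<close>
  define z where "z = - (\<sigma> s / ?c)"
  have "\<bar>z\<bar> < 1" using \<sigma>s c by (simp add: z_def)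
  from sums_mult[OF gen_binomial_real[OF this, of "- b"], of "?c powr - b"]
  have *: "(\<lambda>k. ?c powr - b * (((- b) gchoose k) * z ^ k)) sums (?c powr - b * (1 + z) powr - b)" .
  have "?c powr - b * (((- b) gchoose k) * z ^ k) = ?f k s" for k
  proof -
    have zk: "z ^ k = (- 1) ^ k * (\<sigma> s / ?c) ^ k"
      unfolding z_def by (rule power_minus)
    have "((- b) gchoose k) * z ^ k = pochhammer b k / fact k * (((- 1) ^ k * (- 1) ^ k) * (\<sigma> s / ?c) ^ k)"
      unfolding gbinomial_pochhammer zk minus_minus
      by (simp only: times_divide_eq_left times_divide_eq_right mult.assoc mult.left_commute mult.commute)
    also have "(- 1) ^ k * (- 1) ^ k = (1 :: real)"
      by (cases "even k") auto
    finally have e: "((- b) gchoose k) * z ^ k = pochhammer b k / fact k * (\<sigma> s ^ k * inverse (?c ^ k))"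
      by (simp only: mult_1 divide_inverse[of "\<sigma> s"] power_mult_distrib power_inverse)
    have "- (b + real k) = - b + - real k" by simp
    then have "?c powr - (b + real k) = ?c powr - b * inverse (?c ^ k)"
      by (simp only: powr_add powr_minus[of ?c "real k"] powr_realpow[OF c])
    then show ?thesis unfolding e by (simp only: mult_ac)
  qed
  moreover have "?c powr - b * (1 + z) powr - b = (a + s j - \<sigma> s) powr - b"
  proof -
    have "?c * (1 + z) = a + s j - \<sigma> s"
      using c by (simp add: z_def field_simps)
    moreover have "0 \<le> 1 + z" using \<sigma>s c by (simp add: z_def)
    ultimately show ?thesis using c powr_mult[of ?c "1 + z" "- b"] by simp
  qed
  ultimately show "(\<lambda>k. ?f k s) sums ((a + s j - \<sigma> s) powr - b)"
    using * by simp
qed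

section \<open>Determinants of Z-matrices\<close>

text \<open>Gaussian elimination of the last row: \<open>l\<close> plays the part of the last row
  times the inverse of the leading block, and \<open>?L\<close> subtracts the combination
  \<open>l\<close> of the first rows, which leaves a block upper triangular matrix.\<close>

lemma det_Suc_schur:
  fixes M :: "nat \<Rightarrow> nat \<Rightarrow> 'a :: idom"
  assumes l: "\<And>j. j < n \<Longrightarrow> (\<Sum>i<n. l i * M i j) = M n j"
  shows "Determinant.det (Matrix.mat (Suc n) (Suc n) (\<lambda>(i, j). M i j))
    = Determinant.det (Matrix.mat n n (\<lambda>(i, j). M i j)) * (M n n - (\<Sum>i<n. l i * M i n))"
proof -
  let ?M = "Matrix.mat (Suc n) (Suc n) (\<lambda>(i, j). M i j)"
  let ?L = "Matrix.mat (Suc n) (Suc n) (\<lambda>(i, j). if i = j then 1 else if i = n then - l j else 0)"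
  let ?N = "four_block_mat (Matrix.mat n n (\<lambda>(i, j). M i j)) (Matrix.mat n 1 (\<lambda>(i, j). M i n))
     (0\<^sub>m 1 n) (Matrix.mat 1 1 (\<lambda>_. M n n - (\<Sum>i<n. l i * M i n)))"
  have det1: "Determinant.det (Matrix.mat 1 1 (\<lambda>_. c)) = c" for c :: 'a
    by (subst det_lower_triangular[of 1]) (auto simp: diag_mat_def)
  have "Determinant.det ?L = 1"
  proof (subst det_lower_triangular[of "Suc n"])
    show "prod_list (diag_mat ?L) = 1"
      by (auto simp: prod_list_diag_prod intro!: prod.neutral)
  qed auto
  have "?L * ?M = ?N"
  proof (rule eq_matI)
    fix i j assume ij: "i < dim_row ?N" "j < dim_col ?N"
    then have ij': "i < Suc n" "j < Suc n" by auto
    have "(?L * ?M) $$ (i, j) = (\<Sum>k<Suc n. (if i = k then 1 else if i = n then - l k else 0) * M k j)"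
      using ij' by (simp add: scalar_prod_def atLeast0LessThan)
    also have "\<dots> = ?N $$ (i, j)"
    proof (cases "i < n")
      case True
      then have "(\<Sum>k<Suc n. (if i = k then 1 else if i = n then - l k else 0) * M k j) = (\<Sum>k<Suc n. if k = i then M k j else 0)"
        by (intro sum.cong) auto
      also have "\<dots> = M i j"
        using ij' by (subst sum.delta) auto
      finally show ?thesis
        using True ij' by (auto simp: less_Suc_eq)
    next
      case False
      then have i: "i = n" using ij' by simp
      have "(\<Sum>k<Suc n. (if i = k then 1 else if i = n then - l k else 0) * M k j) = M n j + (\<Sum>k<n. - l k * M k j)"
        unfolding i by (auto intro!: sum.cong)
      also have "\<dots> = M n j - (\<Sum>k<n. l k * M k j)"
        by (simp add: sum_negf)
      finally show ?thesis
        using l[of j] ij' by (auto simp: i less_Suc_eq)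
    qed
    finally show "(?L * ?M) $$ (i, j) = ?N $$ (i, j)" .
  qed auto
  moreover have "Determinant.det (?L * ?M) = Determinant.det ?L * Determinant.det ?M"
    by (rule det_mult[of _ "Suc n"]) auto
  moreover have "Determinant.det ?N = Determinant.det (Matrix.mat n n (\<lambda>(i, j). M i j)) * (M n n - (\<Sum>i<n. l i * M i n))"
    by (subst det_four_block_mat_lower_left_zero[of _ n _ 1]) (auto simp: det1[simplified])
  ultimately show ?thesis
    using \<open>Determinant.det ?L = 1\<close> by simp
qed

abbreviation shifted_det :: "(nat \<Rightarrow> nat \<Rightarrow> real) \<Rightarrow> nat \<Rightarrow> (nat \<Rightarrow> real) \<Rightarrow> real" where
  "shifted_det A n s \<equiv> Determinant.det (Matrix.mat n n (\<lambda>(i, j). A i j + (if i = j then s i else 0)))"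

text \<open>\<open>R\<close> is the inverse of \<open>A + S\<close>, entrywise a transform. It is
  carried through the induction because the Schur complement of the next step is built from
  it.\<close>

definition laplace_resolvent ::
  "nat \<Rightarrow> nat \<Rightarrow> (nat \<Rightarrow> nat \<Rightarrow> real) \<Rightarrow> (nat \<Rightarrow> nat \<Rightarrow> (nat \<Rightarrow> real) \<Rightarrow> real) \<Rightarrow> bool" where
  "laplace_resolvent N n A R \<longleftrightarrow> (\<forall>i<n. \<forall>j<n. R i j \<in> laplace_class N) \<and>
     (\<forall>s. (\<forall>i. 0 \<le> s i) \<longrightarrow> (\<forall>i<n. \<forall>k<n.
        (\<Sum>j<n. R i j s * (A j k + (if j = k then s j else 0))) = (if i = k then 1 else 0)))"

lemma laplace_resolventD:
  assumes "laplace_resolvent N n A R" "i < n" "j < n"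
  shows "R i j \<in> laplace_class N"
    and "(\<And>i. 0 \<le> s i) \<Longrightarrow>
      (\<Sum>k<n. R i k s * (A k j + (if k = j then s k else 0))) = (if i = j then 1 else 0)"
  using assms by (simp_all add: laplace_resolvent_def)

text \<open>Induction on \<open>n\<close>: by the Schur complement \<open>det (A + S)\<close> acquires the factor
  \<open>A n n + s n - \<sigma> s\<close> with \<open>\<sigma>\<close> a Laplace transform, and the binomial series of
  \<open>(a + s n - \<sigma> s) powr - b\<close> has nonnegative coefficients.\<close>

lemma z_matrix_laplace_class:
  fixes A :: "nat \<Rightarrow> nat \<Rightarrow> real"
  assumes "n \<le> N"
    and Z: "\<And>i j. i < n \<Longrightarrow> j < n \<Longrightarrow> i \<noteq> j \<Longrightarrow> A i j \<le> 0"
    and x: "\<And>i. i < n \<Longrightarrow> 0 < x i"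
    and Ax: "\<And>i. i < n \<Longrightarrow> 0 < (\<Sum>j<n. A i j * x j)"
  shows "\<exists>R. laplace_resolvent N n A R" (is ?R)
    and "\<And>s. (\<And>i. 0 \<le> s i) \<Longrightarrow> 0 < shifted_det A n s" (is "PROP ?P")
    and "\<And>b. 0 < b \<Longrightarrow> (\<lambda>s. shifted_det A n s powr - b) \<in> laplace_class N" (is "PROP ?Q")
proof -
  have "?R \<and> (\<forall>s. (\<forall>i. 0 \<le> s i) \<longrightarrow> 0 < shifted_det A n s) \<and>
    (\<forall>b>0. (\<lambda>s. shifted_det A n s powr - b) \<in> laplace_class N)"
    using assms
proof (induction n)
  case 0
  have "shifted_det A 0 s = 1" for s
    by (rule det_dim_zero) simp
  then show ?case
    by (auto simp: laplace_class_1 laplace_resolvent_def)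
next
  case (Suc n)
  let ?D = "shifted_det A"
  have n: "n < N" using Suc.prems(1) by simp
  have Axn: "0 < (\<Sum>j<n. A i j * x j)" if "i < n" for i
  proof -
    have "0 < (\<Sum>j<n. A i j * x j) + A i n * x n"
      using Suc.prems(4)[of i] that by simp
    moreover have "A i n * x n \<le> 0"
      using Suc.prems(2)[of i n] Suc.prems(3)[of n] that by (simp add: mult_nonpos_nonneg)
    ultimately show ?thesis by simp
  qed
  have IH: "(\<exists>R. laplace_resolvent N n A R) \<and> (\<forall>s. (\<forall>i. 0 \<le> s i) \<longrightarrow> 0 < ?D n s) \<and>
    (\<forall>b>0. (\<lambda>s. ?D n s powr - b) \<in> laplace_class N)"
    by (rule Suc.IH) (use Suc.prems Axn in auto)
  obtain R where "laplace_resolvent N n A R"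
    using IH[THEN conjunct1] by (rule exE)
  note R = laplace_resolventD(1)[OF this] and RA = laplace_resolventD(2)[OF this]
  have D: "0 < ?D n s" if "\<And>i. 0 \<le> s i" for s
    by (rule IH[THEN conjunct2, THEN conjunct1, THEN spec, THEN mp]) (simp add: that)
  have Db: "(\<lambda>s. ?D n s powr - b) \<in> laplace_class N" if "0 < b" for b
    using IH that by simp
  \<comment> \<open>\<open>p\<close> and \<open>q\<close> are \<open>R\<close> applied to the
    negated last column and the negated last row. Off-diagonal entries are nonpositive, so these are
    nonnegative combinations of transforms, and so is \<open>\<sigma>\<close>, the row times
    \<open>R\<close> times the column.\<close>
  define p where "p i s = (\<Sum>j<n. R i j s * - A j n)" for i s
  define q where "q j s = (\<Sum>i<n. - A n i * R i j s)" for j s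
  define \<sigma> where "\<sigma> s = (\<Sum>j<n. q j s * - A j n)" for s
  have \<sigma>_alt: "\<sigma> s = (\<Sum>i<n. - A n i * p i s)" for s
    unfolding \<sigma>_def p_def q_def sum_distrib_left sum_distrib_right
    by (subst sum.swap) (simp add: mult_ac)
  have An: "0 \<le> - A j n" "0 \<le> - A n j" if "j < n" for j
    using Suc.prems(2)[of j n] Suc.prems(2)[of n j] that by auto
  have p: "p i \<in> laplace_class N" if "i < n" for i
    unfolding p_def
    by (intro laplace_class_sum, simp, subst mult.commute, intro laplace_class_cmult) (use R An that in auto)
  have q: "q i \<in> laplace_class N" if "i < n" for i
    unfolding q_def by (intro laplace_class_sum laplace_class_cmult) (use R An that in auto)
  have \<sigma>: "\<sigma> \<in> laplace_class N"
    unfolding \<sigma>_def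
    by (intro laplace_class_sum, simp, subst mult.commute, intro laplace_class_cmult) (use q An in auto)
  have qA: "(\<Sum>j<n. q j s * (A j k + (if j = k then s j else 0))) = - A n k"
    if s: "\<And>i. 0 \<le> s i" and k: "k < n" for s k
  proof -
    have "(\<Sum>j<n. q j s * (A j k + (if j = k then s j else 0)))
      = (\<Sum>i<n. - A n i * (\<Sum>j<n. R i j s * (A j k + (if j = k then s j else 0))))"
      unfolding q_def sum_distrib_left sum_distrib_right
      by (subst sum.swap) (simp only: mult.assoc)
    also have "\<dots> = (\<Sum>i<n. if i = k then - A n i else 0)"
      using RA[of _ k s, OF _ k s] by (intro sum.cong) auto
    also have "\<dots> = - A n k" using k by simp
    finally show ?thesis .
  qed
  \<comment> \<open>The positive vector \<open>x\<close> enters here. Applying \<open>R\<close> at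
    \<open>s = 0\<close>, which has nonnegative entries, to
    \<open>- A j n * x n \<le> (\<Sum>k<n. A j k * x k)\<close> bounds \<open>p i * x n\<close> by
    \<open>x i\<close>, and row \<open>n\<close> of the hypothesis on \<open>A x\<close> then yields
    the strict bound.\<close>
  have \<sigma>0: "\<sigma> (\<lambda>_. 0) < A n n"
  proof -
    let ?r = "\<lambda>i j. R i j (\<lambda>_. 0)"
    have xn: "0 < x n" and [simp]: "\<And>i. i < n \<Longrightarrow> 0 < x i" using Suc.prems(3) by auto
    have le: "p i (\<lambda>_. 0) * x n \<le> x i" if i: "i < n" for i
    proof -
      have "x i = (\<Sum>k<n. (\<Sum>j<n. ?r i j * (A j k + (if j = k then 0 else 0))) * x k)"
        using RA[of i _ "\<lambda>_. 0"] i by (simp add: if_distrib[of "\<lambda>y. y * _"] cong: if_cong)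
      also have "\<dots> = (\<Sum>j<n. ?r i j * (\<Sum>k<n. A j k * x k))"
        unfolding sum_distrib_left sum_distrib_right by (subst sum.swap) (simp add: mult_ac)
      also have "\<dots> \<ge> (\<Sum>j<n. ?r i j * (- A j n * x n))"
      proof (intro sum_mono mult_left_mono)
        fix j assume "j \<in> {..<n}"
        then show "- A j n * x n \<le> (\<Sum>k<n. A j k * x k)" "0 \<le> ?r i j"
          using Suc.prems(4)[of j] laplace_class_nonneg[OF R[OF i], of j "\<lambda>_. 0"] by auto
      qed
      finally show ?thesis unfolding p_def by (simp add: sum_distrib_right mult.assoc)
    qed
    have "\<sigma> (\<lambda>_. 0) * x n = (\<Sum>i<n. - A n i * (p i (\<lambda>_. 0) * x n))"
      unfolding \<sigma>_alt by (simp add: sum_distrib_right mult.assoc)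
    also have "\<dots> \<le> (\<Sum>i<n. - A n i * x i)"
      by (intro sum_mono mult_left_mono) (use le An in auto)
    also have "\<dots> < A n n * x n"
      using Suc.prems(4)[of n] by (simp add: sum_negf)
    finally show ?thesis using xn by simp
  qed
  \<comment> \<open>\<open>w\<close> is the reciprocal of the Schur complement, the lower right
    entry of the new inverse.\<close>
  define w where "w s = (A n n + s n - \<sigma> s) powr - 1" for s :: "nat \<Rightarrow> real"
  have w: "w \<in> laplace_class N"
    unfolding w_def using laplace_class_powr_diff[OF \<sigma> n \<sigma>0, of 1] by simp
  have pos: "0 < A n n + s n - \<sigma> s" if s: "\<And>i. 0 \<le> s i" for s
    using laplace_class_le[OF \<sigma>, of s, OF s] \<sigma>0 s[of n] by simp
  have w1: "w s * (A n n + s n - \<sigma> s) = 1" if s: "\<And>i. 0 \<le> s i" for s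
    using pos[of s, OF s] by (simp add: w_def powr_minus)
  have Dn: "?D (Suc n) s = ?D n s * (A n n + s n - \<sigma> s)" if s: "\<And>i. 0 \<le> s i" for s
  proof -
    have "(\<Sum>i<n. - q i s * (A i j + (if i = j then s i else 0))) = A n j + (if n = j then s n else 0)" if "j < n" for j
      using qA[of s, OF s that] that by (simp add: sum_negf)
    from det_Suc_schur[of n "\<lambda>i. - q i s" "\<lambda>i j. A i j + (if i = j then s i else 0)", OF this]
    have "?D (Suc n) s = ?D n s * (A n n + s n - (\<Sum>i<n. - q i s * (A i n + (if i = n then s i else 0))))"
      by simp
    also have "(\<Sum>i<n. - q i s * (A i n + (if i = n then s i else 0))) = \<sigma> s"
      unfolding \<sigma>_def by (intro sum.cong) auto
    finally show ?thesis .
  qed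
  \<comment> \<open>Block inversion of \<open>A + S\<close> with leading inverse \<open>R\<close>
    and corner \<open>w\<close>. The blocks are sums of products of transforms because
    \<open>p\<close> and \<open>q\<close> already carry the signs.\<close>
  define R' where "R' i j s = (if i < n then (if j < n then R i j s + p i s * w s * q j s else p i s * w s)
    else (if j < n then w s * q j s else w s))" for i j s
  have R': "R' i j \<in> laplace_class N" if "i < Suc n" "j < Suc n" for i j
    using p q w R that unfolding R'_def
    by (cases "i < n"; cases "j < n") (simp_all add: laplace_class_add laplace_class_mult)
  have R'A: "(\<Sum>j<Suc n. R' i j s * (A j k + (if j = k then s j else 0))) = (if i = k then 1 else 0)"
    if s: "\<And>i. 0 \<le> s i" and ik: "i < Suc n" "k < Suc n" for s i k
  proof -
    have qn: "(\<Sum>j<n. q j s * (A j k + (if j = k then s j else 0))) = (if k < n then - A n k else - \<sigma> s)"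
      using qA[of s k, OF s] ik by (auto simp: \<sigma>_def sum_negf less_Suc_eq intro!: sum.cong)
    have Rn: "(\<Sum>j<n. R i j s * (A j k + (if j = k then s j else 0))) = (if k < n then if i = k then 1 else 0 else - p i s)" if "i < n"
      using RA[of i k s, OF that _ s] ik by (auto simp: p_def sum_negf less_Suc_eq intro!: sum.cong)
    have last: "A n k + (if n = k then s n else 0) = (if k < n then A n k else A n n + s n)"
      using ik by (cases "k = n") auto
    show ?thesis
    proof (cases "i < n")
      case True
      have "(\<Sum>j<Suc n. R' i j s * (A j k + (if j = k then s j else 0)))
        = (\<Sum>j<n. R i j s * (A j k + (if j = k then s j else 0))) + p i s * w s * (\<Sum>j<n. q j s * (A j k + (if j = k then s j else 0)))
          + p i s * w s * (A n k + (if n = k then s n else 0))"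
        using True by (simp add: R'_def sum_distrib_left sum.distrib distrib_right mult.assoc)
      also have "\<dots> = (if k < n then if i = k then 1 else 0 else p i s * (w s * (A n n + s n - \<sigma> s) - 1))"
        unfolding qn Rn[OF True] last by (simp add: algebra_simps)
      finally show ?thesis using w1[of s, OF s] True ik by (auto simp: less_Suc_eq)
    next
      case False
      have "(\<Sum>j<Suc n. R' i j s * (A j k + (if j = k then s j else 0)))
        = w s * (\<Sum>j<n. q j s * (A j k + (if j = k then s j else 0))) + w s * (A n k + (if n = k then s n else 0))"
        using False by (simp add: R'_def sum_distrib_left mult.assoc)
      also have "\<dots> = (if k < n then 0 else w s * (A n n + s n - \<sigma> s))"
        unfolding qn last by (simp add: algebra_simps)
      finally show ?thesis using w1[of s, OF s] False ik by (auto simp: less_Suc_eq)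
    qed
  qed
  have D': "0 < ?D (Suc n) s" if s: "\<And>i. 0 \<le> s i" for s
    unfolding Dn[of s, OF s] using D[of s, OF s] pos[of s, OF s] by simp
  have Db': "(\<lambda>s. ?D (Suc n) s powr - b) \<in> laplace_class N" if b: "0 < b" for b
  proof (rule laplace_class_cong)
    show "(\<lambda>s. ?D n s powr - b * (A n n + s n - \<sigma> s) powr - b) \<in> laplace_class N"
      by (intro laplace_class_mult Db laplace_class_powr_diff) fact+
    show "?D (Suc n) s powr - b = ?D n s powr - b * (A n n + s n - \<sigma> s) powr - b" if s: "\<And>i. 0 \<le> s i" for s
      unfolding Dn[of s, OF s] using D[of s, OF s] pos[of s, OF s] by (simp add: powr_mult)
  qed
  have "laplace_resolvent N (Suc n) A R'"
    unfolding laplace_resolvent_def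
  proof (intro conjI allI impI)
    show "R' i j \<in> laplace_class N" if "i < Suc n" "j < Suc n" for i j
      using that by (rule R')
    show "(\<Sum>j<Suc n. R' i j s * (A j k + (if j = k then s j else 0))) = (if i = k then 1 else 0)"
      if "\<forall>i. 0 \<le> s i" "i < Suc n" "k < Suc n" for s i k
      using that by (intro R'A) simp_all
  qed
  then show ?case
    using D' Db' by (intro conjI exI[of _ R'] allI impI) simp_all
qed
  then have *: ?R "\<forall>s. (\<forall>i. 0 \<le> s i) \<longrightarrow> 0 < shifted_det A n s"
    "\<forall>b>0. (\<lambda>s. shifted_det A n s powr - b) \<in> laplace_class N" by simp_all
  show ?R by fact
  show "0 < shifted_det A n s" if "\<And>i. 0 \<le> s i" for s
    using *(2) that by simp
  show "(\<lambda>s. shifted_det A n s powr - b) \<in> laplace_class N" if "0 < b" for b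
    using *(3) that by simp
qed

lemma inverse_z_matrix_laplace:
  fixes A K :: "nat \<Rightarrow> nat \<Rightarrow> real"
  assumes Z: "\<And>i j. i < n \<Longrightarrow> j < n \<Longrightarrow> i \<noteq> j \<Longrightarrow> A i j \<le> 0"
    and AK: "\<And>i k. i < n \<Longrightarrow> k < n \<Longrightarrow> (\<Sum>j<n. A i j * K j k) = (if i = k then 1 else 0)"
    and K: "\<And>i j. i < n \<Longrightarrow> j < n \<Longrightarrow> 0 \<le> K i j" "\<And>i. i < n \<Longrightarrow> 0 < K i i"
    and \<alpha>: "0 < \<alpha>"
  defines "d \<equiv> \<lambda>s. Determinant.det (1\<^sub>m n + Matrix.mat n n (\<lambda>(i, j). K i j) * mat_diag n s)"
  shows "(\<lambda>s. d s powr - \<alpha>) \<in> laplace_class n" "\<And>s. (\<And>i. 0 \<le> s i) \<Longrightarrow> 0 < d s"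
proof -
  let ?D = "\<lambda>s. Determinant.det (Matrix.mat n n (\<lambda>(i, j). A i j + (if i = j then s i else 0)))"
  define x where "x i = (\<Sum>j<n. K i j)" for i
  have "0 < x i" if "i < n" for i
    unfolding x_def using K that by (intro sum_pos2[of _ i]) auto
  moreover have "0 < (\<Sum>j<n. A i j * x j)" if "i < n" for i
  proof -
    have "(\<Sum>j<n. A i j * x j) = (\<Sum>k<n. \<Sum>j<n. A i j * K j k)"
      unfolding x_def sum_distrib_left by (rule sum.swap)
    also have "\<dots> = (\<Sum>k<n. if i = k then 1 else 0)"
      using AK[OF that] by simp
    also have "\<dots> = 1" using that by simp
    finally show ?thesis by simp
  qed
  ultimately have *: "\<And>s. (\<And>i. 0 \<le> s i) \<Longrightarrow> 0 < ?D s" "(\<lambda>s. ?D s powr - \<alpha>) \<in> laplace_class n"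
    using z_matrix_laplace_class(2)[of n n A x, OF order_refl Z] z_matrix_laplace_class(3)[of n n A x \<alpha>, OF order_refl Z] \<alpha>
    by simp_all
  let ?A = "Matrix.mat n n (\<lambda>(i, j). A i j)" and ?K = "Matrix.mat n n (\<lambda>(i, j). K i j)"
  have A0: "Matrix.mat n n (\<lambda>(i, j). A i j + (if i = j then (\<lambda>_. 0) i else 0)) = ?A"
    by (intro eq_matI) auto
  \<comment> \<open>At \<open>s = 0\<close> the result above is positivity of \<open>det A\<close>,
    which allows the real power of the quotient to be split.\<close>
  have pos: "0 < Determinant.det ?A"
    using *(1)[of "\<lambda>_. 0"] unfolding A0 by simp
  have AK1: "?A * ?K = 1\<^sub>m n"
    using AK by (intro eq_matI) (auto simp: scalar_prod_def atLeast0LessThan)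
  have D: "?D s = Determinant.det ?A * d s" for s
  proof -
    have KS: "?K * mat_diag n s \<in> carrier_mat n n"
      by (rule mult_carrier_mat[OF _ mat_diag_dim]) simp
    have "?A * (1\<^sub>m n + ?K * mat_diag n s) = ?A * 1\<^sub>m n + (?A * ?K) * mat_diag n s"
      unfolding assoc_mult_mat[OF mat_carrier mat_carrier mat_diag_dim]
      by (rule mult_add_distrib_mat[OF mat_carrier one_carrier_mat KS])
    also have "\<dots> = Matrix.mat n n (\<lambda>(i, j). A i j + (if i = j then s i else 0))"
      unfolding AK1 by (intro eq_matI) (auto simp: mat_diag_def)
    finally show ?thesis
      unfolding d_def using det_mult[OF _ add_carrier_mat[OF KS], of ?A "1\<^sub>m n"] by simp
  qed
  show d: "0 < d s" if "\<And>i. 0 \<le> s i" for s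
    using *(1)[of s, OF that] pos unfolding D by (simp add: zero_less_mult_iff)
  show "(\<lambda>s. d s powr - \<alpha>) \<in> laplace_class n"
  proof (rule laplace_class_cong)
    show "(\<lambda>s. Determinant.det ?A powr \<alpha> * ?D s powr - \<alpha>) \<in> laplace_class n"
      using *(2) by (intro laplace_class_cmult) auto
    show "d s powr - \<alpha> = Determinant.det ?A powr \<alpha> * ?D s powr - \<alpha>" if "\<And>i. 0 \<le> s i" for s
      using d[of s, OF that] pos unfolding D by (simp add: powr_mult powr_add[symmetric] mult.assoc[symmetric])
  qed
qed

section \<open>Determinants when points are merged\<close>

text \<open>\<open>?U * ?V\<close> and \<open>?V * ?U\<close> have the same determinant, and both
  are block triangular: the diagonal blocks are \<open>1 + A B\<close> and \<open>1\<close> for the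
  first, \<open>1\<close> and \<open>1 + B A\<close> for the second.\<close>

lemma det_one_plus_mult_commute:
  fixes A B :: "'a :: idom mat"
  assumes A: "A \<in> carrier_mat n m" and B: "B \<in> carrier_mat m n"
  shows "Determinant.det (1\<^sub>m n + A * B) = Determinant.det (1\<^sub>m m + B * A)"
proof -
  let ?U = "four_block_mat (1\<^sub>m n) A (0\<^sub>m m n) (1\<^sub>m m)"
  let ?V = "four_block_mat (1\<^sub>m n) (- A) B (1\<^sub>m m)"
  have c: "?U \<in> carrier_mat (n + m) (n + m)" "?V \<in> carrier_mat (n + m) (n + m)"
    using A B by auto
  have UV: "?U * ?V = four_block_mat (1\<^sub>m n + A * B) (0\<^sub>m n m) B (1\<^sub>m m)"
    using A B by (subst mult_four_block_mat[of _ n n _ m _ m]) (auto intro!: arg_cong4[where f=four_block_mat] simp: minus_add_uminus_mat[symmetric])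
  have VU: "?V * ?U = four_block_mat (1\<^sub>m n) (0\<^sub>m n m) B (1\<^sub>m m + B * A)"
    using A B by (subst mult_four_block_mat[of _ n n _ m _ m]) (auto intro!: arg_cong4[where f=four_block_mat] )
  have "Determinant.det (?U * ?V) = Determinant.det (?V * ?U)"
    using c by (simp add: det_mult[OF c] det_mult[OF c(2,1)] mult.commute)
  then show ?thesis
    unfolding UV VU using A B
    by (simp add: det_four_block_mat_upper_right_zero[of _ n _ m])
qed

text \<open>Repeated points are merged by \<open>det (1 + A B) = det (1 + B A)\<close>.\<close>

lemma det_kernel_reindex:
  fixes K :: "'a \<Rightarrow> 'a \<Rightarrow> real"
  assumes p: "inj_on p {..<m}" "t ` {..<n} \<subseteq> p ` {..<m}"
  shows "Determinant.det (1\<^sub>m n + Matrix.mat n n (\<lambda>(i, j). K (t i) (t j)) * mat_diag n s)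
   = Determinant.det (1\<^sub>m m + Matrix.mat m m (\<lambda>(i, j). K (p i) (p j)) * mat_diag m (\<lambda>j. \<Sum>i | i < n \<and> t i = p j. s i))"
proof -
  \<comment> \<open>\<open>e\<close> records which entry of the list \<open>t\<close> is which
    \<open>p j\<close>. With \<open>?F\<close> the transpose of \<open>?E\<close> weighted by
    \<open>s\<close>, the matrix for \<open>t\<close> factors through the one for \<open>p\<close>,
    while \<open>?F * ?E\<close> is diagonal by injectivity of \<open>p\<close> and adds up the
    weights of merged points.\<close>
  define e where "e i j = (if t i = p j then 1 else 0 :: real)" for i j
  let ?E = "Matrix.mat n m (\<lambda>(i, j). e i j)"
  let ?F = "Matrix.mat m n (\<lambda>(j, i). e i j * s i)"
  let ?K = "Matrix.mat m m (\<lambda>(i, j). K (p i) (p j))"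
  have e: "(\<Sum>j<m. e i j * h (p j)) = h (t i)" if "i < n" for i and h :: "'a \<Rightarrow> real"
  proof -
    have "t i \<in> p ` {..<m}" using p(2) that by auto
    then obtain k where k: "k < m" "t i = p k" by auto
    have "(\<Sum>j<m. e i j * h (p j)) = (\<Sum>j<m. if j = k then h (p j) else 0)"
      using p(1) k by (intro sum.cong) (auto simp: e_def inj_on_def)
    then show ?thesis using k by simp
  qed
  have 1: "Matrix.mat n n (\<lambda>(i, j). K (t i) (t j)) * mat_diag n s = ?E * (?K * ?F)"
  proof (rule eq_matI)
    fix i j assume "i < dim_row (?E * (?K * ?F))" "j < dim_col (?E * (?K * ?F))"
    then have ij: "i < n" "j < n" by auto
    have "(?E * (?K * ?F)) $$ (i, j) = (\<Sum>k<m. e i k * (\<Sum>l<m. K (p k) (p l) * (e j l * s j)))"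
      using ij by (simp add: scalar_prod_def atLeast0LessThan)
    also have "\<dots> = (\<Sum>k<m. e i k * (s j * (\<Sum>l<m. e j l * K (p k) (p l))))"
      by (simp add: sum_distrib_left mult_ac)
    also have "\<dots> = (\<Sum>k<m. e i k * (s j * K (p k) (t j)))"
      using e[OF ij(2), of "K (p _)"] by simp
    also have "\<dots> = s j * K (t i) (t j)"
      using e[OF ij(1), of "\<lambda>x. s j * K x (t j)"] by simp
    finally show "(Matrix.mat n n (\<lambda>(i, j). K (t i) (t j)) * mat_diag n s) $$ (i, j) = (?E * (?K * ?F)) $$ (i, j)"
      using ij by (subst mat_diag_mult_right[of _ n]) auto
  qed (auto simp: mat_diag_def)
  have 2: "?F * ?E = mat_diag m (\<lambda>j. \<Sum>i | i < n \<and> t i = p j. s i)"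
  proof (rule eq_matI)
    fix k l assume "k < dim_row (mat_diag m (\<lambda>j. \<Sum>i | i < n \<and> t i = p j. s i))"
      "l < dim_col (mat_diag m (\<lambda>j. \<Sum>i | i < n \<and> t i = p j. s i))"
    then have kl: "k < m" "l < m" by (auto simp: mat_diag_def)
    have "(?F * ?E) $$ (k, l) = (\<Sum>i<n. e i k * s i * e i l)"
      using kl by (simp add: scalar_prod_def atLeast0LessThan)
    also have "\<dots> = (\<Sum>i<n. if t i = p l then if k = l then s i else 0 else 0)"
      using p(1) kl by (intro sum.cong) (auto simp: e_def inj_on_def)
    also have "\<dots> = (\<Sum>i | i < n \<and> t i = p l. if k = l then s i else 0)"
      by (subst sum.inter_filter[symmetric]) (auto intro!: sum.cong)
    finally show "(?F * ?E) $$ (k, l) = mat_diag m (\<lambda>j. \<Sum>i | i < n \<and> t i = p j. s i) $$ (k, l)"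
      using kl by (simp add: mat_diag_def)
  qed (auto simp: mat_diag_def)
  have "Determinant.det (1\<^sub>m n + ?E * (?K * ?F)) = Determinant.det (1\<^sub>m m + (?K * ?F) * ?E)"
    by (rule det_one_plus_mult_commute) auto
  also have "(?K * ?F) * ?E = ?K * (?F * ?E)"
    by (rule assoc_mult_mat) auto
  finally show ?thesis unfolding 1 2 .
qed

section \<open>Uniqueness of Laplace transforms\<close>

text \<open>At natural arguments the transform gives the moments of the image under
  \<open>x \<mapsto> exp (- x)\<close>, which lives on the unit interval. By Weierstrass
  approximation the moments determine the integrals of continuous functions of
  \<open>exp (- x)\<close>, and these determine the masses of half-lines.\<close>

lemma finite_measure_eqI_laplace:
  fixes M N :: "real measure"
  assumes fin: "finite_measure M" "finite_measure N"
    and sets: "sets M = sets borel" "sets N = sets borel"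
    and nonneg: "AE x in M. 0 \<le> x" "AE x in N. 0 \<le> x"
    and eq: "\<And>k::nat. (\<integral>\<^sup>+x. ennreal (exp (- (real k * x))) \<partial>M) = (\<integral>\<^sup>+x. ennreal (exp (- (real k * x))) \<partial>N)"
  shows "M = N"
proof -
  interpret M: finite_measure M by fact
  interpret N: finite_measure N by fact
  note [measurable_cong] = sets
  have int: "integrable L (\<lambda>x. h (exp (- x)))"
    if L: "finite_measure L" "sets L = sets borel" "AE x in L. 0 \<le> x" and h: "continuous_on UNIV h"
    for L and h :: "real \<Rightarrow> real"
  proof -
    have "bounded (h ` {0..1})"
      using compact_continuous_image[OF continuous_on_subset[OF h], of "{0..1}"]
      by (simp add: compact_imp_bounded)
    then obtain B where "\<forall>y\<in>{0..1}. \<bar>h y\<bar> \<le> B"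
      by (auto simp: bounded_iff)
    then have B: "\<bar>h y\<bar> \<le> B" if "0 \<le> y" "y \<le> 1" for y
      using that by simp
    have [measurable]: "h \<in> borel_measurable borel"
      using h by (rule borel_measurable_continuous_onI)
    show ?thesis
    proof (rule finite_measure.integrable_const_bound[OF L(1)])
      show "AE x in L. norm (h (exp (- x))) \<le> B"
        using L(3) by eventually_elim (auto intro!: B)
      show "(\<lambda>x. h (exp (- x))) \<in> borel_measurable L"
        using L(2) by measurable
    qed
  qed
  note intM = int[OF fin(1) sets(1) nonneg(1)] and intN = int[OF fin(2) sets(2) nonneg(2)]
  have pow: "(\<integral>x. exp (- x) ^ k \<partial>M) = (\<integral>x. exp (- x) ^ k \<partial>N)" for k :: nat
  proof -
    have e: "exp (- x) ^ k = exp (- (real k * x))" for x :: real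
      by (simp add: exp_of_nat_mult[symmetric])
    show ?thesis
      unfolding e using eq[of k] by (subst (1 2) integral_eq_nn_integral) auto
  qed
  have cont: "(\<integral>x. h (exp (- x)) \<partial>M) = (\<integral>x. h (exp (- x)) \<partial>N)" if h: "continuous_on UNIV h" for h :: "real \<Rightarrow> real"
  proof (rule ccontr)
    let ?d = "\<bar>(\<integral>x. h (exp (- x)) \<partial>M) - (\<integral>x. h (exp (- x)) \<partial>N)\<bar>"
    \<comment> \<open>The summand 1 keeps the denominator positive for null measures and makes the
      final comparison strict.\<close>
    let ?m = "measure M (space M) + measure N (space N) + 1"
    assume "(\<integral>x. h (exp (- x)) \<partial>M) \<noteq> (\<integral>x. h (exp (- x)) \<partial>N)"
    then have "0 < ?d / ?m"
      by (intro divide_pos_pos add_nonneg_pos) auto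
    from Stone_Weierstrass_real_polynomial_function[OF compact_Icc[of 0 1] continuous_on_subset[OF h] this]
    obtain g where g: "real_polynomial_function g" "\<And>x. x \<in> {0..1} \<Longrightarrow> \<bar>h x - g x\<bar> < ?d / ?m" by auto
    obtain a n where ga: "g = (\<lambda>x. \<Sum>i\<le>n. a i * x ^ i)"
      using real_polynomial_function_imp_sum[OF g(1)] by auto
    have gc: "continuous_on UNIV g" unfolding ga by (intro continuous_intros)
    have gi: "(\<integral>x. g (exp (- x)) \<partial>M) = (\<integral>x. g (exp (- x)) \<partial>N)"
      unfolding ga using pow
      by (subst (1 2) Bochner_Integration.integral_sum)
         (auto intro!: integrable_mult_right intM[of "\<lambda>x. x ^ _"] intN[of "\<lambda>x. x ^ _"] continuous_intros)
    have diff: "\<bar>(\<integral>x. h (exp (- x)) \<partial>L) - (\<integral>x. g (exp (- x)) \<partial>L)\<bar> \<le> ?d / ?m * measure L (space L)"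
      if L: "finite_measure L" "sets L = sets borel" "AE x in L. 0 \<le> x" for L
    proof -
      interpret L: finite_measure L by fact
      have "\<bar>(\<integral>x. h (exp (- x)) \<partial>L) - (\<integral>x. g (exp (- x)) \<partial>L)\<bar> = \<bar>\<integral>x. h (exp (- x)) - g (exp (- x)) \<partial>L\<bar>"
        using int[OF L h] int[OF L gc] by simp
      also have "\<dots> \<le> (\<integral>x. \<bar>h (exp (- x)) - g (exp (- x))\<bar> \<partial>L)"
        by (rule integral_abs_bound)
      also have "\<dots> \<le> (\<integral>x. ?d / ?m \<partial>L)"
      proof (rule integral_mono_AE)
        show "AE x in L. \<bar>h (exp (- x)) - g (exp (- x))\<bar> \<le> ?d / ?m"
          using L(3) by eventually_elim (auto intro!: less_imp_le[OF g(2)])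
      qed (use int[OF L h] int[OF L gc] in auto)
      also have "\<dots> = ?d / ?m * measure L (space L)" by simp
      finally show ?thesis .
    qed
    have "?d \<le> ?d / ?m * measure M (space M) + ?d / ?m * measure N (space N)"
      using diff[OF fin(1) sets(1) nonneg(1)] diff[OF fin(2) sets(2) nonneg(2)] gi by linarith
    also have "\<dots> < ?d / ?m * ?m"
      using \<open>0 < ?d / ?m\<close> by (simp only: distrib_left)
    also have "\<dots> = ?d"
      using measure_nonneg[of M "space M"] measure_nonneg[of N "space N"] by (simp only: nonzero_eq_divide_eq[symmetric])
    finally show False by simp
  qed
  show ?thesis
  proof (rule measure_eqI_lessThan[OF sets])
    show "emeasure M {a<..} < \<infinity>" for a by (simp add: less_top[symmetric])
    show "emeasure M {a<..} = emeasure N {a<..}" for a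
    proof -
      \<comment> \<open>Continuous functions of \<open>y = exp (- x)\<close> that increase to the
        indicator of \<open>y < exp (- a)\<close>, that is of \<open>a < x\<close>.\<close>
      define h where "h k y = min 1 (real k * max 0 (exp (- a) - y))" for k y
      have hc: "continuous_on UNIV (h k)" for k
        unfolding h_def by (intro continuous_intros)
      have lim: "(\<lambda>k. \<integral>x. h k (exp (- x)) \<partial>L) \<longlonglongrightarrow> measure L {a<..}"
        if L: "finite_measure L" "sets L = sets borel" for L
      proof -
        interpret L: finite_measure L by fact
        have "(\<lambda>k. \<integral>x. h k (exp (- x)) \<partial>L) \<longlonglongrightarrow> (\<integral>x. indicator {a<..} x \<partial>L)"
        proof (rule integral_dominated_convergence[where w="\<lambda>_. 1"])
          show "AE x in L. (\<lambda>k. h k (exp (- x))) \<longlonglongrightarrow> indicator {a<..} x"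
          proof (intro AE_I2)
            fix x
            show "(\<lambda>k. h k (exp (- x))) \<longlonglongrightarrow> indicator {a<..} x"
            proof (cases "a < x")
              case True
              then have pos: "0 < exp (- a) - exp (- x)" by simp
              obtain K :: nat where K: "1 / (exp (- a) - exp (- x)) < real K" using reals_Archimedean2 by blast
              have "eventually (\<lambda>k. h k (exp (- x)) = 1) sequentially"
                using eventually_ge_at_top[of K]
              proof eventually_elim
                case (elim k)
                then have "1 / (exp (- a) - exp (- x)) \<le> real k" using K by simp
                then show ?case using pos by (simp add: h_def field_simps min_def)
              qed
              then show ?thesis using True by (simp add: tendsto_eventually)
            qed (simp add: h_def)
          qed
          show "(\<lambda>x. indicator {a<..} x :: real) \<in> borel_measurable L" using L(2) by simp
          show "(\<lambda>x. h k (exp (- x))) \<in> borel_measurable L" for k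
            unfolding h_def measurable_cong_sets[OF L(2) refl] by measurable
        qed (auto simp: h_def)
        then show ?thesis using L(2) sets_eq_imp_space_eq[OF L(2)] by simp
      qed
      have "measure M {a<..} = measure N {a<..}"
        using lim[OF fin(1) sets(1)] lim[OF fin(2) sets(2)] unfolding cont[OF hc]
        by (rule LIMSEQ_unique)
      then show ?thesis by (simp add: M.emeasure_eq_measure N.emeasure_eq_measure)
    qed
  qed
qed

text \<open>The exponentials are exchanged for indicators one coordinate at a time: with the other
  factors as a weight, the image of the measure under the coordinate \<open>x j\<close> is a finite
  measure on the half-line, and one-dimensional uniqueness applies to it.\<close>

lemma finite_measure_PiM_eqI_laplace:
  fixes P Q :: "('i \<Rightarrow> real) measure"
  assumes J: "finite J" and fin: "finite_measure P" "finite_measure Q"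
    and sets: "sets P = sets (\<Pi>\<^sub>M i\<in>J. borel)" "sets Q = sets (\<Pi>\<^sub>M i\<in>J. borel)"
    and nonneg: "AE x in P. \<forall>i\<in>J. 0 \<le> x i" "AE x in Q. \<forall>i\<in>J. 0 \<le> x i"
    and eq: "\<And>s. (\<And>i. 0 \<le> s i) \<Longrightarrow>
      (\<integral>\<^sup>+x. ennreal (exp (- (\<Sum>i\<in>J. s i * x i))) \<partial>P) = (\<integral>\<^sup>+x. ennreal (exp (- (\<Sum>i\<in>J. s i * x i))) \<partial>Q)"
  shows "P = Q"
proof -
  note [measurable_cong] = sets
  \<comment> \<open>Indicators in the coordinates of \<open>A\<close>, exponentials in the others;
    the induction is on \<open>A\<close>.\<close>
  let ?w = "\<lambda>A B s (x :: 'i \<Rightarrow> real). (\<Prod>i\<in>A. indicator (B i) (x i)) * ennreal (exp (- (\<Sum>i\<in>J - A. s i * x i)))"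
  have key: "(\<integral>\<^sup>+x. ?w A B s x \<partial>P) = (\<integral>\<^sup>+x. ?w A B s x \<partial>Q)"
    if "A \<subseteq> J" "\<And>i. B i \<in> sets borel" "\<And>i. 0 \<le> s i" for A B s
  proof -
    have "finite A" using that(1) J by (rule finite_subset)
    then show ?thesis using that
    proof (induction A arbitrary: s rule: finite_induct)
      case empty
      then show ?case using eq[of s] by simp
    next
      case (insert j A)
      note [measurable] = insert.prems(2)
      have j: "j \<in> J" using insert.prems by auto
      let ?v = "\<lambda>x. (\<Prod>i\<in>A. indicator (B i) (x i)) * ennreal (exp (- (\<Sum>i\<in>J - insert j A. s i * x i)))"
      have v[measurable]: "?v \<in> borel_measurable (\<Pi>\<^sub>M i\<in>J. borel)"
        by measurable (use insert.prems(1) in auto)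
      let ?L = "\<lambda>P. distr (density P ?v) borel (\<lambda>x. x j)"
      have comp[measurable]: "(\<lambda>x. x j) \<in> borel_measurable (\<Pi>\<^sub>M i\<in>J. borel)"
        using j by simp
      have L: "finite_measure (?L P) \<and> (AE y in ?L P. 0 \<le> y) \<and>
          (\<forall>f\<in>borel_measurable borel. (\<integral>\<^sup>+y. f y \<partial>?L P) = (\<integral>\<^sup>+x. ?v x * f (x j) \<partial>P))"
        if P: "finite_measure P" "sets P = sets (\<Pi>\<^sub>M i\<in>J. borel)" "AE x in P. \<forall>i\<in>J. 0 \<le> x i" for P
      proof (intro conjI ballI)
        note [measurable_cong] = P(2)
        interpret finite_measure P by fact
        show *: "(\<integral>\<^sup>+y. f y \<partial>?L P) = (\<integral>\<^sup>+x. ?v x * f (x j) \<partial>P)" if [measurable]: "f \<in> borel_measurable borel" for f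
        proof -
          have v': "?v \<in> borel_measurable P"
            using v measurable_cong_sets[OF P(2) refl] by simp
          have c': "(\<lambda>x. x j) \<in> borel_measurable P"
            using comp measurable_cong_sets[OF P(2) refl] by simp
          have "(\<integral>\<^sup>+y. f y \<partial>?L P) = (\<integral>\<^sup>+x. f (x j) \<partial>density P ?v)"
            by (rule nn_integral_distr) (use c' that in simp_all)
          also have "\<dots> = (\<integral>\<^sup>+x. ?v x * f (x j) \<partial>P)"
            by (rule nn_integral_density[OF v' measurable_compose[OF c' that]])
          finally show ?thesis .
        qed
        have "AE x in P. ?v x \<le> 1"
          using P(3)
        proof eventually_elim
          case (elim x)
          have "(\<Prod>i\<in>A. indicator (B i) (x i)) \<le> (1 :: ennreal)"
            by (intro prod_le_1) (auto simp: indicator_def)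
          moreover have "ennreal (exp (- (\<Sum>i\<in>J - insert j A. s i * x i))) \<le> 1"
            using elim insert.prems(3) by (auto intro!: sum_nonneg mult_nonneg_nonneg)
          ultimately show ?case using mult_mono[of _ "1::ennreal" _ 1] by simp
        qed
        then have "(\<integral>\<^sup>+x. ?v x \<partial>P) \<le> (\<integral>\<^sup>+x. 1 \<partial>P)"
          by (rule nn_integral_mono_AE)
        then have "emeasure (?L P) (space (?L P)) \<le> emeasure P (space P)"
          using *[of "\<lambda>_. 1"] by simp
        then show "finite_measure (?L P)"
          by (intro finite_measureI) (auto simp: top_unique)
        have "AE x in P. 0 \<le> x j" using P(3) by eventually_elim (use j in auto)
        then show "AE y in ?L P. 0 \<le> y"
          by (subst AE_distr_iff) (auto simp: AE_density)
      qed
      note LP = L[OF fin(1) sets(1) nonneg(1)] and LQ = L[OF fin(2) sets(2) nonneg(2)]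
      \<comment> \<open>Putting the weight \<open>k\<close> at coordinate \<open>j\<close> turns the
        transform of \<open>?L\<close> at \<open>k\<close> into an instance of the induction
        hypothesis; this is why \<open>s\<close> is generalised.\<close>
      have "?L P = ?L Q"
      proof (rule finite_measure_eqI_laplace)
        fix k :: nat
        have e: "?v x * ennreal (exp (- (real k * x j))) = ?w A B (s(j := real k)) x" for x
        proof -
          have "J - A - {j} = J - insert j A" by auto
          then have "(\<Sum>i\<in>J - A. (s(j := real k)) i * x i) = real k * x j + (\<Sum>i\<in>J - insert j A. (s(j := real k)) i * x i)"
            using sum.remove[of "J - A" j "\<lambda>i. (s(j := real k)) i * x i"] J j insert.hyps(2) by simp
          also have "(\<Sum>i\<in>J - insert j A. (s(j := real k)) i * x i) = (\<Sum>i\<in>J - insert j A. s i * x i)"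
            by (intro sum.cong) auto
          finally show ?thesis
            by (simp only: minus_add_distrib exp_add ennreal_mult''[OF exp_ge_zero] mult_ac)
        qed
        have IH: "(\<integral>\<^sup>+x. ?w A B (s(j := real k)) x \<partial>P) = (\<integral>\<^sup>+x. ?w A B (s(j := real k)) x \<partial>Q)"
          by (rule insert.IH) (use insert.prems in auto)
        have m: "(\<lambda>y. ennreal (exp (- (real k * y)))) \<in> borel_measurable borel" by measurable
        show "(\<integral>\<^sup>+y. ennreal (exp (- (real k * y))) \<partial>?L P) = (\<integral>\<^sup>+y. ennreal (exp (- (real k * y))) \<partial>?L Q)"
          using IH unfolding LP[THEN conjunct2, THEN conjunct2, rule_format, OF m]
            LQ[THEN conjunct2, THEN conjunct2, rule_format, OF m] e .
      qed (simp_all add: LP LQ)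
      have m: "indicator (B j) \<in> borel_measurable borel" by measurable
      have w: "?w (insert j A) B s = (\<lambda>x. ?v x * indicator (B j) (x j))"
        by (rule ext) (simp only: prod.insert[OF insert.hyps] mult_ac)
      have "(\<integral>\<^sup>+x. ?v x * indicator (B j) (x j) \<partial>P) = (\<integral>\<^sup>+y. indicator (B j) y \<partial>?L P)"
        by (rule LP[THEN conjunct2, THEN conjunct2, rule_format, OF m, symmetric])
      also have "\<dots> = (\<integral>\<^sup>+y. indicator (B j) y \<partial>?L Q)"
        unfolding \<open>?L P = ?L Q\<close> ..
      also have "\<dots> = (\<integral>\<^sup>+x. ?v x * indicator (B j) (x j) \<partial>Q)"
        by (rule LQ[THEN conjunct2, THEN conjunct2, rule_format, OF m])
      finally show ?case unfolding w .
    qed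
  qed
  have PiE: "emeasure L (Pi\<^sub>E J B) = (\<integral>\<^sup>+x. ?w J B (\<lambda>_. 0) x \<partial>L)"
    if L: "sets L = sets (\<Pi>\<^sub>M i\<in>J. borel)" and B: "\<And>i. i \<in> J \<Longrightarrow> B i \<in> sets borel" for L and B :: "'i \<Rightarrow> real set"
  proof -
    have "Pi\<^sub>E J B \<in> sets L"
      unfolding L using B J by (intro sets_PiM_I_finite) auto
    then have "emeasure L (Pi\<^sub>E J B) = (\<integral>\<^sup>+x. indicator (Pi\<^sub>E J B) x \<partial>L)" by simp
    also have "\<dots> = (\<integral>\<^sup>+x. ?w J B (\<lambda>_. 0) x \<partial>L)"
    proof (intro nn_integral_cong)
      fix x assume "x \<in> space L"
      then have "x \<in> extensional J"
        using sets_eq_imp_space_eq[OF L] by (auto simp: space_PiM PiE_def)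
      then have "indicator (Pi\<^sub>E J B) x = (\<Prod>i\<in>J. indicator (B i) (x i) :: ennreal)"
        using J by (auto simp: indicator_def PiE_def Pi_iff prod_zero_iff)
      then show "indicator (Pi\<^sub>E J B) x = ?w J B (\<lambda>_. 0) x" by simp
    qed
    finally show ?thesis .
  qed
  show ?thesis
  proof (rule measure_eqI_PiM_finite[OF J sets])
    fix A :: "'i \<Rightarrow> real set" assume A: "\<And>i. i \<in> J \<Longrightarrow> A i \<in> sets borel"
    \<comment> \<open>\<open>key\<close> asks for Borel sets at every index, so the sets off
      \<open>J\<close> are replaced by the empty one.\<close>
    let ?A = "\<lambda>i. if i \<in> J then A i else {}"
    have "Pi\<^sub>E J A = Pi\<^sub>E J ?A" by (intro PiE_cong) simp
    moreover have "emeasure P (Pi\<^sub>E J ?A) = emeasure Q (Pi\<^sub>E J ?A)"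
      using PiE[OF sets(1), of ?A] PiE[OF sets(2), of ?A] key[of J ?A "\<lambda>_. 0"] A by simp
    ultimately show "emeasure P (Pi\<^sub>E J A) = emeasure Q (Pi\<^sub>E J A)" by simp
  next
    show "range (\<lambda>_::nat. space (\<Pi>\<^sub>M i\<in>J. borel :: real measure)) \<subseteq> prod_algebra J (\<lambda>_. borel)"
      using J by (auto simp: space_PiM intro!: prod_algebraI_finite)
    show "emeasure P (space (\<Pi>\<^sub>M i\<in>J. borel)) \<noteq> \<infinity>"
      using finite_measure.emeasure_finite[OF fin(1)] by simp
  qed simp
qed

section \<open>Kernels satisfying the domination principle\<close>

text \<open>The potential theory consumed by the linear algebra. \<open>E\<close> will be the
  nonnegative, real valued, lower semicontinuous supermedian functions; \<open>domination\<close>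
  compares at the charged points only and concludes everywhere.\<close>

locale balayage_kernel =
  fixes u :: "'a \<Rightarrow> 'a \<Rightarrow> real" and E :: "('a \<Rightarrow> real) set"
  assumes nonneg: "0 \<le> u x y"
    and sym: "u x y = u y x"
    and pos_def: "finite J \<Longrightarrow> \<exists>i\<in>J. c i \<noteq> 0 \<Longrightarrow> 0 < (\<Sum>i\<in>J. \<Sum>j\<in>J. c i * c j * u i j)"
    and u_E: "u y \<in> E"
    and domination: "finite J \<Longrightarrow> (\<And>j. j \<in> J \<Longrightarrow> 0 \<le> a j) \<Longrightarrow> f \<in> E \<Longrightarrow>
      (\<And>i. i \<in> J \<Longrightarrow> (\<Sum>j\<in>J. a j * u i j) \<le> f i) \<Longrightarrow> (\<Sum>j\<in>J. a j * u x j) \<le> f x"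
begin

text \<open>The difference of two solutions has energy zero.\<close>

lemma solution_unique:
  assumes J: "finite J" and eq: "\<And>i. i \<in> J \<Longrightarrow> (\<Sum>j\<in>J. a j * u i j) = (\<Sum>j\<in>J. b j * u i j)" and j: "j \<in> J"
  shows "a j = b j"
proof (rule ccontr)
  assume "a j \<noteq> b j"
  then have "0 < (\<Sum>i\<in>J. \<Sum>j\<in>J. (a i - b i) * (a j - b j) * u i j)"
    using J j by (intro pos_def) auto
  also have "\<dots> = (\<Sum>i\<in>J. (a i - b i) * ((\<Sum>j\<in>J. a j * u i j) - (\<Sum>j\<in>J. b j * u i j)))"
    by (simp add: sum_distrib_left sum_subtractf[symmetric] algebra_simps)
  also have "\<dots> = 0" using eq by simp
  finally show False by simp
qed

text \<open>This Schur complement is the quadratic form at the vector \<open>e\<close> with 1 at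
  \<open>j\<close> and \<open>- c\<close> on \<open>J\<close>, as the choice of \<open>c\<close>
  annihilates every row except that of \<open>j\<close>.\<close>

lemma schur_pos:
  assumes J: "finite J" "j \<notin> J" and c: "\<And>i. i \<in> J \<Longrightarrow> (\<Sum>k\<in>J. c k * u i k) = u j i"
  shows "0 < u j j - (\<Sum>k\<in>J. c k * u j k)"
proof -
  define e where "e i = (if i = j then 1 else - c i)" for i
  have row: "(\<Sum>k\<in>insert j J. e k * u i k) = (if i = j then u j j - (\<Sum>k\<in>J. c k * u j k) else 0)" if "i \<in> insert j J" for i
  proof -
    have "(\<Sum>k\<in>insert j J. e k * u i k) = u i j + (\<Sum>k\<in>J. - c k * u i k)"
      using J by (auto simp: e_def intro!: sum.cong)
    then show ?thesis using c[of i] that sym[of i j] by (auto simp: sum_negf)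
  qed
  have "0 < (\<Sum>i\<in>insert j J. \<Sum>k\<in>insert j J. e i * e k * u i k)"
    using J by (intro pos_def) (auto simp: e_def)
  also have "\<dots> = (\<Sum>i\<in>insert j J. e i * (\<Sum>k\<in>insert j J. e k * u i k))"
    by (simp add: sum_distrib_left mult.assoc del: sum.insert)
  also have "\<dots> = (\<Sum>i\<in>insert j J. if i = j then u j j - (\<Sum>k\<in>J. c k * u j k) else 0)"
    by (intro sum.cong refl, subst row) (auto simp: e_def)
  also have "\<dots> = u j j - (\<Sum>k\<in>J. c k * u j k)"
    using J by (subst sum.delta) auto
  finally show ?thesis .
qed

text \<open>Induction on the number of points. For a chosen \<open>j\<close>, solve on
  \<open>J - {j}\<close> for \<open>f\<close> and for \<open>u j\<close>, then correct by a mass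
  \<open>\<tau>\<close> at \<open>j\<close>; domination of the first solution by \<open>f\<close> at
  \<open>j\<close> makes \<open>\<tau>\<close> nonnegative. This controls the sign at
  \<open>j\<close> only, but the solution is unique and \<open>j\<close> is arbitrary.\<close>

lemma balayage:
  assumes "finite J" "f \<in> E"
  shows "\<exists>a. (\<forall>j\<in>J. 0 \<le> a j) \<and> (\<forall>i\<in>J. (\<Sum>j\<in>J. a j * u i j) = f i)"
  using assms
proof (induction "card J" arbitrary: J f rule: less_induct)
  case less
  have ex: "\<exists>a. 0 \<le> a j \<and> (\<forall>i\<in>J. (\<Sum>j\<in>J. a j * u i j) = f i)" if j: "j \<in> J" for j
  proof -
    let ?J = "J - {j}"
    have J: "finite ?J" "j \<notin> ?J" "insert j ?J = J" "card ?J < card J"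
      using j less.prems card_Diff1_less[OF less.prems(1) j] by auto
    obtain b where b: "\<forall>j\<in>?J. 0 \<le> b j" "\<forall>i\<in>?J. (\<Sum>k\<in>?J. b k * u i k) = f i"
      using less.hyps[OF J(4) J(1) less.prems(2)] by blast
    obtain c where c: "\<forall>j\<in>?J. 0 \<le> c j" "\<forall>i\<in>?J. (\<Sum>k\<in>?J. c k * u i k) = u j i"
      using less.hyps[OF J(4) J(1) u_E[of j]] by blast
    \<comment> \<open>The mass that repairs the equation at \<open>j\<close>; subtracting
      \<open>\<tau> * c k\<close> at the other points keeps their equations intact.\<close>
    define \<tau> where "\<tau> = (f j - (\<Sum>k\<in>?J. b k * u j k)) / (u j j - (\<Sum>k\<in>?J. c k * u j k))"
    have \<sigma>: "0 < u j j - (\<Sum>k\<in>?J. c k * u j k)"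
      by (rule schur_pos) (use J c in auto)
    moreover have "(\<Sum>k\<in>?J. b k * u j k) \<le> f j"
      by (rule domination) (use J b less.prems in auto)
    ultimately have \<tau>: "0 \<le> \<tau>" "\<tau> * (u j j - (\<Sum>k\<in>?J. c k * u j k)) = f j - (\<Sum>k\<in>?J. b k * u j k)"
      by (auto simp: \<tau>_def)
    define a where "a k = (if k = j then \<tau> else b k - \<tau> * c k)" for k
    have "(\<Sum>k\<in>J. a k * u i k) = f i" if i: "i \<in> J" for i
    proof -
      have "(\<Sum>k\<in>J. a k * u i k) = \<tau> * u i j + (\<Sum>k\<in>?J. a k * u i k)"
        using j less.prems by (subst sum.remove[of _ j]) (auto simp: a_def)
      also have "(\<Sum>k\<in>?J. a k * u i k) = (\<Sum>k\<in>?J. b k * u i k) - \<tau> * (\<Sum>k\<in>?J. c k * u i k)"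
        unfolding sum_distrib_left sum_subtractf[symmetric]
        by (intro sum.cong) (auto simp: a_def algebra_simps)
      finally show ?thesis
        using b(2) c(2) \<tau>(2) i sym[of i j] by (cases "i = j") (auto simp: algebra_simps)
    qed
    moreover have "0 \<le> a j" using \<tau> by (simp add: a_def)
    ultimately show ?thesis by blast
  qed
  show ?case
  proof (cases "J = {}")
    case False
    then obtain j0 where "j0 \<in> J" by blast
    then obtain a where a: "\<forall>i\<in>J. (\<Sum>j\<in>J. a j * u i j) = f i" using ex by blast
    have "0 \<le> a j" if j: "j \<in> J" for j
    proof -
      obtain b where "0 \<le> b j" "\<forall>i\<in>J. (\<Sum>j\<in>J. b j * u i j) = f i" using ex[OF j] by blast
      then show ?thesis using solution_unique[OF less.prems(1), of a b, OF _ j] a by simp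
    qed
    then show ?thesis using a by blast
  qed auto
qed

text \<open>The inverse \<open>B\<close> of \<open>u\<close> on \<open>J\<close> is a Z-matrix because on \<open>J - {j}\<close> the function \<open>u(\<cdot>, j)\<close> is a
  nonnegative combination of the other columns; the Sherman-Morrison formula then subtracts from \<open>B\<close>
  a nonnegative multiple of \<open>(B g) (B f)\<^sup>T\<close>.\<close>

lemma inverse_z_matrix:
  assumes J: "finite J" and f: "f \<in> E" "\<And>x. 0 \<le> f x" and g: "g \<in> E" "\<And>x. 0 \<le> g x"
  shows "\<exists>A. (\<forall>i\<in>J. \<forall>j\<in>J. i \<noteq> j \<longrightarrow> A i j \<le> 0) \<and>
    (\<forall>i\<in>J. \<forall>k\<in>J. (\<Sum>j\<in>J. A i j * (u j k + g j * f k)) = (if i = k then 1 else 0))"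
proof -
  have "\<exists>b. (\<forall>i\<in>J. i \<noteq> j \<longrightarrow> b i \<le> 0) \<and> (\<forall>k\<in>J. (\<Sum>i\<in>J. b i * u k i) = (if j = k then 1 else 0))" if j: "j \<in> J" for j
  proof -
    let ?J = "J - {j}"
    have J': "finite ?J" "j \<notin> ?J" using J by auto
    obtain c where c: "\<forall>j\<in>?J. 0 \<le> c j" "\<forall>i\<in>?J. (\<Sum>k\<in>?J. c k * u i k) = u j i"
      using balayage[OF J'(1) u_E] by blast
    define \<sigma> where "\<sigma> = u j j - (\<Sum>k\<in>?J. c k * u j k)"
    have \<sigma>: "0 < \<sigma>"
      unfolding \<sigma>_def by (rule schur_pos) (use J' c in auto)
    \<comment> \<open>Row \<open>j\<close> of the inverse: the vector that isolates
      \<open>j\<close>, normalised by its Schur complement.\<close>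
    define b where "b k = (if k = j then 1 else - c k) / \<sigma>" for k
    have "(\<Sum>i\<in>J. b i * u k i) = (if j = k then 1 else 0)" if k: "k \<in> J" for k
    proof -
      have "(\<Sum>i\<in>J. b i * u k i) = u k j / \<sigma> + (\<Sum>i\<in>?J. b i * u k i)"
        using j J by (subst sum.remove[of _ j]) (auto simp: b_def)
      also have "(\<Sum>i\<in>?J. b i * u k i) = - (\<Sum>i\<in>?J. c i * u k i) / \<sigma>"
        by (auto simp: b_def sum_negf[symmetric] sum_divide_distrib intro!: sum.cong)
      finally have "(\<Sum>i\<in>J. b i * u k i) = (u k j - (\<Sum>i\<in>?J. c i * u k i)) / \<sigma>"
        by (simp add: diff_divide_distrib)
      then show ?thesis
        using c(2) k \<sigma> sym[of k j] by (cases "k = j") (auto simp: \<sigma>_def[symmetric])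
    qed
    moreover have "b i \<le> 0" if "i \<in> J" "i \<noteq> j" for i
      using c(1) \<sigma> that by (simp add: b_def)
    ultimately show ?thesis by blast
  qed
  then obtain B where B: "\<And>i j. i \<in> J \<Longrightarrow> j \<in> J \<Longrightarrow> i \<noteq> j \<Longrightarrow> B j i \<le> 0"
    "\<And>j k. j \<in> J \<Longrightarrow> k \<in> J \<Longrightarrow> (\<Sum>i\<in>J. B j i * u k i) = (if j = k then 1 else 0)"
    by metis
  obtain \<phi> where \<phi>: "\<forall>j\<in>J. 0 \<le> \<phi> j" "\<forall>i\<in>J. (\<Sum>j\<in>J. \<phi> j * u i j) = f i"
    using balayage[OF J f(1)] by blast
  obtain \<gamma> where \<gamma>: "\<forall>j\<in>J. 0 \<le> \<gamma> j" "\<forall>i\<in>J. (\<Sum>j\<in>J. \<gamma> j * u i j) = g i"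
    using balayage[OF J g(1)] by blast
  \<comment> \<open>The Sherman-Morrison denominator, with \<open>\<phi>\<close> in the place of
    \<open>B f\<close>; since \<open>\<phi>\<close> and \<open>g\<close> are nonnegative, it cannot
    vanish.\<close>
  define \<kappa> where "\<kappa> = 1 + (\<Sum>j\<in>J. \<phi> j * g j)"
  have \<kappa>: "1 \<le> \<kappa>"
    unfolding \<kappa>_def using \<phi>(1) g(2) by (simp add: sum_nonneg)
  have Bg: "(\<Sum>j\<in>J. B i j * g j) = \<gamma> i" if i: "i \<in> J" for i
  proof -
    have "(\<Sum>j\<in>J. B i j * g j) = (\<Sum>j\<in>J. \<Sum>k\<in>J. B i j * (\<gamma> k * u j k))"
      using \<gamma>(2) by (simp add: sum_distrib_left[symmetric])
    also have "\<dots> = (\<Sum>k\<in>J. \<gamma> k * (\<Sum>j\<in>J. B i j * u k j))"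
      unfolding sum_distrib_left by (subst sum.swap) (simp add: mult_ac sym)
    also have "\<dots> = (\<Sum>k\<in>J. if i = k then \<gamma> k else 0)"
      using B(2) i by (intro sum.cong) auto
    also have "\<dots> = \<gamma> i" using i J by simp
    finally show ?thesis .
  qed
  define A where "A i j = B i j - \<gamma> i * \<phi> j / \<kappa>" for i j
  have "(\<Sum>j\<in>J. A i j * (u j k + g j * f k)) = (if i = k then 1 else 0)" if ik: "i \<in> J" "k \<in> J" for i k
  proof -
    have "(\<Sum>j\<in>J. A i j * (u j k + g j * f k)) = (\<Sum>j\<in>J. B i j * u k j) + (\<Sum>j\<in>J. B i j * g j) * f k
      - \<gamma> i / \<kappa> * (\<Sum>j\<in>J. \<phi> j * u k j) - \<gamma> i / \<kappa> * (\<Sum>j\<in>J. \<phi> j * g j) * f k"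
      unfolding sum_distrib_left sum_distrib_right sum_subtractf[symmetric] sum.distrib[symmetric]
      by (intro sum.cong) (auto simp: A_def sym[of k] algebra_simps)
    also have "\<dots> = (if i = k then 1 else 0) + \<gamma> i * f k - \<gamma> i / \<kappa> * (f k + (\<kappa> - 1) * f k)"
      using B(2)[OF ik] Bg[OF ik(1)] \<phi>(2) ik(2) by (simp add: \<kappa>_def algebra_simps)
    also have "\<dots> = (if i = k then 1 else 0)"
      using \<kappa> by (simp add: field_simps)
    finally show ?thesis .
  qed
  moreover have "A i j \<le> 0" if "i \<in> J" "j \<in> J" "i \<noteq> j" for i j
  proof -
    have "0 \<le> \<gamma> i * \<phi> j / \<kappa>" using \<gamma>(1) \<phi>(1) \<kappa> that by simp
    then show ?thesis using B(1)[of j i] that by (simp add: A_def)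
  qed
  ultimately show ?thesis by blast
qed

end

section \<open>Existence of permanental processes\<close>

abbreviation kernel_det :: "('a \<Rightarrow> 'a \<Rightarrow> real) \<Rightarrow> nat \<Rightarrow> (nat \<Rightarrow> 'a) \<Rightarrow> (nat \<Rightarrow> real) \<Rightarrow> real" where
  "kernel_det K n t s \<equiv>
     Determinant.det (1\<^sub>m n + Matrix.mat n n (\<lambda>(i, j). K (t i) (t j)) * mat_diag n s)"

text \<open>The transform is stated for every list \<open>t\<close> of points of \<open>J\<close>,
  repetitions included, so that restriction to smaller sets and the defining formula of the process
  are both instances of it, without reference to the enumeration \<open>p\<close>.\<close>

lemma exists_finite_dimensional_law:
  assumes J: "finite J" and K: "\<And>n p. inj_on p {..<n} \<Longrightarrow> (\<lambda>s. kernel_det K n p s powr - \<alpha>) \<in> laplace_class n"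
  shows "\<exists>Q. prob_space Q \<and> sets Q = sets (\<Pi>\<^sub>M i\<in>J. borel) \<and> (AE x in Q. \<forall>i\<in>J. 0 \<le> x i) \<and>
    (\<forall>n t s. t ` {..<n} \<subseteq> J \<longrightarrow> (\<forall>i. 0 \<le> s i) \<longrightarrow>
      (\<integral>\<^sup>+x. ennreal (exp (- (\<Sum>i<n. s i * x (t i)))) \<partial>Q) = ennreal (kernel_det K n t s powr - \<alpha>))"
proof -
  obtain p where p: "bij_betw p {..<card J} J"
    using ex_bij_betw_nat_finite[OF J] by (auto simp: atLeast0LessThan)
  let ?m = "card J"
  define q where "q = the_inv_into {..<?m} p"
  have inj: "inj_on p {..<?m}" and im: "p ` {..<?m} = J"
    using p by (auto simp: bij_betw_def)
  have pq: "p (q j) = j" "q j < ?m" if "j \<in> J" for j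
    using f_the_inv_into_f[OF inj, of j] the_inv_into_into[OF inj, of j "{..<?m}"] im that by (auto simp: q_def)
  have qp: "q (p k) = k" if "k < ?m" for k
    using the_inv_into_f_f[OF inj] that by (simp add: q_def)
  obtain M where M: "laplace_rep ?m M (\<lambda>s. kernel_det K ?m p s powr - \<alpha>)"
    using K[OF inj] by (rule laplace_classE)
  note Mr = laplace_repD[OF M]
  define r :: "(nat \<Rightarrow> real) \<Rightarrow> 'a \<Rightarrow> real" where "r x = (\<lambda>j\<in>J. x (q j))" for x
  have rm: "r \<in> measurable M (\<Pi>\<^sub>M i\<in>J. borel)"
    unfolding r_def measurable_cong_sets[OF Mr(1) refl] by measurable
  define Q where "Q = distr M (\<Pi>\<^sub>M i\<in>J. borel) r"
  have lap: "(\<integral>\<^sup>+x. ennreal (exp (- (\<Sum>i<n. s i * x (t i)))) \<partial>Q) = ennreal (kernel_det K n t s powr - \<alpha>)"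
    if t: "t ` {..<n} \<subseteq> J" and s: "\<forall>i. 0 \<le> s i" for n t s
  proof -
    let ?s = "\<lambda>j. \<Sum>i | i < n \<and> t i = p j. s i"
    have s': "0 \<le> ?s j" for j using s by (intro sum_nonneg) auto
    have tJ: "t i \<in> J" if "i < n" for i using t that by auto
    have meas: "(\<lambda>x. ennreal (exp (- (\<Sum>i<n. s i * x (t i))))) \<in> borel_measurable (\<Pi>\<^sub>M i\<in>J. borel)"
      using tJ by measurable
    have sum: "(\<Sum>i<n. s i * r x (t i)) = (\<Sum>j<?m. ?s j * x j)" for x
    proof -
      have "(\<Sum>j<?m. ?s j * x j) = (\<Sum>j<?m. \<Sum>i\<in>{..<n}. if t i = p j then s i * x j else 0)"
        by (intro sum.cong refl) (simp add: sum_distrib_right sum.inter_filter[symmetric])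
      also have "\<dots> = (\<Sum>i<n. \<Sum>j<?m. if t i = p j then s i * x j else 0)"
        by (rule sum.swap)
      also have "\<dots> = (\<Sum>i<n. s i * r x (t i))"
      proof (intro sum.cong refl)
        fix i assume "i \<in> {..<n}"
        then have i: "t i \<in> J" using tJ by simp
        have "(\<Sum>j<?m. if t i = p j then s i * x j else 0) = (\<Sum>j<?m. if j = q (t i) then s i * x j else 0)"
        proof (intro sum.cong refl)
          fix j assume "j \<in> {..<?m}"
          then have "t i = p j \<longleftrightarrow> j = q (t i)" using pq[OF i] qp[of j] by auto
          then show "(if t i = p j then s i * x j else 0) = (if j = q (t i) then s i * x j else 0)" by simp
        qed
        also have "\<dots> = s i * r x (t i)"
          using pq(2)[OF i] i by (simp add: r_def)
        finally show "(\<Sum>j<?m. if t i = p j then s i * x j else 0) = s i * r x (t i)" .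
      qed
      finally show ?thesis ..
    qed
    have "(\<integral>\<^sup>+x. ennreal (exp (- (\<Sum>i<n. s i * x (t i)))) \<partial>Q) = (\<integral>\<^sup>+x. ennreal (exp (- (\<Sum>j<?m. ?s j * x j))) \<partial>M)"
      unfolding Q_def sum[symmetric] by (rule nn_integral_distr[OF rm]) (use meas in simp)
    also have "\<dots> = ennreal (kernel_det K ?m p ?s powr - \<alpha>)"
      by (rule Mr(4)[of ?s, OF s'])
    also have "kernel_det K ?m p ?s = kernel_det K n t s"
      by (rule det_kernel_reindex[OF inj, symmetric]) (use t im in simp)
    finally show ?thesis .
  qed
  have "kernel_det K 0 t s = 1" for t s
    by (rule det_dim_zero) (rule add_carrier_mat, rule mult_carrier_mat, rule mat_carrier, rule mat_diag_dim)
  \<comment> \<open>The empty list of points gives the total mass, the determinant of the empty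
    matrix being 1.\<close>
  then have "emeasure Q (space Q) = 1"
    using lap[of "\<lambda>_. undefined" 0 "\<lambda>_. 0"] by simp
  then have "prob_space Q" by (rule prob_spaceI)
  moreover have "AE x in Q. \<forall>i\<in>J. 0 \<le> x i"
  proof -
    have pred: "{x \<in> space (\<Pi>\<^sub>M i\<in>J. borel). \<forall>i\<in>J. 0 \<le> (x i :: real)} \<in> sets (\<Pi>\<^sub>M i\<in>J. borel)"
      using J by measurable
    have "AE x in M. \<forall>i\<in>J. 0 \<le> r x i"
      using Mr(2) by eventually_elim (simp add: r_def)
    then show ?thesis unfolding Q_def by (simp add: AE_distr_iff[OF rm pred])
  qed
  ultimately show ?thesis
    using lap by (intro exI[of _ Q] conjI allI impI) (simp_all add: Q_def)
qed

lemma permanental_kernelI: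
  fixes K :: "'a \<Rightarrow> 'a \<Rightarrow> real"
  assumes K: "\<And>n p. inj_on p {..<n} \<Longrightarrow> (\<lambda>s. kernel_det K n p s powr - \<alpha>) \<in> laplace_class n"
    and pos: "\<And>n p s. inj_on p {..<n} \<Longrightarrow> (\<And>i. 0 \<le> s i) \<Longrightarrow> 0 < kernel_det K n p s"
  shows "permanental_kernel \<alpha> K"
proof -
  have det_pos: "0 < kernel_det K n t s" if s: "\<And>i. 0 \<le> s i" for n t s
  proof -
    have "finite (t ` {..<n})" by simp
    then obtain p where p: "bij_betw p {..<card (t ` {..<n})} (t ` {..<n})"
      using ex_bij_betw_nat_finite[of "t ` {..<n}"] by (auto simp: atLeast0LessThan)
    then have inj: "inj_on p {..<card (t ` {..<n})}" and im: "t ` {..<n} \<subseteq> p ` {..<card (t ` {..<n})}"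
      by (auto simp: bij_betw_def)
    show ?thesis
      unfolding det_kernel_reindex[OF inj im] by (rule pos[OF inj]) (use s in \<open>auto intro!: sum_nonneg\<close>)
  qed
  define good where "good J Q \<longleftrightarrow> prob_space Q \<and> sets Q = sets (\<Pi>\<^sub>M i\<in>J. borel) \<and> (AE x in Q. \<forall>i\<in>J. 0 \<le> x i) \<and>
    (\<forall>n t s. t ` {..<n} \<subseteq> J \<longrightarrow> (\<forall>i. 0 \<le> s i) \<longrightarrow>
      (\<integral>\<^sup>+x. ennreal (exp (- (\<Sum>i<n. s i * x (t i)))) \<partial>Q) = ennreal (kernel_det K n t s powr - \<alpha>))"
    for J :: "'a set" and Q
  have "\<exists>Q. good J Q" if "finite J" for J
    unfolding good_def by (rule exists_finite_dimensional_law[OF that K])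
  then obtain Q where Q: "\<And>J. finite J \<Longrightarrow> good J (Q J)" by metis
  have Qp: "prob_space (Q J)" and Qs: "sets (Q J) = sets (\<Pi>\<^sub>M i\<in>J. borel)" and Qn: "AE x in Q J. \<forall>i\<in>J. 0 \<le> x i"
    if "finite J" for J
    using Q[OF that] by (auto simp: good_def)
  have Ql: "(\<integral>\<^sup>+x. ennreal (exp (- (\<Sum>i<n. s i * x (t i)))) \<partial>Q J) = ennreal (kernel_det K n t s powr - \<alpha>)"
    if "finite J" "t ` {..<n} \<subseteq> J" "\<And>i. 0 \<le> s i" for J n t s
    using Q[OF that(1)] that(2,3) unfolding good_def by simp
  \<comment> \<open>Consistency: for an enumeration \<open>t\<close> of \<open>J\<close> both
    measures have the transform given by \<open>kernel_det K (card J) t\<close>, which does not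
    involve \<open>H\<close>.\<close>
  have proj: "Q J = distr (Q H) (\<Pi>\<^sub>M i\<in>J. borel) (\<lambda>f. restrict f J)" if JH: "J \<subseteq> H" and H: "finite H" for J H
  proof (rule finite_measure_PiM_eqI_laplace)
    show J: "finite J" using JH H by (rule finite_subset)
    have rm: "(\<lambda>f. restrict f J) \<in> measurable (Q H) (\<Pi>\<^sub>M i\<in>J. borel :: real measure)"
      unfolding measurable_cong_sets[OF Qs[OF H] refl] by (rule measurable_restrict_subset[OF JH])
    show "finite_measure (Q J)" using Qp[OF J] by (rule prob_space.finite_measure)
    have "prob_space (distr (Q H) (\<Pi>\<^sub>M i\<in>J. borel) (\<lambda>f. restrict f J))"
      by (rule prob_space.prob_space_distr[OF Qp[OF H] rm])
    then show "finite_measure (distr (Q H) (\<Pi>\<^sub>M i\<in>J. borel) (\<lambda>f. restrict f J))" by (rule prob_space.finite_measure)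
    show "sets (Q J) = sets (\<Pi>\<^sub>M i\<in>J. borel)" by (rule Qs[OF J])
    show "AE x in Q J. \<forall>i\<in>J. 0 \<le> x i" by (rule Qn[OF J])
    have pred: "{x \<in> space (\<Pi>\<^sub>M i\<in>J. borel). \<forall>i\<in>J. 0 \<le> (x i :: real)} \<in> sets (\<Pi>\<^sub>M i\<in>J. borel)"
      using J by measurable
    have "AE x in Q H. \<forall>i\<in>J. 0 \<le> restrict x J i"
      using Qn[OF H] by eventually_elim (use JH in auto)
    then show "AE x in distr (Q H) (\<Pi>\<^sub>M i\<in>J. borel) (\<lambda>f. restrict f J). \<forall>i\<in>J. 0 \<le> x i"
      by (simp add: AE_distr_iff[OF rm pred])
    fix s :: "'a \<Rightarrow> real" assume s: "\<And>i. 0 \<le> s i"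
    obtain t where t: "bij_betw t {..<card J} J"
      using ex_bij_betw_nat_finite[OF J] by (auto simp: atLeast0LessThan)
    then have tJ: "t ` {..<card J} \<subseteq> J" by (auto simp: bij_betw_def)
    have sum: "(\<Sum>i\<in>J. s i * x i) = (\<Sum>k<card J. s (t k) * x (t k))" for x
      by (rule sum.reindex_bij_betw[OF t, symmetric])
    have meas: "(\<lambda>x. ennreal (exp (- (\<Sum>i\<in>J. s i * x i)))) \<in> borel_measurable (\<Pi>\<^sub>M i\<in>J. borel)"
      by measurable
    have "(\<integral>\<^sup>+x. ennreal (exp (- (\<Sum>i\<in>J. s i * x i))) \<partial>distr (Q H) (\<Pi>\<^sub>M i\<in>J. borel) (\<lambda>f. restrict f J))
      = (\<integral>\<^sup>+x. ennreal (exp (- (\<Sum>i\<in>J. s i * x i))) \<partial>Q H)"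
      by (subst nn_integral_distr[OF rm]) (use meas in simp_all)
    also have "\<dots> = ennreal (kernel_det K (card J) t (\<lambda>k. s (t k)) powr - \<alpha>)"
      unfolding sum by (rule Ql[OF H]) (use tJ JH s in auto)
    also have "\<dots> = (\<integral>\<^sup>+x. ennreal (exp (- (\<Sum>i\<in>J. s i * x i))) \<partial>Q J)"
      unfolding sum by (rule Ql[OF J tJ, symmetric]) (rule s)
    finally show "(\<integral>\<^sup>+x. ennreal (exp (- (\<Sum>i\<in>J. s i * x i))) \<partial>Q J) =
      (\<integral>\<^sup>+x. ennreal (exp (- (\<Sum>i\<in>J. s i * x i))) \<partial>distr (Q H) (\<Pi>\<^sub>M i\<in>J. borel) (\<lambda>f. restrict f J))" ..
  qed simp
  have "projective_family UNIV Q (\<lambda>_. borel)"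
  proof (rule projective_family.intro)
    show "Q J = distr (Q H) (\<Pi>\<^sub>M i\<in>J. borel) (\<lambda>f. restrict f J)" if "J \<subseteq> H" "finite H" for J H
      using that by (rule proj)
    show "prob_space (Q J)" if "finite J" for J using that by (rule Qp)
  qed
  then interpret polish_projective UNIV Q by (rule polish_projective.intro)
  have lim_restrict: "distr lim (\<Pi>\<^sub>M i\<in>J. borel) (\<lambda>f. restrict f J) = Q J" if J: "finite J" for J
  proof (rule measure_eqI)
    show "sets (distr lim (\<Pi>\<^sub>M i\<in>J. borel) (\<lambda>f. restrict f J)) = sets (Q J)" by (simp add: Qs[OF J])
    fix X assume "X \<in> sets (distr lim (\<Pi>\<^sub>M i\<in>J. borel) (\<lambda>f. restrict f J))"
    then have X: "X \<in> sets (\<Pi>\<^sub>M i\<in>J. borel)" by simp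
    have rm: "(\<lambda>f. restrict f J) \<in> measurable lim (\<Pi>\<^sub>M i\<in>J. borel :: real measure)"
      unfolding measurable_cong_sets[OF sets_lim refl] by (rule measurable_restrict_subset) simp
    have "emeasure (distr lim (\<Pi>\<^sub>M i\<in>J. borel) (\<lambda>f. restrict f J)) X = emeasure lim (emb UNIV J X)"
      unfolding emeasure_distr[OF rm X] by (simp add: prod_emb_def space_PiM)
    then show "emeasure (distr lim (\<Pi>\<^sub>M i\<in>J. borel) (\<lambda>f. restrict f J)) X = emeasure (Q J) X"
      using emeasure_lim_emb[OF _ J X] by simp
  qed
  \<comment> \<open>Under the projective limit the coordinates are nonnegative only almost surely,
    whereas the definition speaks of every sample point; \<open>max 0\<close> repairs this.\<close>
  have "permanental_process \<alpha> K lim (\<lambda>t \<omega>. max 0 (\<omega> t))"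
    unfolding permanental_process_def Let_def
  proof (intro conjI allI ballI impI)
    show "prob_space lim" by (rule P.prob_space_axioms)
    show "(\<lambda>\<omega>. max 0 (\<omega> t)) \<in> borel_measurable lim" for t
      unfolding measurable_cong_sets[OF sets_lim refl] by measurable
    fix n and t :: "nat \<Rightarrow> 'a" and s :: "nat \<Rightarrow> real" assume s: "\<forall>i<n. 0 < s i"
    \<comment> \<open>The definition constrains \<open>s\<close> below \<open>n\<close> only;
      \<open>s'\<close> is 0 beyond, which leaves the determinant unchanged.\<close>
    define s' where "s' i = (if i < n then s i else 0)" for i
    have s': "0 \<le> s' i" for i using s by (simp add: s'_def less_imp_le)
    have diag: "mat_diag n s = mat_diag n s'"
      by (intro eq_matI) (auto simp: mat_diag_def s'_def)
    show d: "0 < kernel_det K n t s" unfolding diag by (rule det_pos[of s', OF s'])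
    let ?J = "t ` {..<n}"
    have J: "finite ?J" by simp
    have rm: "(\<lambda>f. restrict f ?J) \<in> measurable lim (\<Pi>\<^sub>M i\<in>?J. borel :: real measure)"
      unfolding measurable_cong_sets[OF sets_lim refl] by (rule measurable_restrict_subset) simp
    have meas: "(\<lambda>x. ennreal (exp (- (\<Sum>i<n. s i * max 0 (x (t i)))))) \<in> borel_measurable (\<Pi>\<^sub>M i\<in>?J. borel)"
      by measurable
    have "(\<integral>\<^sup>+\<omega>. ennreal (exp (- (\<Sum>i<n. s i * max 0 (\<omega> (t i))))) \<partial>lim) =
      (\<integral>\<^sup>+x. ennreal (exp (- (\<Sum>i<n. s i * max 0 (x (t i))))) \<partial>distr lim (\<Pi>\<^sub>M i\<in>?J. borel) (\<lambda>f. restrict f ?J))"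
      by (subst nn_integral_distr[OF rm]) (use meas in simp_all)
    also have "\<dots> = (\<integral>\<^sup>+x. ennreal (exp (- (\<Sum>i<n. s' i * x (t i)))) \<partial>Q ?J)"
      unfolding lim_restrict[OF J]
    proof (rule nn_integral_cong_AE)
      show "AE x in Q ?J. ennreal (exp (- (\<Sum>i<n. s i * max 0 (x (t i))))) = ennreal (exp (- (\<Sum>i<n. s' i * x (t i))))"
        using Qn[OF J]
      proof eventually_elim
        case (elim x)
        have "(\<Sum>i<n. s i * max 0 (x (t i))) = (\<Sum>i<n. s' i * x (t i))"
          using elim by (intro sum.cong) (auto simp: s'_def max_def)
        then show ?case by simp
      qed
    qed
    also have "\<dots> = ennreal (kernel_det K n t s powr - \<alpha>)"
      unfolding diag by (rule Ql[OF J order_refl s'])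
    finally have nn: "(\<integral>\<^sup>+\<omega>. ennreal (exp (- (\<Sum>i<n. s i * max 0 (\<omega> (t i))))) \<partial>lim) = ennreal (kernel_det K n t s powr - \<alpha>)" .
    have "(\<integral>\<omega>. exp (- (\<Sum>i<n. s i * max 0 (\<omega> (t i)))) \<partial>lim) = kernel_det K n t s powr - \<alpha>"
    proof (subst integral_eq_nn_integral)
      show "(\<lambda>\<omega>. exp (- (\<Sum>i<n. s i * max 0 (\<omega> (t i))))) \<in> borel_measurable lim"
        unfolding measurable_cong_sets[OF sets_lim refl] by measurable
    qed (simp_all add: nn)
    then show "(\<integral>\<omega>. exp (- (\<Sum>i<n. s i * max 0 (\<omega> (t i)))) \<partial>lim) = 1 / kernel_det K n t s powr \<alpha>"
      by (simp only: powr_minus_divide)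
  qed simp
  then show ?thesis unfolding permanental_kernel_def by blast
qed

section \<open>Symmetric semigroups with continuous potential density\<close>

definition lsc :: "('a :: topological_space \<Rightarrow> ennreal) \<Rightarrow> bool" where
  "lsc v \<longleftrightarrow> (\<forall>c. open {x. c < v x})"

lemma lsc_min: "lsc v \<Longrightarrow> lsc w \<Longrightarrow> lsc (\<lambda>x. min (v x) (w x))"
  unfolding lsc_def by (simp add: open_Collect_conj)

lemma lsc_continuous: "continuous_on UNIV v \<Longrightarrow> lsc v"
  unfolding lsc_def by (auto intro!: open_Collect_less)

lemma lsc_indicator: "open V \<Longrightarrow> lsc (indicator V)"
  unfolding lsc_def
proof
  fix c :: ennreal assume "open V"
  moreover have "{x. c < indicator V x} = (if c < 1 then V else {})"
    by (auto simp: indicator_def split: if_splits)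
  ultimately show "open {x. c < indicator V x}" by simp
qed

text \<open>Fatou's lemma along sequences; these decide closedness since the space is first
  countable.\<close>

lemma lsc_nn_integral:
  fixes k :: "'a :: first_countable_topology \<Rightarrow> 'b \<Rightarrow> ennreal"
  assumes [measurable]: "\<And>x. k x \<in> borel_measurable M" and k: "\<And>y. continuous_on UNIV (\<lambda>x. k x y)"
  shows "lsc (\<lambda>x. \<integral>\<^sup>+y. k x y \<partial>M)"
  unfolding lsc_def
proof
  fix c
  have "closed {x. (\<integral>\<^sup>+y. k x y \<partial>M) \<le> c}"
    unfolding closed_sequential_limits
  proof (intro allI impI)
    fix X l assume "(\<forall>n. X n \<in> {x. (\<integral>\<^sup>+y. k x y \<partial>M) \<le> c}) \<and> X \<longlonglongrightarrow> l"
    then have X: "\<And>n. (\<integral>\<^sup>+y. k (X n) y \<partial>M) \<le> c" "X \<longlonglongrightarrow> l" by auto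
    have "(\<integral>\<^sup>+y. k l y \<partial>M) = (\<integral>\<^sup>+y. liminf (\<lambda>n. k (X n) y) \<partial>M)"
    proof (intro nn_integral_cong)
      fix y
      have "(\<lambda>n. k (X n) y) \<longlonglongrightarrow> k l y"
        using X(2) by (rule continuous_on_tendsto_compose[OF k]) auto
      then show "k l y = liminf (\<lambda>n. k (X n) y)"
        by (rule lim_imp_Liminf[OF sequentially_bot, symmetric])
    qed
    also have "\<dots> \<le> liminf (\<lambda>n. \<integral>\<^sup>+y. k (X n) y \<partial>M)"
      by (rule nn_integral_liminf) simp
    also have "\<dots> \<le> limsup (\<lambda>n. \<integral>\<^sup>+y. k (X n) y \<partial>M)"
      by (rule Liminf_le_Limsup) simp
    also have "\<dots> \<le> c"
      using X(1) by (intro Limsup_bounded) simp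
    finally show "l \<in> {x. (\<integral>\<^sup>+y. k x y \<partial>M) \<le> c}" by simp
  qed
  then have "open (- {x. (\<integral>\<^sup>+y. k x y \<partial>M) \<le> c})" by (rule open_Compl)
  moreover have "- {x. (\<integral>\<^sup>+y. k x y \<partial>M) \<le> c} = {x. c < (\<integral>\<^sup>+y. k x y \<partial>M)}" by auto
  ultimately show "open {x. c < (\<integral>\<^sup>+y. k x y \<partial>M)}" by simp
qed

lemma ennreal_two_mult_le: "2 * (a * b) \<le> a * a + b * (b :: ennreal)"
proof (cases "a = \<top> \<or> b = \<top>")
  case True
  then show ?thesis by (auto simp: ennreal_mult_eq_top_iff)
next
  case False
  then obtain r s where rs: "a = ennreal r" "0 \<le> r" "b = ennreal s" "0 \<le> s"
    by (cases a; cases b) auto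
  have "2 * (r * s) \<le> r * r + s * s"
    using zero_le_square[of "r - s"] by (simp add: algebra_simps)
  then have "ennreal (2 * (r * s)) \<le> ennreal (r * r + s * s)" by (rule ennreal_leI)
  then show ?thesis using rs by (simp add: ennreal_mult)
qed

lemma nn_integral_shift:
  fixes f :: "real \<Rightarrow> ennreal"
  assumes [measurable]: "f \<in> borel_measurable borel"
  shows "(\<integral>\<^sup>+s\<in>{a..b}. f (s + t) \<partial>lborel) = (\<integral>\<^sup>+s\<in>{a + t..b + t}. f s \<partial>lborel)"
    and "(\<integral>\<^sup>+s\<in>{a..}. f (s + t) \<partial>lborel) = (\<integral>\<^sup>+s\<in>{a + t..}. f s \<partial>lborel)"
proof -
  have "(\<integral>\<^sup>+s\<in>{a + t..b + t}. f s \<partial>lborel) = (\<integral>\<^sup>+s. f (t + 1 * s) * indicator {a + t..b + t} (t + 1 * s) \<partial>lborel)"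
    by (subst nn_integral_real_affine[where c=1 and t=t]) auto
  also have "\<dots> = (\<integral>\<^sup>+s\<in>{a..b}. f (s + t) \<partial>lborel)"
    by (intro nn_integral_cong) (auto simp: indicator_def add_ac)
  finally show "(\<integral>\<^sup>+s\<in>{a..b}. f (s + t) \<partial>lborel) = (\<integral>\<^sup>+s\<in>{a + t..b + t}. f s \<partial>lborel)" by simp
  have "(\<integral>\<^sup>+s\<in>{a + t..}. f s \<partial>lborel) = (\<integral>\<^sup>+s. f (t + 1 * s) * indicator {a + t..} (t + 1 * s) \<partial>lborel)"
    by (subst nn_integral_real_affine[where c=1 and t=t]) auto
  also have "\<dots> = (\<integral>\<^sup>+s\<in>{a..}. f (s + t) \<partial>lborel)"
    by (intro nn_integral_cong) (auto simp: indicator_def add_ac)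
  finally show "(\<integral>\<^sup>+s\<in>{a..}. f (s + t) \<partial>lborel) = (\<integral>\<^sup>+s\<in>{a + t..}. f s \<partial>lborel)" by simp
qed

lemma nn_integral_split_interval:
  fixes f :: "real \<Rightarrow> ennreal"
  assumes [measurable]: "f \<in> borel_measurable borel" and ab: "a \<le> b"
  shows "(\<integral>\<^sup>+s\<in>{a..}. f s \<partial>lborel) = (\<integral>\<^sup>+s\<in>{a..b}. f s \<partial>lborel) + (\<integral>\<^sup>+s\<in>{b..}. f s \<partial>lborel)"
    and "b \<le> c \<Longrightarrow> (\<integral>\<^sup>+s\<in>{a..c}. f s \<partial>lborel) = (\<integral>\<^sup>+s\<in>{a..b}. f s \<partial>lborel) + (\<integral>\<^sup>+s\<in>{b..c}. f s \<partial>lborel)"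
proof -
  have b: "AE s in lborel. s \<noteq> b" by (rule AE_lborel_singleton)
  show "(\<integral>\<^sup>+s\<in>{a..}. f s \<partial>lborel) = (\<integral>\<^sup>+s\<in>{a..b}. f s \<partial>lborel) + (\<integral>\<^sup>+s\<in>{b..}. f s \<partial>lborel)"
    using b ab by (subst nn_integral_add[symmetric]) (auto intro!: nn_integral_cong_AE simp: indicator_def)
  assume "b \<le> c"
  then show "(\<integral>\<^sup>+s\<in>{a..c}. f s \<partial>lborel) = (\<integral>\<^sup>+s\<in>{a..b}. f s \<partial>lborel) + (\<integral>\<^sup>+s\<in>{b..c}. f s \<partial>lborel)"
    using b ab by (subst nn_integral_add[symmetric]) (auto intro!: nn_integral_cong_AE simp: indicator_def)
qed

text \<open>Truncating at multiples of a strictly positive function loses nothing in the limit. With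
  \<open>\<eta>\<close> as that function the truncations have finite potentials; with
  \<open>U \<eta>\<close> they lie below finite potentials.\<close>

lemma ennreal_SUP_min_mult:
  fixes a b :: ennreal
  assumes "0 < b"
  shows "(SUP n::nat. min a (of_nat n * b)) = a"
proof (rule antisym)
  show "(SUP n::nat. min a (of_nat n * b)) \<le> a" by (intro SUP_least) simp
  show "a \<le> (SUP n::nat. min a (of_nat n * b))"
  proof (rule dense_le)
    fix c assume c: "c < a"
    have "\<exists>n::nat. c \<le> of_nat n * b"
    proof (cases "b = \<top>")
      case True
      then show ?thesis by (intro exI[of _ 1]) simp
    next
      case False
      then obtain r where r: "b = ennreal r" "0 < r" using assms by (cases b) auto
      obtain s where s: "c = ennreal s" "0 \<le> s" using c by (cases c) auto
      obtain n :: nat where "s / r < real n" using reals_Archimedean2 by blast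
      then have "s \<le> real n * r" using r by (simp add: field_simps)
      then have "ennreal s \<le> of_nat n * ennreal r"
        using r by (simp add: ennreal_of_nat_eq_real_of_nat ennreal_mult'[symmetric] ennreal_leI)
      then show ?thesis using r s by auto
    qed
    then obtain n :: nat where "c \<le> of_nat n * b" by blast
    then have "c \<le> min a (of_nat n * b)" using c by simp
    also have "\<dots> \<le> (SUP n::nat. min a (of_nat n * b))" by (rule SUP_upper) simp
    finally show "c \<le> (SUP n::nat. min a (of_nat n * b))" .
  qed
qed

lemma lsc_cmult:
  assumes "lsc v" "c < \<infinity>"
  shows "lsc (\<lambda>x. c * v x)"
proof (cases "c = 0")
  case False
  have "{x. d < c * v x} = {x. d / c < v x}" for d
    using False assms(2) by (auto simp: divide_less_ennreal mult.commute less_top)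
  then show ?thesis using assms(1) by (simp add: lsc_def)
qed (simp add: lsc_def)

text \<open>What the potential theory uses of the process. Right continuity of the paths survives as
  convergence of the mass of open neighbourhoods, and transience as the function
  \<open>\<eta>\<close>, whose multiples serve as truncation levels.\<close>

locale symmetric_semigroup =
  fixes \<kappa> :: "real \<Rightarrow> 'a :: {t2_space, second_countable_topology} \<Rightarrow> 'a measure"
    and m :: "'a measure" and u :: "'a \<Rightarrow> 'a \<Rightarrow> real" and \<eta> :: "'a \<Rightarrow> ennreal"
  assumes sets_\<kappa> [measurable_cong]: "sets (\<kappa> s x) = sets borel"
    and \<kappa>_le_1: "emeasure (\<kappa> s x) UNIV \<le> 1"
    and measurable_\<kappa>: "h \<in> borel_measurable borel \<Longrightarrow>
      (\<lambda>(s, x). \<integral>\<^sup>+y. h y \<partial>\<kappa> s x) \<in> borel_measurable (borel \<Otimes>\<^sub>M borel)"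
    and semigroup: "0 \<le> s \<Longrightarrow> 0 \<le> t \<Longrightarrow> h \<in> borel_measurable borel \<Longrightarrow>
      (\<integral>\<^sup>+y. (\<integral>\<^sup>+z. h z \<partial>\<kappa> t y) \<partial>\<kappa> s x) = (\<integral>\<^sup>+z. h z \<partial>\<kappa> (s + t) x)"
    and right_continuous: "open V \<Longrightarrow> x \<in> V \<Longrightarrow> ((\<lambda>s. emeasure (\<kappa> s x) V) \<longlongrightarrow> 1) (at_right 0)"
    and sets_m [measurable_cong]: "sets m = sets borel"
    and locally_bounded: "\<exists>V. open V \<and> x \<in> V \<and> emeasure m V < \<infinity>"
    and symmetric: "0 \<le> s \<Longrightarrow> h \<in> borel_measurable borel \<Longrightarrow> k \<in> borel_measurable borel \<Longrightarrow>
      (\<integral>\<^sup>+x. h x * (\<integral>\<^sup>+y. k y \<partial>\<kappa> s x) \<partial>m) = (\<integral>\<^sup>+x. (\<integral>\<^sup>+y. h y \<partial>\<kappa> s x) * k x \<partial>m)"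
    and u_nonneg: "0 \<le> u x y"
    and u_continuous: "continuous_on UNIV (\<lambda>(x, y). u x y)"
    and density: "h \<in> borel_measurable borel \<Longrightarrow>
      (\<integral>\<^sup>+s\<in>{0..}. (\<integral>\<^sup>+y. h y \<partial>\<kappa> s x) \<partial>lborel) = (\<integral>\<^sup>+y. ennreal (u x y) * h y \<partial>m)"
    and \<eta>_borel [measurable]: "\<eta> \<in> borel_measurable borel"
    and \<eta>_pos: "0 < \<eta> x"
    and \<eta>_le_1: "\<eta> x \<le> 1"
    and \<eta>_potential: "(\<integral>\<^sup>+y. ennreal (u x y) * \<eta> y \<partial>m) < \<infinity>"
begin

section \<open>The semigroup, its potentials and supermedian functions\<close>

abbreviation T :: "real \<Rightarrow> ('a \<Rightarrow> ennreal) \<Rightarrow> 'a \<Rightarrow> ennreal" where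
  "T s h x \<equiv> \<integral>\<^sup>+y. h y \<partial>\<kappa> s x"

definition U :: "('a \<Rightarrow> ennreal) \<Rightarrow> 'a \<Rightarrow> ennreal" where
  "U h x = (\<integral>\<^sup>+y. ennreal (u x y) * h y \<partial>m)"

text \<open>The averages \<open>A t h x / t\<close> play the part of the resolvent:
  \<open>A t h\<close> is the potential of \<open>h\<close> less its image under \<open>T t\<close>,
  and the averages of a supermedian function stay below it.\<close>

definition A :: "real \<Rightarrow> ('a \<Rightarrow> ennreal) \<Rightarrow> 'a \<Rightarrow> ennreal" where
  "A t h x = (\<integral>\<^sup>+s\<in>{0..t}. T s h x \<partial>lborel)"

definition supermedian :: "('a \<Rightarrow> ennreal) \<Rightarrow> bool" where
  "supermedian q \<longleftrightarrow> q \<in> borel_measurable borel \<and> (\<forall>s\<ge>0. \<forall>x. T s q x \<le> q x)"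

lemma space_\<kappa> [simp]: "space (\<kappa> s x) = UNIV"
  using sets_eq_imp_space_eq[OF sets_\<kappa>] by simp

lemma space_m [simp]: "space m = UNIV"
  using sets_eq_imp_space_eq[OF sets_m] by simp

lemma measurable_T [measurable (raw)]:
  assumes "h \<in> borel_measurable borel" "f \<in> borel_measurable M" "g \<in> measurable M borel"
  shows "(\<lambda>x. T (f x) h (g x)) \<in> borel_measurable M"
  using measurable_compose[OF measurable_Pair[OF assms(2,3)] measurable_\<kappa>[OF assms(1)]] by simp

lemma finite_\<kappa>: "finite_measure (\<kappa> s x)"
  using \<kappa>_le_1[of s x] by (intro finite_measureI) (auto simp: top_unique)

text \<open>By Lindelof countably many open sets of finite measure cover the space.\<close>

lemma sigma_finite_m: "sigma_finite_measure m"
proof -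
  let ?F = "{V. open V \<and> emeasure m V < \<infinity>}"
  obtain F where F: "F \<subseteq> ?F" "countable F" "\<Union>F = \<Union>?F"
    using Lindelof_openin[of ?F UNIV] by auto
  have "\<Union>?F = UNIV" using locally_bounded by blast
  then show ?thesis
    using F by (intro sigma_finite_measure.intro exI[of _ F]) (auto simp: sets_m less_top)
qed

sublocale m: sigma_finite_measure m by (rule sigma_finite_m)

lemma measurable_u [measurable]: "(\<lambda>(x, y). u x y) \<in> borel_measurable (borel \<Otimes>\<^sub>M borel)"
  using borel_measurable_continuous_onI[OF u_continuous] by (simp add: borel_prod)

lemma u_continuous1: "continuous_on UNIV (\<lambda>x. u x y)"
proof -
  have "continuous_on UNIV (\<lambda>x. (x, y))" by (intro continuous_intros)
  from continuous_on_compose2[OF u_continuous this] show ?thesis by simp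
qed

lemma u_continuous2: "continuous_on UNIV (u x)"
proof -
  have "continuous_on UNIV (\<lambda>y. (x, y))" by (intro continuous_intros)
  from continuous_on_compose2[OF u_continuous this] show ?thesis by simp
qed

lemma U_alt: "h \<in> borel_measurable borel \<Longrightarrow> U h x = (\<integral>\<^sup>+s\<in>{0..}. T s h x \<partial>lborel)"
  by (simp add: U_def density)

lemma measurable_U [measurable]:
  assumes [measurable]: "h \<in> borel_measurable borel"
  shows "U h \<in> borel_measurable borel"
  unfolding U_def using measurable_u by (intro m.borel_measurable_nn_integral) (simp add: split_beta')

lemma measurable_T1: "h \<in> borel_measurable borel \<Longrightarrow> T s h \<in> borel_measurable borel"
  by (rule measurable_T) auto

lemma measurable_A [measurable]:
  assumes h: "h \<in> borel_measurable borel"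
  shows "A t h \<in> borel_measurable borel"
  unfolding A_def
proof (intro sigma_finite_measure.borel_measurable_nn_integral[OF sigma_finite_lborel])
  have "(\<lambda>x. T (snd x) h (fst x)) \<in> borel_measurable (borel \<Otimes>\<^sub>M lborel)"
    by (rule measurable_T[OF h]) measurable
  then show "(\<lambda>(x, s). T s h x * indicator {0..t} s) \<in> borel_measurable (borel \<Otimes>\<^sub>M lborel)"
    unfolding split_beta' by measurable
qed

text \<open>Continuity of \<open>u\<close> in its first argument enters through Fatou. Finiteness of
  \<open>h\<close> matters: a value \<top> would make \<open>x \<mapsto> u x y * h y\<close> jump at
  zeros of \<open>u\<close>.\<close>

lemma lsc_U:
  assumes h: "h \<in> borel_measurable borel" "\<And>x. h x < \<infinity>"
  shows "lsc (U h)"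
  unfolding U_def
proof (rule lsc_nn_integral)
  show "(\<lambda>y. ennreal (u x y) * h y) \<in> borel_measurable m" for x
    using h(1) by measurable
  have "ennreal (u x y) * h y = ennreal (u x y * enn2real (h y))" for x y
    using h(2)[of y] u_nonneg[of x y] by (simp add: ennreal_mult less_top)
  then show "continuous_on UNIV (\<lambda>x. ennreal (u x y) * h y)" for y
    by (auto intro!: continuous_on_ennreal continuous_intros u_continuous1)
qed

lemma T_mono: "(\<And>y. h y \<le> k y) \<Longrightarrow> T s h x \<le> T s k x"
  by (rule nn_integral_mono)

lemma T_cmult: "h \<in> borel_measurable borel \<Longrightarrow> T s (\<lambda>y. c * h y) x = c * T s h x"
  by (rule nn_integral_cmult) measurable

lemma T_le: "(\<And>y. h y \<le> c) \<Longrightarrow> T s h x \<le> c"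
proof -
  assume "\<And>y. h y \<le> c"
  then have "T s h x \<le> (\<integral>\<^sup>+y. c \<partial>\<kappa> s x)" by (rule nn_integral_mono)
  also have "\<dots> = c * emeasure (\<kappa> s x) UNIV" by simp
  also have "\<dots> \<le> c * 1" by (intro mult_left_mono \<kappa>_le_1) simp
  finally show ?thesis by simp
qed

lemma supermedianD:
  assumes "supermedian q"
  shows "q \<in> borel_measurable borel" "0 \<le> s \<Longrightarrow> T s q x \<le> q x"
  using assms by (auto simp: supermedian_def)

lemma supermedian_decreasing:
  assumes q: "supermedian q" and st: "0 \<le> s" "s \<le> t"
  shows "T t q x \<le> T s q x"
proof -
  have "T t q x = T s (T (t - s) q) x"
    using semigroup[of s "t - s" q x] st supermedianD(1)[OF q] by simp
  also have "\<dots> \<le> T s q x"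
    using st by (intro T_mono supermedianD(2)[OF q]) simp
  finally show ?thesis .
qed

lemma supermedian_min:
  assumes "supermedian q" "supermedian r"
  shows "supermedian (\<lambda>x. min (q x) (r x))"
proof -
  have "T s (\<lambda>x. min (q x) (r x)) x \<le> min (q x) (r x)" if "0 \<le> s" for s x
    using order_trans[OF T_mono[of "\<lambda>x. min (q x) (r x)" q] supermedianD(2)[OF assms(1) that]]
      order_trans[OF T_mono[of "\<lambda>x. min (q x) (r x)" r] supermedianD(2)[OF assms(2) that]]
    by simp
  then show ?thesis
    using supermedianD(1)[OF assms(1)] supermedianD(1)[OF assms(2)] by (simp add: supermedian_def)
qed

lemma supermedian_cmult: "supermedian q \<Longrightarrow> supermedian (\<lambda>x. c * q x)"
  by (auto simp: supermedian_def T_cmult intro!: mult_left_mono)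

lemma supermedian_sum:
  assumes "finite I" "\<And>i. i \<in> I \<Longrightarrow> supermedian (q i)"
  shows "supermedian (\<lambda>x. \<Sum>i\<in>I. q i x)"
proof -
  have "T s (\<lambda>x. \<Sum>i\<in>I. q i x) x = (\<Sum>i\<in>I. T s (q i) x)" for s x
    using supermedianD(1)[OF assms(2)] by (intro nn_integral_sum) (simp add: measurable_cong_sets[OF sets_\<kappa> refl])
  moreover have "(\<lambda>x. \<Sum>i\<in>I. q i x) \<in> borel_measurable borel"
    using supermedianD(1)[OF assms(2)] by (intro borel_measurable_sum)
  ultimately show ?thesis
    using supermedianD(2)[OF assms(2)] by (auto simp: supermedian_def intro!: sum_mono)
qed

text \<open>This replaces the continuity of excessive functions along the paths.\<close>

lemma lsc_eventually_less_T:
  assumes v: "lsc v" and c: "c < v x"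
  shows "\<forall>\<^sub>F s in at_right 0. c < T s v x"
proof -
  obtain c' where c': "c < c'" "c' < v x" using dense[OF c] by blast
  let ?V = "{y. c' < v y}"
  have "((\<lambda>s. c' * emeasure (\<kappa> s x) ?V) \<longlongrightarrow> c' * 1) (at_right 0)"
    using v c' by (intro ennreal_tendsto_cmult right_continuous) (auto simp: lsc_def less_top[symmetric])
  then have "\<forall>\<^sub>F s in at_right 0. c < c' * emeasure (\<kappa> s x) ?V"
    using c'(1) by (auto dest: order_tendstoD(1))
  then show ?thesis
  proof eventually_elim
    case (elim s)
    have "?V \<in> sets (\<kappa> s x)" using v by (auto simp: sets_\<kappa> lsc_def)
    then have "c' * emeasure (\<kappa> s x) ?V = (\<integral>\<^sup>+y. c' * indicator ?V y \<partial>\<kappa> s x)"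
      by (rule nn_integral_cmult_indicator[symmetric])
    also have "\<dots> \<le> T s v x"
      by (intro nn_integral_mono) (auto simp: indicator_def)
    finally show ?case using elim by simp
  qed
qed

lemma A_le:
  assumes "supermedian q" "0 \<le> t"
  shows "A t q x \<le> ennreal t * q x"
proof -
  have "A t q x \<le> (\<integral>\<^sup>+s\<in>{0..t}. q x \<partial>lborel)"
    unfolding A_def using supermedianD(2)[OF assms(1)]
    by (intro nn_integral_mono) (auto simp: indicator_def)
  also have "\<dots> = ennreal t * q x"
    using assms(2) by (subst nn_integral_cmult_indicator) (auto simp: mult.commute)
  finally show ?thesis .
qed

lemma lsc_eventually_less_A:
  assumes v: "lsc v" and c: "c < v x"
  shows "\<forall>\<^sub>F t in at_right 0. ennreal t * c \<le> A t v x"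
proof -
  obtain d :: real where d: "0 < d" "\<And>s. 0 < s \<Longrightarrow> s < d \<Longrightarrow> c < T s v x"
    using lsc_eventually_less_T[OF v c] unfolding eventually_at_right_field by auto
  have "\<forall>\<^sub>F t in at_right (0::real). t < d" "\<forall>\<^sub>F t in at_right (0::real). 0 < t"
    using d(1) by (auto simp: eventually_at_right_field)
  then show ?thesis
  proof eventually_elim
    case (elim t)
    have "ennreal t * c = (\<integral>\<^sup>+s\<in>{0..t}. c \<partial>lborel)"
      using elim by (subst nn_integral_cmult_indicator) (auto simp: mult.commute)
    also have "\<dots> \<le> A t v x"
      unfolding A_def
    proof (intro nn_integral_mono_AE)
      show "AE s in lborel. c * indicator {0..t} s \<le> T s v x * indicator {0..t} s"
        using AE_lborel_singleton[of 0]
      proof eventually_elim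
        case (elim s)
        then show ?case using d(2)[of s] \<open>t < d\<close> by (cases "s \<in> {0..t}") auto
      qed
    qed
    finally show ?case .
  qed
qed

text \<open>Lower semicontinuity bounds the averages from below near \<open>t = 0\<close>, the
  supermedian property bounds them from above.\<close>

lemma tendsto_A:
  assumes "supermedian q" "lsc q"
  shows "((\<lambda>t. ennreal (1 / t) * A t q x) \<longlongrightarrow> q x) (at_right 0)"
proof (rule order_tendstoI)
  fix c assume "c < q x"
  then obtain c' where c': "c < c'" "c' < q x" using dense by blast
  have "\<forall>\<^sub>F t in at_right 0. ennreal t * c' \<le> A t q x"
    by (rule lsc_eventually_less_A[OF assms(2) c'(2)])
  moreover have "\<forall>\<^sub>F t in at_right (0::real). 0 < t" by (simp add: eventually_at_right_less)
  ultimately show "\<forall>\<^sub>F t in at_right 0. c < ennreal (1 / t) * A t q x"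
  proof eventually_elim
    case (elim t)
    have "c' = ennreal (1 / t) * (ennreal t * c')"
      using elim(2) by (simp add: mult.assoc[symmetric] ennreal_mult'[symmetric])
    also have "\<dots> \<le> ennreal (1 / t) * A t q x"
      using elim(1) by (intro mult_left_mono) auto
    finally show ?case using c'(1) by simp
  qed
next
  fix c assume c: "q x < c"
  have "\<forall>\<^sub>F t in at_right (0::real). 0 < t" by (simp add: eventually_at_right_less)
  then show "\<forall>\<^sub>F t in at_right 0. ennreal (1 / t) * A t q x < c"
  proof eventually_elim
    case (elim t)
    have "ennreal (1 / t) * A t q x \<le> ennreal (1 / t) * (ennreal t * q x)"
      using A_le[OF assms(1), of t x] elim by (intro mult_left_mono) auto
    also have "\<dots> = q x"
      using elim by (simp add: mult.assoc[symmetric] ennreal_mult'[symmetric])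
    finally show ?case using c by simp
  qed
qed

lemma A_scaled_le:
  assumes "supermedian q" "0 < t"
  shows "ennreal (1 / t) * A t q x \<le> q x"
proof -
  have "ennreal (1 / t) * A t q x \<le> ennreal (1 / t) * (ennreal t * q x)"
    using A_le[OF assms(1), of t x] assms(2) by (intro mult_left_mono) auto
  also have "\<dots> = q x"
    using assms(2) by (simp add: mult.assoc[symmetric] ennreal_mult'[symmetric])
  finally show ?thesis .
qed

lemma T_U:
  assumes h: "h \<in> borel_measurable borel" and t: "0 \<le> t"
  shows "T t (U h) x = (\<integral>\<^sup>+s\<in>{t..}. T s h x \<partial>lborel)" and "U (T t h) x = (\<integral>\<^sup>+s\<in>{t..}. T s h x \<partial>lborel)"
proof -
  interpret k: finite_measure "\<kappa> t x" by (rule finite_\<kappa>)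
  interpret pair_sigma_finite lborel "\<kappa> t x" ..
  have Ts: "(\<lambda>s. T s h x) \<in> borel_measurable borel" for x
    by (rule measurable_T[OF h]) simp_all
  have m: "(\<lambda>z. T (fst z) h (snd z)) \<in> borel_measurable (lborel \<Otimes>\<^sub>M \<kappa> t x)"
    by (rule measurable_T[OF h]) measurable
  have "(\<integral>\<^sup>+s\<in>{0..}. T (s + t) h x \<partial>lborel) = (\<integral>\<^sup>+s\<in>{0 + t..}. T s h x \<partial>lborel)"
    by (rule nn_integral_shift(2)[of "\<lambda>s. T s h x", OF Ts])
  then have shift: "(\<integral>\<^sup>+s\<in>{0..}. T (s + t) h x \<partial>lborel) = (\<integral>\<^sup>+s\<in>{t..}. T s h x \<partial>lborel)"
    unfolding add_0_left .
  have "T t (U h) x = (\<integral>\<^sup>+y. (\<integral>\<^sup>+s. T s h y * indicator {0..} s \<partial>lborel) \<partial>\<kappa> t x)"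
    unfolding U_alt[OF h] ..
  also have "\<dots> = (\<integral>\<^sup>+s. (\<integral>\<^sup>+y. T s h y * indicator {0..} s \<partial>\<kappa> t x) \<partial>lborel)"
  proof (rule Fubini')
    show "(\<lambda>(s, y). T s h y * indicator {0..} s) \<in> borel_measurable (lborel \<Otimes>\<^sub>M \<kappa> t x)"
      using m unfolding split_beta' by measurable
  qed
  also have "\<dots> = (\<integral>\<^sup>+s\<in>{0..}. T (s + t) h x \<partial>lborel)"
  proof (intro nn_integral_cong)
    fix s :: real
    show "(\<integral>\<^sup>+y. T s h y * indicator {0..} s \<partial>\<kappa> t x) = T (s + t) h x * indicator {0..} s"
      using semigroup[OF t _ h, of s x] by (cases "0 \<le> s") (simp_all add: add.commute)
  qed
  finally show "T t (U h) x = (\<integral>\<^sup>+s\<in>{t..}. T s h x \<partial>lborel)" unfolding shift .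
  have "U (T t h) x = (\<integral>\<^sup>+s\<in>{0..}. T s (T t h) x \<partial>lborel)"
    by (rule U_alt[OF measurable_T1[OF h]])
  also have "\<dots> = (\<integral>\<^sup>+s\<in>{0..}. T (s + t) h x \<partial>lborel)"
  proof (intro nn_integral_cong)
    fix s :: real
    show "T s (T t h) x * indicator {0..} s = T (s + t) h x * indicator {0..} s"
      using semigroup[OF _ t h, of s x] by (cases "0 \<le> s") simp_all
  qed
  finally show "U (T t h) x = (\<integral>\<^sup>+s\<in>{t..}. T s h x \<partial>lborel)" unfolding shift .
qed

text \<open>The time axis is cut at \<open>t\<close>. Sums take the place of differences, as the
  potentials may be infinite.\<close>

lemma A_plus_T_U:
  assumes h: "h \<in> borel_measurable borel" and t: "0 \<le> t"
  shows "A t h x + T t (U h) x = U h x" and "A t h x + U (T t h) x = U h x"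
proof -
  have "(\<lambda>s. T s h x) \<in> borel_measurable borel"
    by (rule measurable_T[OF h]) simp_all
  from nn_integral_split_interval(1)[OF this t]
  show "A t h x + T t (U h) x = U h x" "A t h x + U (T t h) x = U h x"
    by (simp_all only: T_U[OF h t] A_def U_alt[OF h, of x])
qed

lemma supermedian_U: "h \<in> borel_measurable borel \<Longrightarrow> supermedian (U h)"
  unfolding supermedian_def 
  using A_plus_T_U(1)[of h, symmetric] by (simp add: measurable_U)

lemma U_pos:
  assumes h: "h \<in> borel_measurable borel" and pos: "\<forall>\<^sub>F s in at_right 0. 0 < T s h x"
  shows "0 < U h x"
proof (rule ccontr)
  assume "\<not> 0 < U h x"
  then have U0: "U h x = 0" by (simp add: zero_less_iff_neq_zero)
  obtain d :: real where d: "0 < d" "\<And>s. 0 < s \<Longrightarrow> s < d \<Longrightarrow> 0 < T s h x"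
    using pos unfolding eventually_at_right_field by auto
  have "(\<integral>\<^sup>+s\<in>{0..}. T s h x \<partial>lborel) = 0"
    using U0 by (simp only: U_alt[OF h])
  moreover have "(\<lambda>s. T s h x * indicator {0..} s) \<in> borel_measurable lborel"
    using measurable_T[OF h, of "\<lambda>s. s" lborel "\<lambda>_. x"] by measurable
  ultimately have "AE s in lborel. T s h x * indicator {0..} s = 0"
    by (simp add: nn_integral_0_iff_AE)
  then have "AE s in lborel. s \<notin> {0<..<d}"
  proof eventually_elim
    case (elim s)
    then show ?case using d(2)[of s] by auto
  qed
  then have "emeasure lborel {0<..<d} = 0"
    by (rule AE_iff_measurable[THEN iffD1, rotated 2]) auto
  then show False using d(1) by simp
qed

section \<open>Support of the reference measure; from integrated to pointwise inequalities\<close>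

text \<open>If \<open>V\<close> were a null set, its potential would vanish at \<open>x\<close>, but
  from \<open>x\<close> the semigroup gives mass to \<open>V\<close> at all small times.\<close>

lemma emeasure_m_pos:
  assumes V: "open V" "x \<in> V"
  shows "0 < emeasure m V"
proof (rule ccontr)
  assume "\<not> 0 < emeasure m V"
  then have 0: "emeasure m V = 0" by (simp add: zero_less_iff_neq_zero)
  have Vs: "V \<in> sets borel" using V by simp
  have "U (indicator V) x \<le> (\<integral>\<^sup>+y. \<infinity> * indicator V y \<partial>m)"
    unfolding U_def by (intro nn_integral_mono) (auto simp: indicator_def)
  also have "\<dots> = 0" using Vs 0 by (subst nn_integral_cmult_indicator) (auto simp: sets_m)
  finally have "U (indicator V) x = 0" by simp
  moreover have "0 < U (indicator V) x"
    using V by (intro U_pos lsc_eventually_less_T lsc_indicator) auto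
  ultimately show False by simp
qed

lemma exists_small_nhd:
  assumes W: "open W" "x \<in> W"
  shows "\<exists>V. open V \<and> x \<in> V \<and> V \<subseteq> W \<and> 0 < emeasure m V \<and> emeasure m V < \<infinity>"
proof -
  obtain V where V: "open V" "x \<in> V" "emeasure m V < \<infinity>" using locally_bounded by blast
  have "emeasure m (V \<inter> W) \<le> emeasure m V"
    using V W by (intro emeasure_mono) (auto simp: sets_m)
  then have "emeasure m (V \<inter> W) < \<infinity>" using V(3) by (rule le_less_trans)
  then show ?thesis
    using V W emeasure_m_pos[of "V \<inter> W" x] by (intro exI[of _ "V \<inter> W"]) auto
qed

text \<open>If it failed at \<open>y\<close>, then \<open>v < b < c < w\<close> would hold near
  \<open>y\<close>, and a neighbourhood of positive finite measure contradicts the integrated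
  inequality.\<close>

lemma le_if_integral_le:
  assumes v: "continuous_on UNIV v" and w: "lsc w"
    and le: "\<And>V. open V \<Longrightarrow> (\<integral>\<^sup>+z\<in>V. w z \<partial>m) \<le> (\<integral>\<^sup>+z\<in>V. ennreal (v z) \<partial>m)"
  shows "w y \<le> ennreal (v y)"
proof (rule ccontr)
  assume "\<not> w y \<le> ennreal (v y)"
  then have "ennreal (v y) < w y" by simp
  then obtain c where c: "ennreal (v y) < c" "c < w y" using dense by blast
  then obtain b where b: "ennreal (v y) < b" "b < c" using dense by blast
  have "open {z. ennreal (v z) < b}"
    using v by (intro open_Collect_less continuous_on_ennreal continuous_on_const) auto
  moreover have "open {z. c < w z}" using w by (simp add: lsc_def)
  ultimately obtain V where V: "open V" "y \<in> V" "V \<subseteq> {z. ennreal (v z) < b} \<inter> {z. c < w z}"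
    "0 < emeasure m V" "emeasure m V < \<infinity>"
    using exists_small_nhd[of "{z. ennreal (v z) < b} \<inter> {z. c < w z}" y] b c by blast
  have Vs: "V \<in> sets m" using V(1) by (simp add: sets_m)
  have "c * emeasure m V = (\<integral>\<^sup>+z\<in>V. c \<partial>m)"
    using Vs by (simp add: nn_integral_cmult_indicator)
  also have "\<dots> \<le> (\<integral>\<^sup>+z\<in>V. w z \<partial>m)"
    using V(3) by (intro nn_integral_mono) (auto simp: indicator_def less_imp_le)
  also have "\<dots> \<le> (\<integral>\<^sup>+z\<in>V. ennreal (v z) \<partial>m)" by (rule le[OF V(1)])
  also have "\<dots> \<le> (\<integral>\<^sup>+z\<in>V. b \<partial>m)"
    using V(3) by (intro nn_integral_mono) (auto simp: indicator_def less_imp_le)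
  also have "\<dots> = b * emeasure m V"
    using Vs by (simp add: nn_integral_cmult_indicator)
  also have "\<dots> < c * emeasure m V"
    using V(4,5) b(2) by (intro ennreal_mult_strict_right_mono) auto
  finally show False by simp
qed

section \<open>Energy of functions\<close>

lemma energy_integral:
  assumes h: "h \<in> borel_measurable borel" and k: "k \<in> borel_measurable borel"
  shows "(\<integral>\<^sup>+x. h x * U k x \<partial>m) = (\<integral>\<^sup>+s\<in>{0..}. (\<integral>\<^sup>+x. h x * T s k x \<partial>m) \<partial>lborel)"
proof -
  interpret pair_sigma_finite lborel m ..
  have Ts: "(\<lambda>s. T s k x) \<in> borel_measurable borel" for x
    by (rule measurable_T[OF k]) simp_all
  have h': "h \<in> borel_measurable m" and Tk: "T s k \<in> borel_measurable m" for s
    using h measurable_T1[OF k] by (simp_all add: measurable_cong_sets[OF sets_m refl])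
  have Tp: "(\<lambda>z. T (fst z) k (snd z)) \<in> borel_measurable (lborel \<Otimes>\<^sub>M m)"
    by (rule measurable_T[OF k]) measurable
  have m: "(\<lambda>(s, x). h x * (T s k x * indicator {0..} s)) \<in> borel_measurable (lborel \<Otimes>\<^sub>M m)"
    using Tp h' unfolding split_beta' by measurable
  have "(\<integral>\<^sup>+x. h x * U k x \<partial>m) = (\<integral>\<^sup>+x. (\<integral>\<^sup>+s. h x * (T s k x * indicator {0..} s) \<partial>lborel) \<partial>m)"
  proof (intro nn_integral_cong)
    fix x
    show "h x * U k x = (\<integral>\<^sup>+s. h x * (T s k x * indicator {0..} s) \<partial>lborel)"
      unfolding U_alt[OF k] by (rule nn_integral_cmult[symmetric]) (use Ts[of x] in measurable)
  qed
  also have "\<dots> = (\<integral>\<^sup>+s. (\<integral>\<^sup>+x. h x * (T s k x * indicator {0..} s) \<partial>m) \<partial>lborel)"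
    by (rule Fubini'[OF m])
  also have "\<dots> = (\<integral>\<^sup>+s\<in>{0..}. (\<integral>\<^sup>+x. h x * T s k x \<partial>m) \<partial>lborel)"
  proof (intro nn_integral_cong)
    fix s
    have hT: "(\<lambda>x. h x * T s k x) \<in> borel_measurable m"
      using h' Tk by measurable
    show "(\<integral>\<^sup>+x. h x * (T s k x * indicator {0..} s) \<partial>m) = (\<integral>\<^sup>+x. h x * T s k x \<partial>m) * indicator {0..} s"
      unfolding mult.assoc[symmetric] by (rule nn_integral_multc[OF hT])
  qed
  finally show ?thesis .
qed

lemma energy_sym:
  assumes h: "h \<in> borel_measurable borel" and k: "k \<in> borel_measurable borel"
  shows "(\<integral>\<^sup>+x. h x * U k x \<partial>m) = (\<integral>\<^sup>+x. k x * U h x \<partial>m)"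
proof -
  have "(\<integral>\<^sup>+x. h x * U k x \<partial>m) = (\<integral>\<^sup>+s\<in>{0..}. (\<integral>\<^sup>+x. k x * T s h x \<partial>m) \<partial>lborel)"
    unfolding energy_integral[OF h k]
  proof (intro nn_integral_cong)
    fix s :: real
    show "(\<integral>\<^sup>+x. h x * T s k x \<partial>m) * indicator {0..} s = (\<integral>\<^sup>+x. k x * T s h x \<partial>m) * indicator {0..} s"
      using symmetric[OF _ h k, of s] by (cases "0 \<le> s") (simp_all add: mult.commute)
  qed
  then show ?thesis unfolding energy_integral[OF k h] .
qed

text \<open>Positivity of the energy: \<open>\<langle>h, T\<^sub>s k\<rangle> = \<langle>T\<^sub>s\<^sub>/\<^sub>2 h, T\<^sub>s\<^sub>/\<^sub>2 k\<rangle>\<close>.\<close>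

lemma energy_ineq:
  assumes h: "h \<in> borel_measurable borel" and k: "k \<in> borel_measurable borel"
  shows "2 * (\<integral>\<^sup>+x. h x * U k x \<partial>m) \<le> (\<integral>\<^sup>+x. h x * U h x \<partial>m) + (\<integral>\<^sup>+x. k x * U k x \<partial>m)"
proof -
  have half: "(\<integral>\<^sup>+x. h x * T s k x \<partial>m) = (\<integral>\<^sup>+x. T (s / 2) h x * T (s / 2) k x \<partial>m)"
    if s: "0 \<le> s" and h: "h \<in> borel_measurable borel" and k: "k \<in> borel_measurable borel" for s h k
  proof -
    have "T s k x = T (s / 2) (T (s / 2) k) x" for x
      using semigroup[of "s / 2" "s / 2" k x] s k by simp
    then show ?thesis
      using symmetric[of "s / 2" h "T (s / 2) k"] s h measurable_T1[OF k] by simp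
  qed
  have meas: "(\<lambda>s. (\<integral>\<^sup>+x. h x * T s k x \<partial>m) * indicator {0..} s) \<in> borel_measurable lborel"
    if h: "h \<in> borel_measurable borel" and k: "k \<in> borel_measurable borel" for h k
  proof -
    have h': "h \<in> borel_measurable m" using h by (simp add: measurable_cong_sets[OF sets_m refl])
    have Tp: "(\<lambda>z. T (fst z) k (snd z)) \<in> borel_measurable (lborel \<Otimes>\<^sub>M m)"
      by (rule measurable_T[OF k]) measurable
    have "(\<lambda>(s, x). h x * T s k x) \<in> borel_measurable (lborel \<Otimes>\<^sub>M m)"
      using Tp h' unfolding split_beta' by measurable
    from m.borel_measurable_nn_integral[OF this]
    show ?thesis by measurable
  qed
  have "2 * (\<integral>\<^sup>+x. h x * U k x \<partial>m) = (\<integral>\<^sup>+s. 2 * ((\<integral>\<^sup>+x. h x * T s k x \<partial>m) * indicator {0..} s) \<partial>lborel)"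
    unfolding energy_integral[OF h k] by (rule nn_integral_cmult[symmetric, OF meas[OF h k]])
  also have "\<dots> \<le> (\<integral>\<^sup>+s. (\<integral>\<^sup>+x. h x * T s h x \<partial>m) * indicator {0..} s + (\<integral>\<^sup>+x. k x * T s k x \<partial>m) * indicator {0..} s \<partial>lborel)"
  proof (rule nn_integral_mono)
    fix s :: real
    show "2 * ((\<integral>\<^sup>+x. h x * T s k x \<partial>m) * indicator {0..} s)
      \<le> (\<integral>\<^sup>+x. h x * T s h x \<partial>m) * indicator {0..} s + (\<integral>\<^sup>+x. k x * T s k x \<partial>m) * indicator {0..} s"
    proof (cases "0 \<le> s")
      case True
      let ?h = "T (s / 2) h" and ?k = "T (s / 2) k"
      have hk: "?h \<in> borel_measurable m" "?k \<in> borel_measurable m"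
        using measurable_T1[OF h] measurable_T1[OF k] by (simp_all add: measurable_cong_sets[OF sets_m refl])
      have "2 * (\<integral>\<^sup>+x. ?h x * ?k x \<partial>m) = (\<integral>\<^sup>+x. 2 * (?h x * ?k x) \<partial>m)"
        by (rule nn_integral_cmult[symmetric]) (use hk in measurable)
      also have "\<dots> \<le> (\<integral>\<^sup>+x. ?h x * ?h x + ?k x * ?k x \<partial>m)"
        by (intro nn_integral_mono ennreal_two_mult_le)
      also have "\<dots> = (\<integral>\<^sup>+x. ?h x * ?h x \<partial>m) + (\<integral>\<^sup>+x. ?k x * ?k x \<partial>m)"
        by (rule nn_integral_add) (use hk in measurable)
      finally show ?thesis
        using True by (simp add: half[OF True h k] half[OF True h h] half[OF True k k])
    qed simp
  qed
  also have "\<dots> = (\<integral>\<^sup>+x. h x * U h x \<partial>m) + (\<integral>\<^sup>+x. k x * U k x \<partial>m)"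
    unfolding energy_integral[OF h h] energy_integral[OF k k]
    by (rule nn_integral_add[OF meas[OF h h] meas[OF k k]])
  finally show ?thesis .
qed

section \<open>Pointwise properties of the density \<open>u\<close>\<close>

text \<open>Symmetry is assumed of the semigroup, hence known for \<open>u\<close> in integrated
  form. By continuity \<open>u y x < b < c < u x y\<close> would persist on a box
  \<open>V \<times> W\<close>, where the mutual energy of the two indicators would be at least
  \<open>c\<close> and at most \<open>b\<close> times the measure of the box.\<close>

lemma u_sym_le: "u x y \<le> u y x"
proof (rule ccontr)
  assume "\<not> u x y \<le> u y x"
  then have "u y x < u x y" by simp
  then obtain c where c: "u y x < c" "c < u x y" using dense by blast
  then obtain b where b: "u y x < b" "b < c" using dense by blast
  have sw: "continuous_on UNIV (\<lambda>z. u (snd z) (fst z))" and st: "continuous_on UNIV (\<lambda>z. u (fst z) (snd z))"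
    using continuous_on_compose2[OF u_continuous, of UNIV "\<lambda>z. (snd z, fst z)"]
      continuous_on_compose2[OF u_continuous, of UNIV "\<lambda>z. (fst z, snd z)"]
    by (simp_all add: continuous_on_Pair continuous_on_fst continuous_on_snd continuous_on_id split_beta')
  have "open {z. u (snd z) (fst z) < b}" "open {z. c < u (fst z) (snd z)}"
    using sw st by (auto intro!: open_Collect_less continuous_on_const)
  then have "open ({z. u (snd z) (fst z) < b} \<inter> {z. c < u (fst z) (snd z)})" by (rule open_Int)
  moreover have "(x, y) \<in> {z. u (snd z) (fst z) < b} \<inter> {z. c < u (fst z) (snd z)}" using b c by simp
  ultimately obtain V0 W0 where VW0: "open V0" "open W0" "x \<in> V0" "y \<in> W0"
    "V0 \<times> W0 \<subseteq> {z. u (snd z) (fst z) < b} \<inter> {z. c < u (fst z) (snd z)}"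
    by (rule open_prod_elim) (auto simp: mem_Times_iff)
  obtain V where V: "open V" "V \<subseteq> V0" "0 < emeasure m V" "emeasure m V < \<infinity>"
    using exists_small_nhd[OF VW0(1,3)] by blast
  obtain W where W: "open W" "W \<subseteq> W0" "0 < emeasure m W" "emeasure m W < \<infinity>"
    using exists_small_nhd[OF VW0(2,4)] by blast
  have VW: "u b' a' < b" "c < u a' b'" if "a' \<in> V" "b' \<in> W" for a' b'
    using subsetD[OF VW0(5), of "(a', b')"] subsetD[OF V(2) that(1)] subsetD[OF W(2) that(2)] by simp_all
  have s[simp]: "V \<in> sets borel" "W \<in> sets borel" "V \<in> sets m" "W \<in> sets m"
    using V(1) W(1) by (simp_all add: sets_m)
  have b0: "0 \<le> b" "0 \<le> c" using b c u_nonneg[of y x] by auto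
  have "ennreal c * emeasure m W * emeasure m V = (\<integral>\<^sup>+a. ennreal c * emeasure m W * indicator V a \<partial>m)"
    by (simp add: nn_integral_cmult_indicator)
  also have "\<dots> \<le> (\<integral>\<^sup>+a. indicator V a * U (indicator W) a \<partial>m)"
  proof (rule nn_integral_mono)
    fix a
    have "ennreal c * emeasure m W \<le> U (indicator W) a" if "a \<in> V"
    proof -
      have "ennreal c * emeasure m W = (\<integral>\<^sup>+z. ennreal c * indicator W z \<partial>m)"
        by (simp add: nn_integral_cmult_indicator)
      also have "\<dots> \<le> U (indicator W) a"
        unfolding U_def using VW(2)[OF that] b0 by (intro nn_integral_mono) (auto simp: indicator_def ennreal_leI less_imp_le)
      finally show ?thesis .
    qed
    then show "ennreal c * emeasure m W * indicator V a \<le> indicator V a * U (indicator W) a"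
      by (simp add: indicator_def)
  qed
  also have "\<dots> = (\<integral>\<^sup>+a. indicator W a * U (indicator V) a \<partial>m)"
    by (intro energy_sym borel_measurable_indicator s)
  also have "\<dots> \<le> (\<integral>\<^sup>+a. ennreal b * emeasure m V * indicator W a \<partial>m)"
  proof (rule nn_integral_mono)
    fix a
    have "U (indicator V) a \<le> ennreal b * emeasure m V" if "a \<in> W"
    proof -
      have "U (indicator V) a \<le> (\<integral>\<^sup>+z. ennreal b * indicator V z \<partial>m)"
        unfolding U_def using VW(1)[OF _ that] b0 by (intro nn_integral_mono) (auto simp: indicator_def ennreal_leI less_imp_le)
      then show ?thesis by (simp add: nn_integral_cmult_indicator)
    qed
    then show "indicator W a * U (indicator V) a \<le> ennreal b * emeasure m V * indicator W a"
      by (simp add: indicator_def)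
  qed
  also have "\<dots> = ennreal b * (emeasure m W * emeasure m V)"
    by (subst nn_integral_cmult_indicator[OF s(4)]) (simp only: mult_ac)
  also have "\<dots> < ennreal c * (emeasure m W * emeasure m V)"
    using V W b b0 by (intro ennreal_mult_strict_right_mono)
      (auto simp: ennreal_less_iff ennreal_zero_less_mult_iff ennreal_mult_less_top)
  finally show False by (simp add: mult.assoc)
qed

lemma u_sym: "u x y = u y x"
  using u_sym_le[of x y] u_sym_le[of y x] by simp

lemma T_u_integral:
  assumes h: "h \<in> borel_measurable borel"
  shows "(\<integral>\<^sup>+y. T s (\<lambda>z. ennreal (u z y)) x * h y \<partial>m) = T s (U h) x"
    and "(\<lambda>y. T s (\<lambda>z. ennreal (u z y)) x) \<in> borel_measurable borel"
proof -
  interpret k: finite_measure "\<kappa> s x" by (rule finite_\<kappa>)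
  interpret pair_sigma_finite "\<kappa> s x" m ..
  have uk: "(\<lambda>z. ennreal (u z y)) \<in> borel_measurable (\<kappa> s x)" for y
    by (simp add: measurable_cong_sets[OF sets_\<kappa> refl])
  have up: "(\<lambda>z. u (fst z) (snd z)) \<in> borel_measurable (\<kappa> s x \<Otimes>\<^sub>M m)"
    using measurable_u by (simp add: split_beta' measurable_cong_sets[OF sets_pair_measure_cong[OF sets_\<kappa> sets_m] refl])
  have h': "h \<in> borel_measurable m" using h by (simp add: measurable_cong_sets[OF sets_m refl])
  have "(\<integral>\<^sup>+y. T s (\<lambda>z. ennreal (u z y)) x * h y \<partial>m) = (\<integral>\<^sup>+y. (\<integral>\<^sup>+z. ennreal (u z y) * h y \<partial>\<kappa> s x) \<partial>m)"
    by (intro nn_integral_cong nn_integral_multc[symmetric] uk)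
  also have "\<dots> = (\<integral>\<^sup>+z. (\<integral>\<^sup>+y. ennreal (u z y) * h y \<partial>m) \<partial>\<kappa> s x)"
    by (rule Fubini') (use up h' in \<open>simp add: split_beta'\<close>)
  finally show "(\<integral>\<^sup>+y. T s (\<lambda>z. ennreal (u z y)) x * h y \<partial>m) = T s (U h) x"
    by (simp add: U_def[abs_def])
  have "(\<lambda>z. ennreal (u (snd z) (fst z))) \<in> borel_measurable (borel \<Otimes>\<^sub>M \<kappa> s x)"
    using measurable_u u_sym by (simp add: split_beta' measurable_cong_sets[OF sets_pair_measure_cong[OF refl sets_\<kappa>] refl])
  then show "(\<lambda>y. T s (\<lambda>z. ennreal (u z y)) x) \<in> borel_measurable borel"
    by (intro k.borel_measurable_nn_integral) (simp add: split_beta')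
qed

text \<open>For fixed \<open>x\<close>, both sides are compared as functions of \<open>y\<close>.
  Integrated over an open \<open>V\<close>, the claim says that \<open>U (indicator V)\<close> is
  supermedian; the left side is lower semicontinuous and the right side continuous in
  \<open>y\<close>, so it holds at each \<open>y\<close>.\<close>

lemma supermedian_u: "supermedian (\<lambda>x. ennreal (u x y))"
proof -
  have "T s (\<lambda>z. ennreal (u z y)) x \<le> ennreal (u x y)" if s: "0 \<le> s" for s x
  proof (rule le_if_integral_le[of "u x" "\<lambda>y. T s (\<lambda>z. ennreal (u z y)) x"])
    show "continuous_on UNIV (u x)" by (rule u_continuous2)
    show "lsc (\<lambda>y. T s (\<lambda>z. ennreal (u z y)) x)"
      by (intro lsc_nn_integral continuous_on_ennreal u_continuous2)
         (simp_all add: measurable_cong_sets[OF sets_\<kappa> refl])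
    fix V :: "'a set" assume "open V"
    then have V: "indicator V \<in> borel_measurable (borel :: 'a measure)" by simp
    have "(\<integral>\<^sup>+y\<in>V. T s (\<lambda>z. ennreal (u z y)) x \<partial>m) = T s (U (indicator V)) x"
      by (rule T_u_integral[OF V])
    also have "\<dots> \<le> U (indicator V) x"
      by (rule supermedianD(2)[OF supermedian_U[OF V] s])
    finally show "(\<integral>\<^sup>+y\<in>V. T s (\<lambda>z. ennreal (u z y)) x \<partial>m) \<le> (\<integral>\<^sup>+y\<in>V. ennreal (u x y) \<partial>m)"
      by (simp add: U_def)
  qed
  then show ?thesis by (simp add: supermedian_def)
qed

lemma lsc_u: "lsc (\<lambda>x. ennreal (u x y))"
  by (intro lsc_continuous continuous_on_ennreal u_continuous1)

lemma U_\<eta>_finite: "U \<eta> x < \<infinity>"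
  using \<eta>_potential by (simp add: U_def)

lemma U_\<eta>_pos: "0 < U \<eta> x"
proof (rule U_pos[OF \<eta>_borel])
  have "((\<lambda>s. emeasure (\<kappa> s x) UNIV) \<longlongrightarrow> 1) (at_right 0)"
    by (rule right_continuous) auto
  then have "\<forall>\<^sub>F s in at_right 0. 0 < emeasure (\<kappa> s x) UNIV"
    by (rule order_tendstoD(1)) simp
  then show "\<forall>\<^sub>F s in at_right 0. 0 < T s \<eta> x"
  proof eventually_elim
    case (elim s)
    show ?case
    proof (rule ccontr)
      assume "\<not> 0 < T s \<eta> x"
      then have "T s \<eta> x = 0" by (simp add: zero_less_iff_neq_zero)
      then have "AE y in \<kappa> s x. \<eta> y = 0"
        by (subst (asm) nn_integral_0_iff_AE) (simp_all add: measurable_cong_sets[OF sets_\<kappa> refl])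
      then have "AE y in \<kappa> s x. False"
        by eventually_elim (use \<eta>_pos in \<open>simp add: zero_less_iff_neq_zero\<close>)
      then have "emeasure (\<kappa> s x) UNIV = 0"
        using AE_iff_null[of "\<kappa> s x" "\<lambda>_. False"] by (simp add: null_sets_def sets_\<kappa>)
      then show False using elim by simp
    qed
  qed
qed

section \<open>Time averages of the transition measures\<close>

lemma measurable_time: "h \<in> borel_measurable borel \<Longrightarrow> (\<lambda>s. T s h x) \<in> borel_measurable borel"
  by (rule measurable_T) simp_all

lemma measurable_m: "f \<in> borel_measurable borel \<Longrightarrow> f \<in> borel_measurable m"
  by (simp add: measurable_cong_sets[OF sets_m refl])

lemma measurable_k: "f \<in> borel_measurable borel \<Longrightarrow> f \<in> borel_measurable (\<kappa> s x)"
  by (simp add: measurable_cong_sets[OF sets_\<kappa> refl])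

abbreviation S :: "real \<Rightarrow> ('a \<Rightarrow> ennreal) \<Rightarrow> 'a \<Rightarrow> ennreal" where
  "S t h x \<equiv> ennreal (1 / t) * A t h x"

lemma A_SUP:
  assumes "incseq h" "\<And>n. h n \<in> borel_measurable borel"
  shows "A t (\<lambda>y. SUP n. h n y) x = (SUP n. A t (h n) x)"
proof -
  have "A t (\<lambda>y. SUP n. h n y) x = (\<integral>\<^sup>+s. (SUP n. T s (h n) x * indicator {0..t} s) \<partial>lborel)"
    unfolding A_def
  proof (intro nn_integral_cong)
    fix s
    have "T s (\<lambda>y. SUP n. h n y) x = (SUP n. T s (h n) x)"
      by (rule nn_integral_monotone_convergence_SUP[OF assms(1) measurable_k[OF assms(2)]])
    then show "T s (\<lambda>y. SUP n. h n y) x * indicator {0..t} s = (SUP n. T s (h n) x * indicator {0..t} s)"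
      by (simp add: SUP_mult_right_ennreal)
  qed
  also have "\<dots> = (SUP n. \<integral>\<^sup>+s. T s (h n) x * indicator {0..t} s \<partial>lborel)"
  proof (rule nn_integral_monotone_convergence_SUP)
    show "incseq (\<lambda>n s. T s (h n) x * indicator {0..t} s)"
      using assms(1) by (intro incseq_SucI le_funI mult_right_mono T_mono) (auto simp: incseq_Suc_iff le_fun_def)
    show "(\<lambda>s. T s (h n) x * indicator {0..t} s) \<in> borel_measurable lborel" for n
      using measurable_time[OF assms(2)[of n], of x] by measurable
  qed
  finally show ?thesis by (simp add: A_def)
qed

text \<open>The averaged transition measure \<open>S t (x, \<cdot>)\<close> has the density
  \<open>(u(x, y) - T\<^sub>t u(\<cdot>, y)(x)) / t\<close>.\<close>

lemma exists_density:
  assumes t: "0 < t"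
  shows "\<exists>\<xi>\<in>borel_measurable borel. (\<forall>y. \<xi> y < \<infinity>) \<and>
    (\<forall>h\<in>borel_measurable borel. (\<integral>\<^sup>+y. \<xi> y * h y \<partial>m) = S t h x)"
proof -
  define w where "w y = T t (\<lambda>z. ennreal (u z y)) x" for y
  define \<xi> where "\<xi> y = ennreal (1 / t) * (ennreal (u x y) - w y)" for y
  have w[measurable]: "w \<in> borel_measurable borel"
    unfolding w_def by (rule T_u_integral(2)[of "\<lambda>_. 0"]) simp
  have wu: "w y \<le> ennreal (u x y)" for y
    unfolding w_def using supermedianD(2)[OF supermedian_u] t by simp
  have \<xi>[measurable]: "\<xi> \<in> borel_measurable borel"
    unfolding \<xi>_def by measurable
  have fin: "\<xi> y < \<infinity>" for y
    unfolding \<xi>_def by (auto simp: ennreal_mult_less_top intro: le_less_trans[OF diff_le_self_ennreal])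
  have 1: "(\<integral>\<^sup>+y. \<xi> y * h y \<partial>m) = S t h x" if h: "h \<in> borel_measurable borel" "\<And>y. h y < \<infinity>" and Uh: "U h x < \<infinity>" for h
  proof -
    have hm: "h \<in> borel_measurable m" "w \<in> borel_measurable m" "(\<lambda>y. ennreal (u x y)) \<in> borel_measurable m"
      using h(1) w by (auto intro!: measurable_m)
    have "(\<integral>\<^sup>+y. \<xi> y * h y \<partial>m) = (\<integral>\<^sup>+y. ennreal (1 / t) * (ennreal (u x y) * h y - w y * h y) \<partial>m)"
    proof (intro nn_integral_cong)
      fix y
      have "(ennreal (u x y) - w y) * h y = ennreal (u x y) * h y - w y * h y"
        using ennreal_right_diff_distrib[of "h y" "ennreal (u x y)" "w y"] h(2)[of y] by (simp add: mult.commute less_top)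
      then show "\<xi> y * h y = ennreal (1 / t) * (ennreal (u x y) * h y - w y * h y)"
        by (simp add: \<xi>_def mult.assoc)
    qed
    also have "\<dots> = ennreal (1 / t) * (\<integral>\<^sup>+y. ennreal (u x y) * h y - w y * h y \<partial>m)"
      by (rule nn_integral_cmult) (use hm in measurable)
    also have "(\<integral>\<^sup>+y. ennreal (u x y) * h y - w y * h y \<partial>m) = U h x - T t (U h) x"
    proof -
      have le: "T t (U h) x \<le> U h x"
        using supermedianD(2)[OF supermedian_U[OF h(1)]] t by simp
      have "(\<integral>\<^sup>+y. ennreal (u x y) * h y - w y * h y \<partial>m) = (\<integral>\<^sup>+y. ennreal (u x y) * h y \<partial>m) - (\<integral>\<^sup>+y. w y * h y \<partial>m)"
      proof (rule nn_integral_diff)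
        show "(\<integral>\<^sup>+y. w y * h y \<partial>m) \<noteq> \<infinity>"
          using le Uh unfolding w_def T_u_integral(1)[OF h(1)] by (auto simp: top_unique)
        show "AE y in m. w y * h y \<le> ennreal (u x y) * h y"
          by (intro AE_I2 mult_right_mono wu) simp
      qed (use hm in measurable)
      then show ?thesis unfolding w_def T_u_integral(1)[OF h(1)] U_def[of h x, symmetric] .
    qed
    also have "U h x - T t (U h) x = A t h x"
    proof -
      have eq: "A t h x + T t (U h) x = U h x" using A_plus_T_U(1)[OF h(1)] t by simp
      have "T t (U h) x \<noteq> \<top>" using eq Uh by auto
      then show ?thesis unfolding eq[symmetric] by (rule ennreal_add_diff_cancel_right)
    qed
    finally show ?thesis .
  qed
  have "(\<integral>\<^sup>+y. \<xi> y * h y \<partial>m) = S t h x" if h: "h \<in> borel_measurable borel" for h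
  proof -
    \<comment> \<open>Step \<open>1\<close> subtracts and so works with finite values and a finite
      potential; cutting at \<open>of_nat n * \<eta> y\<close> provides both.\<close>
    define k where "k n y = min (h y) (of_nat n * \<eta> y)" for n :: nat and y
    have k: "k n \<in> borel_measurable borel" for n
      unfolding k_def using h by measurable
    have inc: "incseq k"
      unfolding k_def by (intro incseq_SucI le_funI min.mono order_refl mult_right_mono) auto
    have sup: "(SUP n. k n y) = h y" for y
      unfolding k_def by (rule ennreal_SUP_min_mult[OF \<eta>_pos])
    have "U (k n) x < \<infinity>" for n
    proof -
      have "U (k n) x \<le> (\<integral>\<^sup>+y. of_nat n * (ennreal (u x y) * \<eta> y) \<partial>m)"
        unfolding U_def k_def by (intro nn_integral_mono) (auto simp: mult.left_commute[of _ "ennreal _"] intro!: mult_left_mono)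
      also have "\<dots> = of_nat n * U \<eta> x"
        unfolding U_def by (rule nn_integral_cmult) (intro measurable_m, measurable)
      finally show ?thesis
        by (rule le_less_trans) (use U_\<eta>_finite[of x] in \<open>simp add: ennreal_mult_less_top of_nat_less_top\<close>)
    qed
    moreover have "k n y < \<infinity>" for n y
    proof -
      have "k n y \<le> of_nat n * 1"
        unfolding k_def using mult_left_mono[OF \<eta>_le_1[of y], of "of_nat n"] by (rule min.coboundedI2) simp
      then show ?thesis by (rule le_less_trans) (simp add: less_top[symmetric])
    qed
    ultimately have k1: "(\<integral>\<^sup>+y. \<xi> y * k n y \<partial>m) = S t (k n) x" for n
      using 1[OF k] by blast
    have "(\<integral>\<^sup>+y. \<xi> y * h y \<partial>m) = (\<integral>\<^sup>+y. (SUP n. \<xi> y * k n y) \<partial>m)"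
      by (simp add: sup SUP_mult_left_ennreal[symmetric])
    also have "\<dots> = (SUP n. \<integral>\<^sup>+y. \<xi> y * k n y \<partial>m)"
      using inc k \<xi>
      by (intro nn_integral_monotone_convergence_SUP)
         (auto simp: incseq_def le_fun_def intro!: mult_left_mono measurable_m)
    also have "\<dots> = (SUP n. S t (k n) x)"
      unfolding k1 ..
    also have "\<dots> = S t h x"
      unfolding SUP_mult_left_ennreal[symmetric] A_SUP[OF inc k, symmetric] sup ..
    finally show ?thesis .
  qed
  then show ?thesis using \<xi> fin by blast
qed

section \<open>Energy of charges with point masses\<close>

text \<open>A charge \<open>\<Sum>\<^sub>x c x \<delta>\<^sub>x + h m\<close>, viewed as a functional.\<close>

definition charge :: "'a set \<Rightarrow> ('a \<Rightarrow> real) \<Rightarrow> ('a \<Rightarrow> ennreal) \<Rightarrow> ('a \<Rightarrow> ennreal) \<Rightarrow> ennreal" where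
  "charge J c h v = (\<Sum>x\<in>J. ennreal (c x) * v x) + (\<integral>\<^sup>+y. h y * v y \<partial>m)"

text \<open>Coefficients pass through \<open>ennreal\<close>, so a negative one counts as 0; signed
  charges are handled as pairs of nonnegative ones.\<close>

definition pot :: "'a set \<Rightarrow> ('a \<Rightarrow> real) \<Rightarrow> ('a \<Rightarrow> ennreal) \<Rightarrow> 'a \<Rightarrow> ennreal" where
  "pot J c h x = (\<Sum>y\<in>J. ennreal (c y) * ennreal (u x y)) + U h x"

lemma charge_u: "charge J c h (\<lambda>y. ennreal (u x y)) = pot J c h x"
  by (simp add: charge_def pot_def U_def mult.commute)

lemma charge_mono: "(\<And>x. v x \<le> w x) \<Longrightarrow> charge J c h v \<le> charge J c h w"
  unfolding charge_def by (intro add_mono sum_mono nn_integral_mono mult_left_mono) auto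

lemma supermedian_u': "supermedian (\<lambda>y. ennreal (u x y))" and lsc_u': "lsc (\<lambda>y. ennreal (u x y))"
  using supermedian_u[of x] lsc_u[of x] by (simp_all only: u_sym[of x])

text \<open>Reciprocity: testing the diffuse part \<open>h\<close> against the potential of the
  other charge amounts to testing that charge against \<open>U h\<close>, by symmetry of
  \<open>u\<close> and of the energy.\<close>

lemma charge_pot:
  assumes h: "h \<in> borel_measurable borel" and k: "k \<in> borel_measurable borel"
  shows "charge J c h (pot L d k) = (\<Sum>x\<in>J. ennreal (c x) * pot L d k x) + charge L d k (U h)"
proof -
  have "(\<integral>\<^sup>+x. h x * pot L d k x \<partial>m) = (\<integral>\<^sup>+x. (\<Sum>y\<in>L. ennreal (d y) * (ennreal (u y x) * h x)) + h x * U k x \<partial>m)"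
    by (intro nn_integral_cong) (simp add: pot_def distrib_left sum_distrib_left mult_ac u_sym)
  also have "\<dots> = (\<integral>\<^sup>+x. (\<Sum>y\<in>L. ennreal (d y) * (ennreal (u y x) * h x)) \<partial>m) + (\<integral>\<^sup>+x. h x * U k x \<partial>m)"
    by (rule nn_integral_add) (use h k in \<open>auto intro!: measurable_m\<close>)
  also have "(\<integral>\<^sup>+x. (\<Sum>y\<in>L. ennreal (d y) * (ennreal (u y x) * h x)) \<partial>m) = (\<Sum>y\<in>L. ennreal (d y) * U h y)"
    unfolding U_def using h
    by (subst nn_integral_sum) (auto intro!: measurable_m sum.cong nn_integral_cmult)
  also have "(\<integral>\<^sup>+x. h x * U k x \<partial>m) = (\<integral>\<^sup>+x. k x * U h x \<partial>m)"
    by (rule energy_sym[OF h k])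
  finally show ?thesis by (simp add: charge_def)
qed

text \<open>Each point mass is smeared into the density of \<open>S t\<close> at that point, which
  makes the charge a function to which \<open>energy_ineq\<close> applies.\<close>

lemma exists_approximation:
  assumes J: "finite J" and h: "h \<in> borel_measurable borel" "\<And>x. h x < \<infinity>" and t: "0 < t"
  shows "\<exists>\<xi>\<in>borel_measurable borel. (\<forall>y. \<xi> y < \<infinity>) \<and>
    (\<forall>v\<in>borel_measurable borel. (\<integral>\<^sup>+y. \<xi> y * v y \<partial>m) = (\<Sum>x\<in>J. ennreal (c x) * S t v x) + (\<integral>\<^sup>+y. h y * v y \<partial>m))"
proof -
  obtain \<delta> where \<delta>: "\<And>x. \<delta> x \<in> borel_measurable borel" "\<And>x y. \<delta> x y < \<infinity>"
    "\<And>x v. v \<in> borel_measurable borel \<Longrightarrow> (\<integral>\<^sup>+y. \<delta> x y * v y \<partial>m) = S t v x"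
    using exists_density[OF t] by metis
  define \<xi> where "\<xi> y = (\<Sum>x\<in>J. ennreal (c x) * \<delta> x y) + h y" for y
  have "\<xi> \<in> borel_measurable borel"
    unfolding \<xi>_def using \<delta>(1) h(1) by measurable
  moreover have "\<xi> y < \<infinity>" for y
    unfolding \<xi>_def using \<delta>(2) h(2) J by (simp add: ennreal_mult_less_top)
  moreover have "(\<integral>\<^sup>+y. \<xi> y * v y \<partial>m) = (\<Sum>x\<in>J. ennreal (c x) * S t v x) + (\<integral>\<^sup>+y. h y * v y \<partial>m)"
    if v: "v \<in> borel_measurable borel" for v
  proof -
    have "(\<integral>\<^sup>+y. \<xi> y * v y \<partial>m) = (\<integral>\<^sup>+y. (\<Sum>x\<in>J. ennreal (c x) * (\<delta> x y * v y)) + h y * v y \<partial>m)"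
      by (intro nn_integral_cong) (simp add: \<xi>_def distrib_right sum_distrib_right mult.assoc)
    also have "\<dots> = (\<integral>\<^sup>+y. (\<Sum>x\<in>J. ennreal (c x) * (\<delta> x y * v y)) \<partial>m) + (\<integral>\<^sup>+y. h y * v y \<partial>m)"
      by (rule nn_integral_add) (use \<delta>(1) h(1) v in \<open>auto intro!: measurable_m\<close>)
    also have "(\<integral>\<^sup>+y. (\<Sum>x\<in>J. ennreal (c x) * (\<delta> x y * v y)) \<partial>m) = (\<Sum>x\<in>J. ennreal (c x) * S t v x)"
    proof -
      have "(\<integral>\<^sup>+y. (\<Sum>x\<in>J. ennreal (c x) * (\<delta> x y * v y)) \<partial>m) = (\<Sum>x\<in>J. \<integral>\<^sup>+y. ennreal (c x) * (\<delta> x y * v y) \<partial>m)"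
        by (rule nn_integral_sum) (use \<delta>(1) v in \<open>auto intro!: measurable_m\<close>)
      also have "\<dots> = (\<Sum>x\<in>J. ennreal (c x) * (\<integral>\<^sup>+y. \<delta> x y * v y \<partial>m))"
        by (intro sum.cong refl nn_integral_cmult) (use \<delta>(1) v in \<open>auto intro!: measurable_m\<close>)
      finally show ?thesis unfolding \<delta>(3)[OF v] .
    qed
    finally show ?thesis .
  qed
  ultimately show ?thesis by blast
qed

text \<open>Positivity of the energy for the difference of two charges, written without subtraction.
  The charges are smeared with times \<open>s\<close> and \<open>t\<close> of their own;
  self-energies do not increase, and the mutual energy is recovered by letting first
  \<open>s\<close>, then \<open>t\<close> tend to 0, one at a time because \<open>tendsto_A\<close>
  concerns a fixed function.\<close>

lemma mixed_energy:
  assumes J: "finite J" and L: "finite L"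
    and h: "h \<in> borel_measurable borel" "\<And>x. h x < \<infinity>"
    and k: "k \<in> borel_measurable borel" "\<And>x. k x < \<infinity>"
  shows "2 * charge J c h (pot L d k) \<le> charge J c h (pot J c h) + charge L d k (pot L d k)"
proof -
  let ?C = "charge J c h (pot J c h) + charge L d k (pot L d k)"
  have "\<exists>\<xi>. \<forall>t>0. \<xi> t \<in> borel_measurable borel \<and> (\<forall>y. \<xi> t y < \<infinity>) \<and>
    (\<forall>v\<in>borel_measurable borel. (\<integral>\<^sup>+y. \<xi> t y * v y \<partial>m) = (\<Sum>x\<in>J. ennreal (c x) * S t v x) + (\<integral>\<^sup>+y. h y * v y \<partial>m))"
    if "finite J" "h \<in> borel_measurable borel" "\<And>x. h x < \<infinity>" for J c h
    using exists_approximation[OF that] by (intro choice allI) blast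
  from this[OF J h, of c] this[OF L k, of d] obtain \<xi> \<zeta> where
    \<xi>: "\<forall>t>0. \<xi> t \<in> borel_measurable borel \<and> (\<forall>y. \<xi> t y < \<infinity>) \<and>
      (\<forall>v\<in>borel_measurable borel. (\<integral>\<^sup>+y. \<xi> t y * v y \<partial>m) = (\<Sum>x\<in>J. ennreal (c x) * S t v x) + (\<integral>\<^sup>+y. h y * v y \<partial>m))"
    and \<zeta>: "\<forall>t>0. \<zeta> t \<in> borel_measurable borel \<and> (\<forall>y. \<zeta> t y < \<infinity>) \<and>
      (\<forall>v\<in>borel_measurable borel. (\<integral>\<^sup>+y. \<zeta> t y * v y \<partial>m) = (\<Sum>x\<in>L. ennreal (d x) * S t v x) + (\<integral>\<^sup>+y. k y * v y \<partial>m))"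
    by blast
  \<comment> \<open>Smearing lowers the integral of a supermedian function. This is used twice: for
    the potential of the smeared charge at each point, and for the integral of that
    potential.\<close>
  have le: "(\<integral>\<^sup>+x. \<xi> x * U \<xi> x \<partial>m) \<le> charge J c h (pot J c h)"
    if \<xi>: "\<xi> \<in> borel_measurable borel" "\<forall>v\<in>borel_measurable borel. (\<integral>\<^sup>+y. \<xi> y * v y \<partial>m) = (\<Sum>x\<in>J. ennreal (c x) * S t v x) + (\<integral>\<^sup>+y. h y * v y \<partial>m)"
      and t: "0 < t" for \<xi> t J c h
  proof -
    have le: "(\<integral>\<^sup>+y. \<xi> y * v y \<partial>m) \<le> charge J c h v" if v: "supermedian v" for v
      unfolding charge_def using \<xi>(2) supermedianD(1)[OF v] A_scaled_le[OF v t]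
      by (auto intro!: sum_mono mult_left_mono)
    have "U \<xi> x \<le> pot J c h x" for x
      using le[OF supermedian_u', of x] unfolding charge_u by (simp add: U_def mult.commute)
    then have "charge J c h (U \<xi>) \<le> charge J c h (pot J c h)" by (rule charge_mono)
    with le[OF supermedian_U[OF \<xi>(1)]] show ?thesis by (rule order_trans)
  qed
  have *: "2 * ((\<Sum>x\<in>J. ennreal (c x) * S s (U (\<zeta> t)) x) + (\<integral>\<^sup>+y. h y * U (\<zeta> t) y \<partial>m)) \<le> ?C"
    if st: "0 < s" "0 < t" for s t
  proof -
    note \<xi>s = \<xi>[THEN spec, THEN mp, OF st(1)] and \<zeta>t = \<zeta>[THEN spec, THEN mp, OF st(2)]
    have m: "\<xi> s \<in> borel_measurable borel" "\<zeta> t \<in> borel_measurable borel" using \<xi>s \<zeta>t by auto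
    have "2 * (\<integral>\<^sup>+x. \<xi> s x * U (\<zeta> t) x \<partial>m) \<le> (\<integral>\<^sup>+x. \<xi> s x * U (\<xi> s) x \<partial>m) + (\<integral>\<^sup>+x. \<zeta> t x * U (\<zeta> t) x \<partial>m)"
      by (rule energy_ineq[OF m])
    also have "\<dots> \<le> ?C"
      by (rule add_mono[OF le[OF conjunct1[OF \<xi>s] conjunct2[OF conjunct2[OF \<xi>s]] st(1)]
            le[OF conjunct1[OF \<zeta>t] conjunct2[OF conjunct2[OF \<zeta>t]] st(2)]])
    also have "(\<integral>\<^sup>+x. \<xi> s x * U (\<zeta> t) x \<partial>m) = (\<Sum>x\<in>J. ennreal (c x) * S s (U (\<zeta> t)) x) + (\<integral>\<^sup>+y. h y * U (\<zeta> t) y \<partial>m)"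
      using \<xi>[rule_format, OF st(1)] measurable_U[OF m(2)] by blast
    finally show ?thesis .
  qed
  have pos: "\<forall>\<^sub>F s in at_right (0::real). 0 < s" by (simp add: eventually_at_right_less)
  \<comment> \<open>First limit: \<open>U (\<zeta> t)\<close> is supermedian, and lower
    semicontinuous since \<open>\<zeta> t\<close> is finite.\<close>
  have **: "2 * ((\<Sum>x\<in>J. ennreal (c x) * U (\<zeta> t) x) + (\<integral>\<^sup>+y. h y * U (\<zeta> t) y \<partial>m)) \<le> ?C"
    if t: "0 < t" for t
  proof (rule tendsto_upperbound)
    have z: "\<zeta> t \<in> borel_measurable borel" "\<And>y. \<zeta> t y < \<infinity>" using \<zeta> t by auto
    show "((\<lambda>s. 2 * ((\<Sum>x\<in>J. ennreal (c x) * S s (U (\<zeta> t)) x) + (\<integral>\<^sup>+y. h y * U (\<zeta> t) y \<partial>m))) \<longlongrightarrow>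
        2 * ((\<Sum>x\<in>J. ennreal (c x) * U (\<zeta> t) x) + (\<integral>\<^sup>+y. h y * U (\<zeta> t) y \<partial>m))) (at_right 0)"
      by (intro ennreal_tendsto_cmult tendsto_add tendsto_sum tendsto_const tendsto_A supermedian_U lsc_U z) auto
    show "\<forall>\<^sub>F s in at_right 0. 2 * ((\<Sum>x\<in>J. ennreal (c x) * S s (U (\<zeta> t)) x) + (\<integral>\<^sup>+y. h y * U (\<zeta> t) y \<partial>m)) \<le> ?C"
      using pos by eventually_elim (rule *[OF _ t])
  qed simp
  have Z: "(\<integral>\<^sup>+y. \<zeta> t y * v y \<partial>m) = (\<Sum>x\<in>L. ennreal (d x) * S t v x) + (\<integral>\<^sup>+y. k y * v y \<partial>m)"
    if "0 < t" "v \<in> borel_measurable borel" for t v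
    using \<zeta> that by blast
  have lim: "((\<lambda>t. \<integral>\<^sup>+y. \<zeta> t y * v y \<partial>m) \<longlongrightarrow> charge L d k v) (at_right 0)"
    if v: "supermedian v" "lsc v" for v
  proof (rule Lim_transform_eventually)
    show "((\<lambda>t. (\<Sum>x\<in>L. ennreal (d x) * S t v x) + (\<integral>\<^sup>+y. k y * v y \<partial>m)) \<longlongrightarrow> charge L d k v) (at_right 0)"
      unfolding charge_def
      by (intro ennreal_tendsto_cmult tendsto_add tendsto_sum tendsto_const tendsto_A v) auto
    show "\<forall>\<^sub>F t in at_right 0. (\<Sum>x\<in>L. ennreal (d x) * S t v x) + (\<integral>\<^sup>+y. k y * v y \<partial>m) = (\<integral>\<^sup>+y. \<zeta> t y * v y \<partial>m)"
      using pos by eventually_elim (rule Z[OF _ supermedianD(1)[OF v(1)], symmetric])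
  qed
  \<comment> \<open>Second limit: by symmetry the smeared charge is now tested against the fixed
    functions \<open>u x\<close> and \<open>U h\<close>.\<close>
  have "2 * charge J c h (pot L d k) \<le> ?C"
  proof (rule tendsto_upperbound)
    show "((\<lambda>t. 2 * ((\<Sum>x\<in>J. ennreal (c x) * (\<integral>\<^sup>+y. \<zeta> t y * ennreal (u x y) \<partial>m)) + (\<integral>\<^sup>+y. \<zeta> t y * U h y \<partial>m)))
        \<longlongrightarrow> 2 * charge J c h (pot L d k)) (at_right 0)"
      unfolding charge_pot[OF h(1) k(1)] charge_u[symmetric]
      by (intro ennreal_tendsto_cmult tendsto_add tendsto_sum lim supermedian_u' lsc_u' supermedian_U lsc_U h) auto
    show "\<forall>\<^sub>F t in at_right 0. 2 * ((\<Sum>x\<in>J. ennreal (c x) * (\<integral>\<^sup>+y. \<zeta> t y * ennreal (u x y) \<partial>m)) + (\<integral>\<^sup>+y. \<zeta> t y * U h y \<partial>m)) \<le> ?C"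
      using pos
    proof eventually_elim
      case (elim t)
      have z: "\<zeta> t \<in> borel_measurable borel" using \<zeta> elim by auto
      show ?case using **[OF elim] energy_sym[OF h(1) z] by (simp add: U_def mult.commute)
    qed
  qed simp
  then show ?thesis .
qed

section \<open>Averages of truncated supermedian functions as potentials\<close>

lemma \<eta>_finite: "\<eta> x < \<infinity>"
  using \<eta>_le_1[of x] by (rule le_less_trans) simp

lemma tail_tendsto_0: "(\<lambda>n. \<integral>\<^sup>+r\<in>{real n..}. T r \<eta> x \<partial>lborel) \<longlonglongrightarrow> 0"
proof -
  let ?f = "\<lambda>n r. T r \<eta> x * indicator {real n..} r"
  have dec: "decseq ?f"
    by (intro decseq_SucI le_funI mult_left_mono) (auto simp: indicator_def)
  have meas: "?f n \<in> borel_measurable lborel" for n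
    using measurable_time[OF \<eta>_borel, of x] by measurable
  have "(\<integral>\<^sup>+r. ?f 0 r \<partial>lborel) = U \<eta> x"
    by (simp add: U_alt[OF \<eta>_borel])
  then have "(\<integral>\<^sup>+r. ?f 0 r \<partial>lborel) < \<infinity>" using U_\<eta>_finite by simp
  from nn_integral_monotone_convergence_INF_decseq[OF dec meas this]
  have "(INF n. \<integral>\<^sup>+r. ?f n r \<partial>lborel) = (\<integral>\<^sup>+r. (INF n. ?f n r) \<partial>lborel)" by simp
  also have "\<dots> = integral\<^sup>N lborel (\<lambda>_::real. 0)"
  proof (intro nn_integral_cong)
    fix r :: real
    obtain n :: nat where "r < real n" using reals_Archimedean2 by blast
    then have "?f n r = 0" by simp
    moreover have "(INF n. ?f n r) \<le> ?f n r" by (rule INF_lower) simp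
    ultimately show "(INF n. ?f n r) = 0" by (simp only: le_zero_eq)
  qed
  also have "\<dots> = 0" by simp
  finally have 0: "(INF n. \<integral>\<^sup>+r. ?f n r \<partial>lborel) = 0" .
  have "decseq (\<lambda>n. \<integral>\<^sup>+r. ?f n r \<partial>lborel)"
    by (intro decseq_SucI nn_integral_mono mult_left_mono) (auto simp: indicator_def)
  from LIMSEQ_INF[OF this] show ?thesis unfolding 0 .
qed

text \<open>Telescoping: the integral of \<open>T s (q - T t q)\<close> over \<open>s\<close> from 0
  to \<open>n\<close> is that of \<open>T s q\<close> over \<open>[0, t]\<close> minus that over
  \<open>[n, n + t]\<close>. The latter vanishes in the limit because \<open>q\<close> is below a
  multiple of \<open>U \<eta>\<close>, whose image under \<open>T s\<close> is the tail of a
  convergent integral.\<close>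

lemma S_eq_U:
  assumes q: "supermedian q" "\<And>y. q y < \<infinity>" "\<And>y. q y \<le> c * U \<eta> y" and c: "c < \<infinity>" and t: "0 < t"
  shows "U (\<lambda>y. ennreal (1 / t) * (q y - T t q y)) x = S t q x"
proof -
  define k where "k y = q y - T t q y" for y
  have qb: "q \<in> borel_measurable borel" by (rule supermedianD(1)[OF q(1)])
  have kb: "k \<in> borel_measurable borel"
    unfolding k_def using qb measurable_T1[OF qb] by measurable
  have Tk: "T s k x + T (s + t) q x = T s q x" if "0 \<le> s" for s
  proof -
    have "T s q x = T s (\<lambda>y. k y + T t q y) x"
      using supermedianD(2)[OF q(1)] t by (intro nn_integral_cong) (simp add: k_def diff_add_cancel_ennreal)
    also have "\<dots> = T s k x + T s (T t q) x"
      by (rule nn_integral_add) (intro measurable_k kb measurable_T1 qb)+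
    finally show ?thesis using semigroup[of s t q x] that t qb by simp
  qed
  define F where "F a b = (\<integral>\<^sup>+s\<in>{a..b}. T s q x \<partial>lborel)" for a b
  define I where "I b = (\<integral>\<^sup>+s\<in>{0..b}. T s k x \<partial>lborel)" for b
  have qs: "(\<lambda>s. T s q x) \<in> borel_measurable borel" and ks: "(\<lambda>s. T s k x) \<in> borel_measurable borel"
    and qt: "(\<lambda>s. T (s + t) q x) \<in> borel_measurable borel"
    using measurable_time[OF qb] measurable_time[OF kb] measurable_T[OF qb, of "\<lambda>s. s + t" borel "\<lambda>_. x"] by simp_all
  have fin: "F t (real n + t) < \<infinity>" for n
  proof -
    have "F t (real n + t) \<le> (\<integral>\<^sup>+s\<in>{t..real n + t}. q x \<partial>lborel)"
      unfolding F_def using supermedianD(2)[OF q(1)] t by (intro nn_integral_mono) (auto simp: indicator_def)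
    also have "\<dots> = q x * ennreal (real n)"
      by (subst nn_integral_cmult_indicator) auto
    finally show ?thesis
      by (rule le_less_trans) (use q(2)[of x] in \<open>simp add: ennreal_mult_less_top\<close>)
  qed
  have id: "I (real n) + F (real n) (real n + t) = F 0 t" for n
  proof -
    have "F 0 (real n) = (\<integral>\<^sup>+s. T s k x * indicator {0..real n} s + T (s + t) q x * indicator {0..real n} s \<partial>lborel)"
      unfolding F_def using Tk by (intro nn_integral_cong) (simp add: indicator_def)
    also have "\<dots> = I (real n) + (\<integral>\<^sup>+s\<in>{0..real n}. T (s + t) q x \<partial>lborel)"
      unfolding I_def by (rule nn_integral_add) (use ks qt in measurable)
    also have "(\<integral>\<^sup>+s\<in>{0..real n}. T (s + t) q x \<partial>lborel) = F t (real n + t)"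
      using nn_integral_shift(1)[of "\<lambda>s. T s q x" t 0 "real n", OF qs] by (simp only: F_def add_0_left)
    finally have "F 0 (real n) = I (real n) + F t (real n + t)" .
    moreover have "F 0 (real n + t) = F 0 t + F t (real n + t)"
      unfolding F_def by (rule nn_integral_split_interval(2)[of "\<lambda>s. T s q x", OF qs]) (use t in auto)
    moreover have "F 0 (real n + t) = F 0 (real n) + F (real n) (real n + t)"
      unfolding F_def by (rule nn_integral_split_interval(2)[of "\<lambda>s. T s q x", OF qs]) (use t in auto)
    \<comment> \<open>The common part over \<open>[t, n + t]\<close> is finite, so it may be
      cancelled.\<close>
    ultimately have "F t (real n + t) + F 0 t = F t (real n + t) + (I (real n) + F (real n) (real n + t))"
      by (simp add: add_ac)
    then show ?thesis
      using fin[of n] by (auto simp: ennreal_add_left_cancel)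
  qed
  have F0: "(\<lambda>n. F (real n) (real n + t)) \<longlonglongrightarrow> 0"
  proof (rule tendsto_sandwich[OF _ _ tendsto_const])
    let ?R = "\<lambda>n. \<integral>\<^sup>+r\<in>{real n..}. T r \<eta> x \<partial>lborel"
    have "F (real n) (real n + t) \<le> ennreal t * c * ?R n" for n
    proof -
      have "T s q x \<le> c * ?R n" if "real n \<le> s" for s
      proof -
        have "T s q x \<le> T s (\<lambda>y. c * U \<eta> y) x" by (intro T_mono q(3))
        also have "\<dots> = c * T s (U \<eta>) x" by (rule T_cmult) (intro measurable_U \<eta>_borel)
        also have "T s (U \<eta>) x = (\<integral>\<^sup>+r\<in>{s..}. T r \<eta> x \<partial>lborel)" using that by (intro T_U \<eta>_borel) simp
        also have "\<dots> \<le> ?R n" using that by (intro nn_integral_mono mult_left_mono) (auto simp: indicator_def)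
        finally show ?thesis by (simp add: mult_left_mono)
      qed
      then have "F (real n) (real n + t) \<le> (\<integral>\<^sup>+s\<in>{real n..real n + t}. c * ?R n \<partial>lborel)"
        unfolding F_def by (intro nn_integral_mono) (auto simp: indicator_def)
      also have "\<dots> = c * ?R n * ennreal t"
        using t by (subst nn_integral_cmult_indicator) auto
      finally show ?thesis by (simp only: mult_ac)
    qed
    then show "\<forall>\<^sub>F n in sequentially. F (real n) (real n + t) \<le> ennreal t * c * ?R n" by simp
    show "(\<lambda>n. ennreal t * c * ?R n) \<longlonglongrightarrow> 0"
      using ennreal_tendsto_cmult[OF _ tail_tendsto_0[of x], of "ennreal t * c"] c by (simp add: ennreal_mult_less_top)
  qed simp
  have Ik: "(\<lambda>n. I (real n)) \<longlonglongrightarrow> U k x"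
  proof -
    have "U k x = (\<integral>\<^sup>+s. (SUP n. T s k x * indicator {0..real n} s) \<partial>lborel)"
      unfolding U_alt[OF kb]
    proof (intro nn_integral_cong)
      fix s :: real
      show "T s k x * indicator {0..} s = (SUP n. T s k x * indicator {0..real n} s)"
      proof (rule antisym)
        obtain n :: nat where "s < real n" using reals_Archimedean2 by blast
        then have "T s k x * indicator {0..} s \<le> T s k x * indicator {0..real n} s"
          by (auto simp: indicator_def)
        then show "T s k x * indicator {0..} s \<le> (SUP n. T s k x * indicator {0..real n} s)"
          by (rule SUP_upper2[OF UNIV_I])
        show "(SUP n. T s k x * indicator {0..real n} s) \<le> T s k x * indicator {0..} s"
          by (intro SUP_least) (auto simp: indicator_def)
      qed
    qed
    also have "\<dots> = (SUP n. I (real n))"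
      unfolding I_def
    proof (rule nn_integral_monotone_convergence_SUP)
      show "incseq (\<lambda>n s. T s k x * indicator {0..real n} s)"
        by (intro incseq_SucI le_funI mult_left_mono) (auto simp: indicator_def)
    qed (use ks in measurable)
    finally have sup: "U k x = (SUP n. I (real n))" .
    have "incseq (\<lambda>n. I (real n))"
      unfolding I_def by (intro incseq_SucI nn_integral_mono mult_left_mono) (auto simp: indicator_def)
    from LIMSEQ_SUP[OF this] show ?thesis unfolding sup .
  qed
  have "(\<lambda>n. F 0 t) \<longlonglongrightarrow> U k x + 0"
    using tendsto_add[OF Ik F0] by (simp only: id)
  then have "F 0 t = U k x + 0"
    by (rule LIMSEQ_unique[OF tendsto_const])
  then have "U k x = F 0 t" by simp
  moreover have "U (\<lambda>y. ennreal (1 / t) * k y) x = ennreal (1 / t) * U k x"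
  proof -
    have "U (\<lambda>y. ennreal (1 / t) * k y) x = (\<integral>\<^sup>+y. ennreal (1 / t) * (ennreal (u x y) * k y) \<partial>m)"
      unfolding U_def by (intro nn_integral_cong) (simp only: mult_ac)
    also have "\<dots> = ennreal (1 / t) * U k x"
      unfolding U_def by (rule nn_integral_cmult) (intro measurable_m, use kb in measurable)
    finally show ?thesis .
  qed
  ultimately have "U (\<lambda>y. ennreal (1 / t) * k y) x = ennreal (1 / t) * F 0 t" by simp
  then show ?thesis unfolding k_def F_def A_def .
qed

lemma difference_quotient:
  assumes "supermedian q" "\<And>y. q y < \<infinity>"
  shows "(\<lambda>y. ennreal (1 / t) * (q y - T t q y)) \<in> borel_measurable borel"
    and "ennreal (1 / t) * (q y - T t q y) < \<infinity>"
proof -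
  show "(\<lambda>y. ennreal (1 / t) * (q y - T t q y)) \<in> borel_measurable borel"
    using supermedianD(1)[OF assms(1)] measurable_T1[OF supermedianD(1)[OF assms(1)]] by measurable
  show "ennreal (1 / t) * (q y - T t q y) < \<infinity>"
    using assms(2)[of y] by (auto simp: ennreal_mult_less_top intro: le_less_trans[OF diff_le_self_ennreal])
qed

text \<open>A finite excessive function is an increasing limit of potentials of functions, and these are
  lower semicontinuous because \<open>u\<close> is continuous.\<close>

lemma lsc_excessive:
  assumes f: "supermedian f" "\<And>x. f x < \<infinity>" "\<And>x. ((\<lambda>s. T s f x) \<longlongrightarrow> f x) (at_right 0)"
  shows "lsc f"
proof -
  \<comment> \<open>The truncation puts \<open>f\<close> below a multiple of
    \<open>U \<eta>\<close>, so that \<open>S_eq_U\<close> turns its averages into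
    potentials.\<close>
  define q where "q n x = min (f x) (of_nat n * U \<eta> x)" for n :: nat and x
  have q: "supermedian (q n)" for n
    unfolding q_def by (intro supermedian_min f supermedian_cmult supermedian_U \<eta>_borel)
  have qfin: "q n x < \<infinity>" for n x
    unfolding q_def using f(2)[of x] by (simp add: min_less_iff_disj)
  have qinc: "incseq q"
    unfolding q_def by (intro incseq_SucI le_funI min.mono order_refl mult_right_mono) auto
  have qsup: "(SUP n. q n x) = f x" for x
    unfolding q_def by (rule ennreal_SUP_min_mult[OF U_\<eta>_pos])
  have l: "lsc (S t (q n))" if t: "0 < t" for t n
  proof -
    have "S t (q n) = U (\<lambda>y. ennreal (1 / t) * (q n y - T t (q n) y))"
      by (rule ext, rule S_eq_U[OF q qfin, of _ "of_nat n", symmetric]) (use t in \<open>auto simp: q_def less_top[symmetric]\<close>)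
    then show ?thesis by (simp only:) (intro lsc_U difference_quotient q qfin)
  qed
  have "{x. c < f x} = (\<Union>i n. {x. c < S (1 / real (Suc i)) (q n) x})" for c
  proof (intro Set.set_eqI iffI)
    fix x assume "x \<in> {x. c < f x}"
    then have "c < f x" by simp
    then have "\<forall>\<^sub>F s in at_right 0. c < T s f x"
      by (rule order_tendstoD(1)[OF f(3)])
    then obtain d :: real where d: "0 < d" "\<And>s. 0 < s \<Longrightarrow> s < d \<Longrightarrow> c < T s f x"
      unfolding eventually_at_right_field by auto
    obtain i where i: "inverse (real (Suc i)) < d" using reals_Archimedean[OF d(1)] by blast
    define t where "t = 1 / real (Suc i)"
    have t: "0 < t" "t < d" using i by (simp_all add: t_def inverse_eq_divide)
    have "c < T t f x" using d(2) t by simp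
    also have "\<dots> = ennreal (1 / t) * (ennreal t * T t f x)"
      using t by (simp add: mult.assoc[symmetric] ennreal_mult'[symmetric])
    also have "ennreal t * T t f x = (\<integral>\<^sup>+s\<in>{0..t}. T t f x \<partial>lborel)"
      using t by (subst nn_integral_cmult_indicator) (auto simp: mult.commute)
    also have "\<dots> \<le> A t f x"
      unfolding A_def using supermedian_decreasing[OF f(1)]
      by (intro nn_integral_mono) (auto simp: indicator_def)
    also have "A t f x = (SUP n. A t (q n) x)"
      using A_SUP[OF qinc supermedianD(1)[OF q], of t x] unfolding qsup .
    finally have "c < (SUP n. S t (q n) x)"
      unfolding SUP_mult_left_ennreal by (simp add: mult_left_mono)
    then show "x \<in> (\<Union>i n. {x. c < S (1 / real (Suc i)) (q n) x})"
      unfolding less_SUP_iff t_def by blast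
  next
    fix x assume "x \<in> (\<Union>i n. {x. c < S (1 / real (Suc i)) (q n) x})"
    then obtain i n where "c < S (1 / real (Suc i)) (q n) x" by blast
    also have "\<dots> \<le> q n x" by (rule A_scaled_le[OF q]) simp
    also have "\<dots> \<le> f x" by (simp add: q_def)
    finally show "x \<in> {x. c < f x}" by simp
  qed
  moreover have "open {x. c < S (1 / real (Suc i)) (q n) x}" for c i n
  proof -
    have "0 < 1 / real (Suc i)" by simp
    from l[OF this, of n] show ?thesis unfolding lsc_def by (rule spec)
  qed
  ultimately show ?thesis
    unfolding lsc_def by (simp only:) (intro allI open_UN ballI)
qed

section \<open>The domination principle\<close>

lemma U_0 [simp]: "U (\<lambda>_. 0) x = 0"
  by (simp add: U_def)

lemma pot_0: "pot J a (\<lambda>_. 0) x = (\<Sum>j\<in>J. ennreal (a j) * ennreal (u x j))"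
  by (simp add: pot_def)

lemma pot_eq_ennreal:
  "(\<And>j. j \<in> J \<Longrightarrow> 0 \<le> a j) \<Longrightarrow> pot J a (\<lambda>_. 0) x = ennreal (\<Sum>j\<in>J. a j * u x j)"
  using u_nonneg by (simp add: pot_0 ennreal_mult sum_nonneg flip: sum_ennreal)

text \<open>With \<open>p = \<Sum>\<^sub>j a\<^sub>j u(\<cdot>, j)\<close>, \<open>q = p \<and> f\<close> (truncated) and \<open>h = (q - T\<^sub>t q) / t\<close>, so that
  \<open>U h = S t q\<close>, the energy inequality for \<open>c \<delta>\<^sub>x + h\<close> and \<open>\<Sum>\<^sub>j a\<^sub>j \<delta>\<^sub>j\<close> bounds
  \<open>2 c (p x - q x)\<close> by \<open>c\<^sup>2 u(x, x)\<close> as \<open>t\<close> tends to 0.\<close>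

lemma domination:
  assumes J: "finite J" and a: "\<And>j. j \<in> J \<Longrightarrow> 0 \<le> a j"
    and f: "supermedian (\<lambda>x. ennreal (f x))" "lsc (\<lambda>x. ennreal (f x))" "0 \<le> f x"
    and le: "\<And>i. i \<in> J \<Longrightarrow> (\<Sum>j\<in>J. a j * u i j) \<le> f i"
  shows "(\<Sum>j\<in>J. a j * u x j) \<le> f x"
proof -
  define p where "p = pot J a (\<lambda>_. 0)"
  have p_eq: "p y = ennreal (\<Sum>j\<in>J. a j * u y j)" for y
    unfolding p_def by (rule pot_eq_ennreal[OF a])
  have p: "supermedian p" "lsc p"
  proof -
    have "p = (\<lambda>x. \<Sum>j\<in>J. ennreal (a j) * ennreal (u x j))"
      by (rule ext) (simp add: p_def pot_0)
    then show "supermedian p"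
      using supermedian_sum[OF J, of "\<lambda>j x. ennreal (a j) * ennreal (u x j)"] supermedian_cmult[OF supermedian_u] by simp
    have "p = (\<lambda>y. ennreal (\<Sum>j\<in>J. a j * u y j))" by (rule ext) (rule p_eq)
    then show "lsc p"
      by (auto intro!: lsc_continuous continuous_on_ennreal continuous_intros u_continuous1)
  qed
  \<comment> \<open>\<open>N\<close> is so large that truncating \<open>q\<close> at
    \<open>of_nat N * U \<eta> y\<close> has no effect at the charged points.\<close>
  obtain N :: nat where N: "\<And>y. y \<in> insert x J \<Longrightarrow> p y \<le> of_nat N * U \<eta> y"
  proof -
    have "\<exists>n::nat. p y \<le> of_nat n * U \<eta> y" for y
    proof (rule ccontr)
      assume "\<not> (\<exists>n::nat. p y \<le> of_nat n * U \<eta> y)"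
      then have *: "of_nat n * U \<eta> y \<le> p y" for n :: nat by (meson le_cases)
      have "(SUP n::nat. min \<top> (of_nat n * U \<eta> y)) \<le> p y"
        using * by (intro SUP_least) (simp add: min_def top_unique)
      then show False
        unfolding ennreal_SUP_min_mult[OF U_\<eta>_pos] p_eq by (simp add: top_unique)
    qed
    then obtain n :: "'a \<Rightarrow> nat" where n: "\<And>y. p y \<le> of_nat (n y) * U \<eta> y" by metis
    show ?thesis
    proof (rule that[of "Max (n ` insert x J)"])
      fix y assume "y \<in> insert x J"
      then have "n y \<le> Max (n ` insert x J)" using J by (intro Max_ge) auto
      then have "of_nat (n y) * U \<eta> y \<le> of_nat (Max (n ` insert x J)) * U \<eta> y"
        by (intro mult_right_mono) (simp_all only: of_nat_le_iff zero_le)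
      with n show "p y \<le> of_nat (Max (n ` insert x J)) * U \<eta> y" by (rule order_trans)
    qed
  qed
  define q where "q y = min (p y) (min (ennreal (f y)) (of_nat N * U \<eta> y))" for y
  have q: "supermedian q" "lsc q"
    unfolding q_def
    by (intro supermedian_min lsc_min p f supermedian_cmult supermedian_U lsc_cmult lsc_U \<eta>_borel
        \<eta>_finite of_nat_less_top[folded infinity_ennreal_def])+
  have q_fin: "q y < \<infinity>" for y
  proof -
    have "q y \<le> p y" by (simp add: q_def)
    then show ?thesis by (rule le_less_trans) (simp add: p_eq)
  qed
  have q_le: "q y \<le> of_nat N * U \<eta> y" "q y \<le> p y" "q y \<le> ennreal (f y)" for y
    by (auto simp: q_def min_le_iff_disj)
  have qJ: "q j = p j" if "j \<in> J" for j
    using le[OF that] N[of j] that by (simp add: q_def p_eq min_def ennreal_leI)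
  define P where "P = (\<Sum>j\<in>J. ennreal (a j) * p j)"
  have P_fin: "P < \<infinity>" unfolding P_def by (simp add: p_eq J ennreal_mult_less_top)
  have main: "2 * (ennreal c * p x) + (\<Sum>j\<in>J. ennreal (a j) * S t q j) \<le>
      ennreal c * (ennreal c * ennreal (u x x)) + 2 * (ennreal c * q x) + P" if t: "0 < t" and c: "0 < c" for t c
  proof -
    define h where "h y = ennreal (1 / t) * (q y - T t q y)" for y
    have h: "h \<in> borel_measurable borel" "\<And>y. h y < \<infinity>"
      unfolding h_def by (intro difference_quotient q q_fin)+
    have z: "(\<lambda>_. 0) \<in> borel_measurable (borel :: 'a measure)" "(0::ennreal) < \<infinity>" by auto
    have Uh: "U h y = S t q y" for y
      unfolding h_def by (rule S_eq_U[OF q(1) q_fin q_le(1) _ t]) (simp add: less_top[symmetric])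
    have Uh_le: "U h y \<le> q y" for y
      unfolding Uh by (rule A_scaled_le[OF q(1) t])
    \<comment> \<open>By reciprocity \<open>H\<close> is also the integral of \<open>h * p\<close>.
      It bounds the energy of \<open>h\<close>, occurs on both sides of the inequality below and is
      finite, so one copy cancels.\<close>
    define H where "H = (\<Sum>j\<in>J. ennreal (a j) * S t q j)"
    have "H \<le> P"
      unfolding H_def P_def using A_scaled_le[OF q(1) t] q_le(2)
      by (intro sum_mono mult_left_mono) (auto intro: order_trans)
    then have H_fin: "H < \<infinity>" using P_fin by (rule le_less_trans)
    let ?c = "\<lambda>_::'a. c"
    have 1: "charge {x} ?c h p = ennreal c * p x + H"
      unfolding p_def charge_pot[OF h(1) z(1)] by (simp add: charge_def H_def Uh)
    have 2: "charge J a (\<lambda>_. 0) p = P" by (simp add: charge_def P_def)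
    have px: "pot {x} ?c h y = ennreal c * ennreal (u y x) + U h y" for y by (simp add: pot_def)
    have "charge {x} ?c h (pot {x} ?c h) = ennreal c * pot {x} ?c h x + charge {x} ?c h (U h)"
      unfolding charge_pot[OF h(1) h(1)] by simp
    also have "charge {x} ?c h (U h) = ennreal c * U h x + (\<integral>\<^sup>+y. h y * U h y \<partial>m)"
      by (simp add: charge_def)
    also have "(\<integral>\<^sup>+y. h y * U h y \<partial>m) \<le> (\<integral>\<^sup>+y. h y * p y \<partial>m)"
      using order_trans[OF Uh_le q_le(2)] by (intro nn_integral_mono mult_left_mono) auto
    also have "(\<integral>\<^sup>+y. h y * p y \<partial>m) = H"
      using charge_pot[OF h(1) z(1), of "{}" ?c J a] unfolding p_def[symmetric]
      by (simp add: charge_def H_def Uh)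
    finally have 3: "charge {x} ?c h (pot {x} ?c h) \<le> ennreal c * (ennreal c * ennreal (u x x)) + 2 * (ennreal c * U h x) + H"
      by (simp add: px[of x] distrib_left mult_2 add_ac add_left_mono)
    have "2 * (ennreal c * p x + H) \<le> charge {x} ?c h (pot {x} ?c h) + P"
      using mixed_energy[of "{x}" J h "\<lambda>_. 0" ?c a, OF _ J h z] unfolding p_def[symmetric] 1 2 by simp
    also have "\<dots> \<le> (ennreal c * (ennreal c * ennreal (u x x)) + 2 * (ennreal c * U h x) + H) + P"
      by (intro add_right_mono 3)
    also have "\<dots> \<le> (ennreal c * (ennreal c * ennreal (u x x)) + 2 * (ennreal c * q x) + H) + P"
      by (intro add_right_mono add_left_mono mult_left_mono Uh_le) auto
    finally have "H + (2 * (ennreal c * p x) + H) \<le> H + (ennreal c * (ennreal c * ennreal (u x x)) + 2 * (ennreal c * q x) + P)"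
      by (simp add: distrib_left mult_2 add_ac)
    then show ?thesis
      using H_fin unfolding H_def[symmetric] by (auto simp: ennreal_add_left_cancel_le)
  qed
  \<comment> \<open>As \<open>t\<close> tends to 0 the averages of \<open>q\<close> tend to
    \<open>q\<close>, which equals \<open>p\<close> at the charged points; the sum becomes
    \<open>P\<close>, which can then be cancelled.\<close>
  have lim: "2 * (ennreal c * p x) + P \<le> ennreal c * (ennreal c * ennreal (u x x)) + 2 * (ennreal c * q x) + P" if c: "0 < c" for c
  proof (rule tendsto_upperbound)
    have "P = (\<Sum>j\<in>J. ennreal (a j) * q j)" unfolding P_def using qJ by simp
    then show "((\<lambda>t. 2 * (ennreal c * p x) + (\<Sum>j\<in>J. ennreal (a j) * S t q j)) \<longlongrightarrow> 2 * (ennreal c * p x) + P) (at_right 0)"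
      by (simp only:) (intro tendsto_add tendsto_const tendsto_sum ennreal_tendsto_cmult tendsto_A q; simp)
    have "\<forall>\<^sub>F t in at_right (0::real). 0 < t" by (simp add: eventually_at_right_less)
    then show "\<forall>\<^sub>F t in at_right 0. 2 * (ennreal c * p x) + (\<Sum>j\<in>J. ennreal (a j) * S t q j) \<le>
      ennreal c * (ennreal c * ennreal (u x x)) + 2 * (ennreal c * q x) + P"
      by eventually_elim (rule main[OF _ c])
  qed simp
  obtain r where r: "q x = ennreal r" "0 \<le> r" using q_fin[of x] by (cases "q x") auto
  define s where "s = (\<Sum>j\<in>J. a j * u x j)"
  have s: "p x = ennreal s" "0 \<le> s"
    unfolding s_def p_eq using a u_nonneg by (auto intro!: sum_nonneg)
  have "s \<le> r + e" if e: "0 < e" for e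
  proof -
    \<comment> \<open>Dividing by \<open>2 * c\<close> leaves the error
      \<open>c * u x x / 2\<close>, which this \<open>c\<close> keeps below \<open>e\<close>; the
      summand 1 covers \<open>u x x = 0\<close>, not yet excluded.\<close>
    define c where "c = 2 * e / (u x x + 1)"
    have c: "0 < c" using e u_nonneg[of x x] by (simp add: c_def)
    have "2 * (ennreal c * p x) \<le> ennreal c * (ennreal c * ennreal (u x x)) + 2 * (ennreal c * q x)"
      using lim[OF c] P_fin by (auto simp: add.commute[of _ P] ennreal_add_left_cancel_le)
    then have "ennreal (2 * (c * s)) \<le> ennreal (c * (c * u x x) + 2 * (c * r))"
      using c s r u_nonneg[of x x] by (simp add: ennreal_mult ennreal_plus)
    then have "2 * (c * s) \<le> c * (c * u x x) + 2 * (c * r)"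
      using c r u_nonneg[of x x] by (subst (asm) ennreal_le_iff) auto
    then have "c * (2 * s) \<le> c * (c * u x x + 2 * r)" by (simp add: algebra_simps)
    then have "2 * s \<le> c * u x x + 2 * r" using c by (simp only: mult_le_cancel_left_pos)
    moreover have "c * u x x \<le> c * (u x x + 1)" using c by (intro mult_left_mono) auto
    moreover have "c * (u x x + 1) = 2 * e" using u_nonneg[of x x] by (simp add: c_def)
    ultimately show ?thesis by simp
  qed
  then have "s \<le> r" by (rule field_le_epsilon)
  also have "r \<le> f x" using q_le(3)[of x] f(3) r by (simp add: ennreal_le_iff)
  finally show ?thesis by (simp add: s_def)
qed

section \<open>Strict positive definiteness\<close>

text \<open>First variation of the energy at a charge where it is not positive: adding
  \<open>e * \<phi>\<close> changes it by \<open>2 * e * (\<Sum>i\<in>J. c i * w i)\<close> plus a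
  term of order \<open>e * e\<close>. The total cannot be negative, so the linear term is not
  negative either.\<close>

lemma energy_variation:
  assumes J: "finite J" and Q: "(\<Sum>i\<in>J. \<Sum>j\<in>J. c i * c j * u i j) \<le> 0"
    and \<phi>: "\<phi> \<in> borel_measurable borel" "\<And>x. \<phi> x < \<infinity>"
    and w: "\<And>i. i \<in> J \<Longrightarrow> U \<phi> i = ennreal (w i)" "\<And>i. 0 \<le> w i"
    and E: "(\<integral>\<^sup>+x. \<phi> x * U \<phi> x \<partial>m) < \<infinity>"
  shows "0 \<le> (\<Sum>i\<in>J. c i * w i)"
proof -
  obtain E0 where E0: "(\<integral>\<^sup>+x. \<phi> x * U \<phi> x \<partial>m) = ennreal E0" "0 \<le> E0"
    using E by (cases "\<integral>\<^sup>+x. \<phi> x * U \<phi> x \<partial>m") auto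
  \<comment> \<open>The signed vector is split into nonnegative parts: \<open>mixed_energy\<close>
    is applied to \<open>p\<close> together with \<open>e * \<phi>\<close> against
    \<open>n\<close>.\<close>
  define p where "p i = max 0 (c i)" for i
  define n where "n i = max 0 (- c i)" for i
  have pn: "0 \<le> p i" "0 \<le> n i" "c i = p i - n i" for i
    by (auto simp: p_def n_def)
  define B where "B a b = (\<Sum>i\<in>J. a i * (\<Sum>j\<in>J. b j * u i j))" for a b :: "'a \<Rightarrow> real"
  define L where "L a = (\<Sum>i\<in>J. a i * w i)" for a :: "'a \<Rightarrow> real"
  have B0: "0 \<le> B a b" if "\<And>i. 0 \<le> a i" "\<And>i. 0 \<le> b i" for a b
    unfolding B_def using that u_nonneg by (intro sum_nonneg mult_nonneg_nonneg) auto
  have L0: "0 \<le> L a" if "\<And>i. 0 \<le> a i" for a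
    unfolding L_def using that w by (intro sum_nonneg mult_nonneg_nonneg) auto
  have Lc: "L c = L p - L n"
    unfolding L_def by (simp add: pn(3) left_diff_distrib sum_subtractf)
  have Bsym: "B p n = B n p"
    unfolding B_def sum_distrib_left by (subst sum.swap) (simp add: mult_ac u_sym)
  have "B c c = B p p - B p n - B n p + B n n"
    unfolding B_def sum_distrib_left sum.distrib[symmetric] sum_subtractf[symmetric]
    by (intro sum.cong refl) (simp add: pn(3) algebra_simps)
  moreover have "B c c = (\<Sum>i\<in>J. \<Sum>j\<in>J. c i * c j * u i j)"
    unfolding B_def sum_distrib_left by (simp add: mult_ac)
  ultimately have Bc: "B p p + B n n - 2 * B p n \<le> 0"
    using Q Bsym by simp
  have var: "0 \<le> 2 * e * L c + e * e * E0" if e: "0 < e" for e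
  proof -
    define h where "h x = ennreal e * \<phi> x" for x
    have h: "h \<in> borel_measurable borel" "\<And>x. h x < \<infinity>"
      unfolding h_def using \<phi> by (auto simp: ennreal_mult_less_top)
    have z: "(\<lambda>_. 0) \<in> borel_measurable (borel :: 'a measure)" "(0::ennreal) < \<infinity>" by auto
    have Uh: "U h x = ennreal e * U \<phi> x" for x
    proof -
      have "U h x = (\<integral>\<^sup>+y. ennreal e * (ennreal (u x y) * \<phi> y) \<partial>m)"
        unfolding U_def h_def by (intro nn_integral_cong) (simp only: mult_ac)
      also have "\<dots> = ennreal e * U \<phi> x"
        unfolding U_def by (rule nn_integral_cmult) (intro measurable_m, use \<phi>(1) in measurable)
      finally show ?thesis .
    qed
    have Uhw: "U h i = ennreal (e * w i)" if "i \<in> J" for i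
      unfolding Uh w(1)[OF that] using e w(2) by (simp add: ennreal_mult)
    have Eh: "(\<integral>\<^sup>+x. h x * U h x \<partial>m) = ennreal (e * e * E0)"
    proof -
      have "(\<integral>\<^sup>+x. h x * U h x \<partial>m) = (\<integral>\<^sup>+x. ennreal (e * e) * (\<phi> x * U \<phi> x) \<partial>m)"
        unfolding Uh h_def using e by (intro nn_integral_cong) (simp add: ennreal_mult mult_ac)
      also have "\<dots> = ennreal (e * e) * ennreal E0"
        unfolding E0(1)[symmetric] by (rule nn_integral_cmult) (intro measurable_m, use \<phi>(1) in measurable)
      finally show ?thesis using e E0 by (simp add: ennreal_mult)
    qed
    have potB: "(\<Sum>x\<in>J. ennreal (a x) * pot J b (\<lambda>_. 0) x) = ennreal (B a b)"
      if ab: "\<And>i. 0 \<le> a i" "\<And>i. 0 \<le> b i" for a b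
    proof -
      have "(\<Sum>x\<in>J. ennreal (a x) * pot J b (\<lambda>_. 0) x) = (\<Sum>x\<in>J. ennreal (a x * (\<Sum>j\<in>J. b j * u x j)))"
        using ab u_nonneg by (intro sum.cong refl) (simp add: pot_eq_ennreal ennreal_mult sum_nonneg)
      also have "\<dots> = ennreal (B a b)"
        unfolding B_def using ab u_nonneg by (intro sum_ennreal) (auto intro!: mult_nonneg_nonneg sum_nonneg)
      finally show ?thesis .
    qed
    have sumU: "(\<Sum>x\<in>J. ennreal (a x) * U h x) = ennreal (e * L a)" if a: "\<And>i. 0 \<le> a i" for a
    proof -
      have "(\<Sum>x\<in>J. ennreal (a x) * U h x) = (\<Sum>x\<in>J. ennreal (e * (a x * w x)))"
        using a e w(2) by (intro sum.cong refl) (simp add: Uhw ennreal_mult'[symmetric] mult_ac)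
      also have "\<dots> = ennreal (\<Sum>x\<in>J. e * (a x * w x))"
        using a e w(2) by (intro sum_ennreal) auto
      finally show ?thesis by (simp add: L_def sum_distrib_left)
    qed
    have poth: "pot J p h x = pot J p (\<lambda>_. 0) x + U h x" for x
      by (simp add: pot_def pot_0)
    have c1: "charge J p h (pot J n (\<lambda>_. 0)) = ennreal (B p n) + ennreal (e * L n)"
      unfolding charge_pot[OF h(1) z(1)] potB[OF pn(1,2)] by (simp add: charge_def sumU[OF pn(2)])
    have c2: "charge J n (\<lambda>_. 0) (pot J n (\<lambda>_. 0)) = ennreal (B n n)"
      unfolding charge_pot[OF z(1) z(1)] potB[OF pn(2,2)] by (simp add: charge_def U_def)
    have c3: "charge J p h (pot J p h) = ennreal (B p p) + ennreal (e * L p) + (ennreal (e * L p) + ennreal (e * e * E0))"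
      unfolding charge_pot[OF h(1) h(1)] poth distrib_left sum.distrib potB[OF pn(1,1)] sumU[OF pn(1)]
      by (simp add: charge_def sumU[OF pn(1)] Eh)
    have "2 * (ennreal (B p n) + ennreal (e * L n)) \<le> ennreal (B p p) + ennreal (e * L p) + (ennreal (e * L p) + ennreal (e * e * E0)) + ennreal (B n n)"
      using mixed_energy[of J J h "\<lambda>_. 0" p n, OF J J h z] unfolding c1 c2 c3 .
    moreover have nn: "0 \<le> B p n" "0 \<le> B p p" "0 \<le> B n n" "0 \<le> e * L p" "0 \<le> e * L n" "0 \<le> e * e * E0"
      using e E0(2) by (auto intro!: B0 L0 pn mult_nonneg_nonneg)
    moreover have "2 * ennreal r = ennreal (2 * r)" for r by (simp add: ennreal_mult')
    ultimately have "ennreal (2 * (B p n + e * L n)) \<le> ennreal (B p p + e * L p + (e * L p + e * e * E0) + B n n)"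
      by (simp only: ennreal_plus[symmetric] add_nonneg_nonneg)
    then have "2 * (B p n + e * L n) \<le> B p p + e * L p + (e * L p + e * e * E0) + B n n"
      using nn by (subst (asm) ennreal_le_iff) simp_all
    then show ?thesis using Bc unfolding Lc by (simp add: algebra_simps)
  qed
  have "- (L c) \<le> 0 + d" if d: "0 < d" for d
  proof -
    \<comment> \<open>This \<open>e\<close> makes the second order term, divided by
      \<open>e\<close>, at most \<open>2 * d\<close>; the summand 1 covers
      \<open>E0 = 0\<close>.\<close>
    define e where "e = 2 * d / (E0 + 1)"
    have e: "0 < e" using d E0 by (simp add: e_def)
    have "0 \<le> e * (2 * L c + e * E0)" using var[OF e] by (simp add: algebra_simps)
    then have "0 \<le> 2 * L c + e * E0" using e by (simp add: zero_le_mult_iff)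
    moreover have "e * E0 \<le> e * (E0 + 1)" using e by (intro mult_left_mono) auto
    moreover have "e * (E0 + 1) = 2 * d" using E0 by (simp add: e_def)
    ultimately show ?thesis by simp
  qed
  then have "- (L c) \<le> 0" by (rule field_le_epsilon)
  then show ?thesis by (simp add: L_def)
qed

text \<open>The quadratic form takes the same value at \<open>- c\<close>, so the first variation is
  bounded below in both directions.\<close>

lemma energy_zero:
  assumes J: "finite J" and Q: "(\<Sum>i\<in>J. \<Sum>j\<in>J. c i * c j * u i j) \<le> 0"
    and \<phi>: "\<phi> \<in> borel_measurable borel" "\<And>x. \<phi> x < \<infinity>"
    and w: "\<And>i. i \<in> J \<Longrightarrow> U \<phi> i < \<infinity>" and E: "(\<integral>\<^sup>+x. \<phi> x * U \<phi> x \<partial>m) < \<infinity>"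
  shows "(\<Sum>i\<in>J. c i * enn2real (U \<phi> i)) = 0"
proof (rule antisym)
  have w': "U \<phi> i = ennreal (enn2real (U \<phi> i))" if "i \<in> J" for i
    using w[OF that] by simp
  show "0 \<le> (\<Sum>i\<in>J. c i * enn2real (U \<phi> i))"
    by (rule energy_variation[OF J Q \<phi> w' _ E]) simp_all
  have "0 \<le> (\<Sum>i\<in>J. - c i * enn2real (U \<phi> i))"
    by (rule energy_variation[OF J _ \<phi> w' _ E]) (use Q in simp_all)
  then show "(\<Sum>i\<in>J. c i * enn2real (U \<phi> i)) \<le> 0" by (simp add: sum_negf)
qed

text \<open>The bound \<open>C\<close> gives the indicator of \<open>V\<close> finite energy and
  finite potentials at the points of \<open>J\<close>; the set \<open>W\<close> separates the other
  points from \<open>V\<close>.\<close>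

lemma exists_test_set:
  assumes J: "finite J"
  shows "\<exists>V W C. open V \<and> open W \<and> j \<in> V \<and> J - {j} \<subseteq> W \<and> V \<inter> W = {} \<and> emeasure m V < \<infinity> \<and> 0 \<le> C \<and>
    (\<forall>y\<in>V. \<forall>x\<in>V \<union> J. u x y \<le> C)"
proof -
  have "\<exists>V W. open V \<and> open W \<and> j \<in> V \<and> i \<in> W \<and> V \<inter> W = {}" if "i \<noteq> j" for i
    using hausdorff[of j i] that by metis
  then obtain V0 W0 where VW: "\<And>i. i \<noteq> j \<Longrightarrow> open (V0 i)" "\<And>i. i \<noteq> j \<Longrightarrow> open (W0 i)" "\<And>i. i \<noteq> j \<Longrightarrow> j \<in> V0 i"
    "\<And>i. i \<noteq> j \<Longrightarrow> i \<in> W0 i" "\<And>i. i \<noteq> j \<Longrightarrow> V0 i \<inter> W0 i = {}"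
    by metis
  define V1 where "V1 = (\<Inter>i\<in>J - {j}. V0 i)"
  define W where "W = (\<Union>i\<in>J - {j}. W0 i)"
  have V1: "open V1" "j \<in> V1" using VW J by (auto simp: V1_def intro!: open_INT)
  have W: "open W" "J - {j} \<subseteq> W" "V1 \<inter> W = {}"
  proof -
    show "open W" unfolding W_def using VW(2) by (intro open_UN ballI) auto
    show "J - {j} \<subseteq> W" unfolding W_def using VW(4) by blast
    show "V1 \<inter> W = {}" unfolding W_def V1_def using VW(5) by blast
  qed
  \<comment> \<open>The summand 1 turns the bounds at the point \<open>j\<close> into strict
    inequalities, which persist near \<open>j\<close>.\<close>
  define C where "C = Max (insert (u j j) ((\<lambda>i. u i j) ` J)) + 1"
  have Cj: "u j j < C" "\<And>i. i \<in> J \<Longrightarrow> u i j < C"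
  proof -
    have "finite (insert (u j j) ((\<lambda>i. u i j) ` J))" using J by simp
    then have "u j j \<le> C - 1" "\<And>i. i \<in> J \<Longrightarrow> u i j \<le> C - 1" unfolding C_def by (auto intro: Max_ge)
    then show "u j j < C" "\<And>i. i \<in> J \<Longrightarrow> u i j < C" by force+
  qed
  have "open {z. u (fst z) (snd z) < C}"
    using u_continuous by (intro open_Collect_less continuous_on_const) (simp add: split_beta')
  moreover have "(j, j) \<in> {z. u (fst z) (snd z) < C}" using Cj by simp
  ultimately obtain A B where AB: "open A" "open B" "(j, j) \<in> A \<times> B" "A \<times> B \<subseteq> {z. u (fst z) (snd z) < C}"
    by (rule open_prod_elim)
  define V2 where "V2 = (\<Inter>i\<in>J. {y. u i y < C})"
  have V2: "open V2" "j \<in> V2"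
    using J Cj u_continuous2 by (auto simp: V2_def intro!: open_INT open_Collect_less continuous_on_const)
  obtain V where V: "open V" "j \<in> V" "V \<subseteq> V1 \<inter> A \<inter> B \<inter> V2" "emeasure m V < \<infinity>"
    using exists_small_nhd[of "V1 \<inter> A \<inter> B \<inter> V2" j] V1 V2 AB by (auto simp: open_Int)
  have "u x y \<le> C" if "y \<in> V" "x \<in> V \<union> J" for x y
  proof (cases "x \<in> V")
    case True
    then have "(x, y) \<in> A \<times> B" using that(1) V(3) by blast
    then show ?thesis using AB(4) by (auto intro: less_imp_le)
  next
    case False
    then have "x \<in> J" "y \<in> V2" using that V(3) by auto
    then show ?thesis by (auto simp: V2_def intro: less_imp_le)
  qed
  moreover have "0 \<le> C" using u_nonneg[of j j] Cj(1) by simp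
  ultimately show ?thesis
    using V W by (intro exI[of _ V] exI[of _ W] exI[of _ C]) auto
qed

lemma A_add_le:
  assumes "h \<in> borel_measurable borel" "k \<in> borel_measurable borel" "\<And>y. h y + k y \<le> 1" "0 \<le> t"
  shows "A t h x + A t k x \<le> ennreal t"
proof -
  have "A t h x + A t k x = (\<integral>\<^sup>+s. T s h x * indicator {0..t} s + T s k x * indicator {0..t} s \<partial>lborel)"
    unfolding A_def by (rule nn_integral_add[symmetric])
      (use measurable_time[OF assms(1), of x] measurable_time[OF assms(2), of x] in measurable)
  also have "\<dots> \<le> (\<integral>\<^sup>+s. 1 * indicator {0..t} s \<partial>lborel)"
  proof (rule nn_integral_mono)
    fix s :: real
    have "T s h x + T s k x = T s (\<lambda>y. h y + k y) x"
      by (rule nn_integral_add[symmetric]) (intro measurable_k assms)+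
    also have "\<dots> \<le> 1" by (rule T_le) (rule assms)
    finally show "T s h x * indicator {0..t} s + T s k x * indicator {0..t} s \<le> 1 * indicator {0..t} s"
      by (simp add: indicator_def)
  qed
  also have "\<dots> = ennreal t" using assms(4) by simp
  finally show ?thesis .
qed

text \<open>If the energy of \<open>\<Sum>\<^sub>i c\<^sub>i \<delta>\<^sub>i\<close> is not positive, then its mutual energy vanishes with every function
  of finite energy.  For \<open>\<phi> = 1\<^sub>V\<close> and for \<open>T\<^sub>t \<phi>\<close>, with \<open>V\<close> a neighbourhood of \<open>j\<close> away from the other
  points, the difference is \<open>\<Sum>\<^sub>i c\<^sub>i A t \<phi> i\<close>, which is asymptotic to \<open>c\<^sub>j t\<close> as \<open>t\<close> tends to 0.\<close>

lemma positive_definite: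
  assumes J: "finite J" and j: "j \<in> J" "c j \<noteq> 0"
  shows "0 < (\<Sum>i\<in>J. \<Sum>j\<in>J. c i * c j * u i j)"
proof (rule ccontr)
  assume "\<not> 0 < (\<Sum>i\<in>J. \<Sum>j\<in>J. c i * c j * u i j)"
  then have Q: "(\<Sum>i\<in>J. \<Sum>j\<in>J. c i * c j * u i j) \<le> 0" by simp
  obtain V W C where V: "open V" "open W" "j \<in> V" "J - {j} \<subseteq> W" "V \<inter> W = {}" "emeasure m V < \<infinity>" "0 \<le> C"
    "\<And>x y. y \<in> V \<Longrightarrow> x \<in> V \<union> J \<Longrightarrow> u x y \<le> C"
    using exists_test_set[OF J, of j] by blast
  let ?\<phi> = "indicator V :: 'a \<Rightarrow> ennreal" and ?\<psi> = "indicator W :: 'a \<Rightarrow> ennreal"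
  have \<phi>: "?\<phi> \<in> borel_measurable borel" "\<And>x. ?\<phi> x < \<infinity>" and \<psi>: "?\<psi> \<in> borel_measurable borel"
    using V by (auto simp: indicator_def)
  have Vm: "V \<in> sets m" using V(1) by (simp add: sets_m)
  have U\<phi>: "U ?\<phi> x \<le> ennreal C * emeasure m V" if "x \<in> V \<union> J" for x
  proof -
    have "U ?\<phi> x \<le> (\<integral>\<^sup>+y. ennreal C * indicator V y \<partial>m)"
      unfolding U_def using V(8)[OF _ that] by (intro nn_integral_mono) (auto simp: indicator_def ennreal_leI)
    then show ?thesis using Vm by (simp add: nn_integral_cmult_indicator)
  qed
  have CV: "ennreal C * emeasure m V < \<infinity>" using V(6) by (simp add: ennreal_mult_less_top)
  have w: "U ?\<phi> i < \<infinity>" if "i \<in> J" for i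
    using U\<phi>[of i] CV that by (auto intro: le_less_trans)
  have E: "(\<integral>\<^sup>+x. ?\<phi> x * U ?\<phi> x \<partial>m) < \<infinity>"
  proof -
    have "(\<integral>\<^sup>+x. ?\<phi> x * U ?\<phi> x \<partial>m) \<le> (\<integral>\<^sup>+x. ennreal C * emeasure m V * indicator V x \<partial>m)"
      using U\<phi> by (intro nn_integral_mono) (auto simp: indicator_def)
    also have "\<dots> = ennreal C * emeasure m V * emeasure m V"
      using Vm by (rule nn_integral_cmult_indicator)
    also have "\<dots> < \<infinity>" using CV V(6) by (simp add: ennreal_mult_less_top)
    finally show ?thesis .
  qed
  have AU: "A t ?\<phi> x + U (T t ?\<phi>) x = U ?\<phi> x" if "0 < t" for t x
    using A_plus_T_U(2)[OF \<phi>(1)] that by simp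
  have UT_le: "U (T t ?\<phi>) x \<le> U ?\<phi> x" if "0 < t" for t x
    unfolding AU[OF that, symmetric] by simp
  have A0: "(\<Sum>i\<in>J. c i * enn2real (A t ?\<phi> i)) = 0" if t: "0 < t" for t
  proof -
    have T\<phi>: "T t ?\<phi> \<in> borel_measurable borel" by (rule measurable_T1[OF \<phi>(1)])
    have "T t ?\<phi> x \<le> 1" for x by (rule T_le) (simp add: indicator_def)
    then have T\<phi>_fin: "T t ?\<phi> x < \<infinity>" for x by (rule le_less_trans) simp
    have wT: "U (T t ?\<phi>) i < \<infinity>" if "i \<in> J" for i
      using UT_le[OF t] w[OF that] by (rule le_less_trans)
    \<comment> \<open>Energy of \<open>T t\<close> applied to the indicator: one factor
      \<open>T t\<close> is moved across by symmetry, and potentials decrease under it.\<close>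
    have "(\<integral>\<^sup>+x. T t ?\<phi> x * U (T t ?\<phi>) x \<partial>m) = (\<integral>\<^sup>+x. ?\<phi> x * T t (U (T t ?\<phi>)) x \<partial>m)"
      using t by (intro symmetric[symmetric] \<phi> measurable_U T\<phi>) simp
    also have "\<dots> \<le> (\<integral>\<^sup>+x. ?\<phi> x * U ?\<phi> x \<partial>m)"
      using order_trans[OF supermedianD(2)[OF supermedian_U[OF T\<phi>]] UT_le[OF t]] t
      by (intro nn_integral_mono mult_left_mono) auto
    finally have ET: "(\<integral>\<^sup>+x. T t ?\<phi> x * U (T t ?\<phi>) x \<partial>m) < \<infinity>" using E by (rule le_less_trans)
    have "enn2real (U ?\<phi> i) = enn2real (A t ?\<phi> i) + enn2real (U (T t ?\<phi>) i)" if "i \<in> J" for i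
    proof -
      have "A t ?\<phi> i \<le> A t ?\<phi> i + U (T t ?\<phi>) i" by simp
      also have "\<dots> < \<infinity>" unfolding AU[OF t] by (rule w[OF that])
      finally have "enn2real (A t ?\<phi> i + U (T t ?\<phi>) i) = enn2real (A t ?\<phi> i) + enn2real (U (T t ?\<phi>) i)"
        using wT[OF that] by (intro enn2real_plus) simp_all
      then show ?thesis unfolding AU[OF t] .
    qed
    then have "(\<Sum>i\<in>J. c i * enn2real (U ?\<phi> i)) = (\<Sum>i\<in>J. c i * enn2real (A t ?\<phi> i)) + (\<Sum>i\<in>J. c i * enn2real (U (T t ?\<phi>) i))"
      unfolding sum.distrib[symmetric] by (intro sum.cong refl) (simp add: distrib_left)
    then show ?thesis
      using energy_zero[OF J Q \<phi> w E] energy_zero[OF J Q T\<phi> T\<phi>_fin wT ET] by simp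
  qed
  define s where "s = (\<Sum>i\<in>J. \<bar>c i\<bar>)"
  have cs: "\<bar>c j\<bar> \<le> s" unfolding s_def using J j by (intro member_le_sum) auto
  \<comment> \<open>With this \<open>e\<close> the other points contribute at most
    \<open>t * (e * s)\<close>, a quarter of \<open>t * \<bar>c j\<bar>\<close>, against at least
    three quarters of it from \<open>j\<close>.\<close>
  define e where "e = \<bar>c j\<bar> / (4 * s)"
  have e: "0 < e" "e \<le> 1 / 4" "e * s = \<bar>c j\<bar> / 4"
    using cs j by (auto simp: e_def field_simps)
  have le1: "A t ?\<phi> i + A t ?\<psi> i \<le> ennreal t" if "0 < t" for t i
    using V(5) that by (intro A_add_le \<phi> \<psi>) (auto simp: indicator_def)
  have big: "\<forall>\<^sub>F t in at_right 0. ennreal t * ennreal (1 - e) \<le> A t h x"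
    if "h = indicator X" "open X" "x \<in> X" for h X x
    using that e by (intro lsc_eventually_less_A) (auto simp: lsc_indicator ennreal_less_one_iff)
  have "\<forall>\<^sub>F t in at_right 0. ennreal t * ennreal (1 - e) \<le> A t ?\<phi> j"
    using V by (intro big) auto
  \<comment> \<open>At another point \<open>i\<close> the averages concentrate on \<open>W\<close>;
    since \<open>V\<close> is disjoint from \<open>W\<close>, at most \<open>t * e\<close> is left
    for \<open>V\<close>.\<close>
  moreover have "\<forall>\<^sub>F t in at_right 0. \<forall>i\<in>J - {j}. ennreal t * ennreal (1 - e) \<le> A t ?\<psi> i"
  proof (rule eventually_ball_finite)
    show "\<forall>i\<in>J - {j}. \<forall>\<^sub>F t in at_right 0. ennreal t * ennreal (1 - e) \<le> A t ?\<psi> i"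
    proof
      fix i assume "i \<in> J - {j}"
      then show "\<forall>\<^sub>F t in at_right 0. ennreal t * ennreal (1 - e) \<le> A t ?\<psi> i"
        using V(4) by (intro big[OF refl V(2)]) blast
    qed
  qed (use J in simp)
  moreover have "\<forall>\<^sub>F t in at_right (0::real). 0 < t" by (simp add: eventually_at_right_less)
  ultimately have "\<forall>\<^sub>F t in at_right (0::real). False"
  proof eventually_elim
    case (elim t)
    have fin: "A t ?\<phi> i \<le> ennreal t" for i
      using le1[OF elim(3), of i] by (rule order_trans[rotated]) simp
    have a: "A t ?\<phi> i = ennreal (enn2real (A t ?\<phi> i))" for i
      using le_less_trans[OF fin[of i] ennreal_less_top] by simp
    have "ennreal (t * (1 - e)) \<le> ennreal (enn2real (A t ?\<phi> j))"
      using elim(1,3) e a[of j] by (simp add: ennreal_mult)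
    then have "t * (1 - e) \<le> enn2real (A t ?\<phi> j)"
      by (subst (asm) ennreal_le_iff) simp_all
    then have "\<bar>c j\<bar> * (t * (1 - e)) \<le> \<bar>c j * enn2real (A t ?\<phi> j)\<bar>"
      by (simp add: abs_mult mult_left_mono)
    also have "c j * enn2real (A t ?\<phi> j) = - (\<Sum>i\<in>J - {j}. c i * enn2real (A t ?\<phi> i))"
      using A0[OF elim(3)] sum.remove[OF J j(1), of "\<lambda>i. c i * enn2real (A t ?\<phi> i)"] by simp
    also have "\<bar>- (\<Sum>i\<in>J - {j}. c i * enn2real (A t ?\<phi> i))\<bar> \<le> (\<Sum>i\<in>J - {j}. \<bar>c i\<bar> * (t * e))"
      unfolding abs_minus
    proof (rule order_trans[OF sum_abs], rule sum_mono)
      fix i assume i: "i \<in> J - {j}"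
      have "ennreal (enn2real (A t ?\<phi> i)) + ennreal (t * (1 - e)) \<le> ennreal t"
        using order_trans[OF add_left_mono le1[OF elim(3), of i], of "ennreal t * ennreal (1 - e)"] elim(2,3) i e a[of i]
        by (simp add: ennreal_mult)
      then have "ennreal (enn2real (A t ?\<phi> i) + t * (1 - e)) \<le> ennreal t"
        using elim(3) e by (simp add: ennreal_plus)
      then have "enn2real (A t ?\<phi> i) + t * (1 - e) \<le> t"
        using elim(3) by (subst (asm) ennreal_le_iff) simp_all
      then have "enn2real (A t ?\<phi> i) \<le> t * e" by (simp add: algebra_simps)
      then show "\<bar>c i * enn2real (A t ?\<phi> i)\<bar> \<le> \<bar>c i\<bar> * (t * e)"
        by (simp add: abs_mult mult_left_mono)
    qed
    also have "\<dots> \<le> (\<Sum>i\<in>J. \<bar>c i\<bar> * (t * e))"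
      using J elim(3) e by (intro sum_mono2) auto
    also have "\<dots> = t * (e * s)" by (simp add: s_def sum_distrib_left sum_distrib_right mult_ac)
    also have "\<dots> = t * (\<bar>c j\<bar> / 4)" by (simp only: e(3))
    finally have "t * (\<bar>c j\<bar> * (1 - e)) \<le> t * (\<bar>c j\<bar> / 4)" by (simp add: mult_ac)
    then have "\<bar>c j\<bar> * (1 - e) \<le> \<bar>c j\<bar> / 4" using elim(3) by (simp only: mult_le_cancel_left_pos)
    moreover have "\<bar>c j\<bar> * (3 / 4) \<le> \<bar>c j\<bar> * (1 - e)" using e by (intro mult_left_mono) auto
    ultimately show False using j(2) by simp
  qed
  then show False by simp
qed

lemma balayage_kernel:
  "balayage_kernel u {f. (\<forall>x. 0 \<le> f x) \<and> supermedian (\<lambda>x. ennreal (f x)) \<and> lsc (\<lambda>x. ennreal (f x))}"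
proof
  show "0 < (\<Sum>i\<in>J. \<Sum>j\<in>J. c i * c j * u i j)" if "finite J" "\<exists>i\<in>J. c i \<noteq> 0" for J c
    using that positive_definite[of J _ c] by blast
  show "u y \<in> {f. (\<forall>x. 0 \<le> f x) \<and> supermedian (\<lambda>x. ennreal (f x)) \<and> lsc (\<lambda>x. ennreal (f x))}" for y
    using u_nonneg supermedian_u' lsc_u' by simp
  show "(\<Sum>j\<in>J. a j * u x j) \<le> f x"
    if "finite J" "\<And>j. j \<in> J \<Longrightarrow> 0 \<le> a j"
      "f \<in> {f. (\<forall>x. 0 \<le> f x) \<and> supermedian (\<lambda>x. ennreal (f x)) \<and> lsc (\<lambda>x. ennreal (f x))}"
      "\<And>i. i \<in> J \<Longrightarrow> (\<Sum>j\<in>J. a j * u i j) \<le> f i" for J a f x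
    by (rule domination) (use that in auto)
qed (rule u_nonneg u_sym)+

lemma u_diag_pos: "0 < u x x"
  using positive_definite[of "{x}" x "\<lambda>_. 1"] by simp

end

section \<open>The transition semigroup of a Borel right process\<close>

lemma borel_induct_indicator [consumes 1, case_names indicator cmult add SUP]:
  fixes h :: "'a :: topological_space \<Rightarrow> ennreal"
  assumes h: "h \<in> borel_measurable borel"
    and ind: "\<And>B. B \<in> sets borel \<Longrightarrow> Q (indicator B)"
    and cmult: "\<And>h c. h \<in> borel_measurable borel \<Longrightarrow> Q h \<Longrightarrow> Q (\<lambda>x. c * h x)"
    and add: "\<And>h k. h \<in> borel_measurable borel \<Longrightarrow> k \<in> borel_measurable borel \<Longrightarrow> Q h \<Longrightarrow> Q k \<Longrightarrow> Q (\<lambda>x. h x + k x)"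
    and sup: "\<And>H. (\<And>n::nat. H n \<in> borel_measurable borel) \<Longrightarrow> incseq H \<Longrightarrow> (\<And>n. Q (H n)) \<Longrightarrow> Q (\<lambda>x. SUP n. H n x)"
  shows "Q h"
  using h
proof (induction rule: borel_measurable_induct)
  case (cong f g)
  then have "f = g" by auto
  then show ?case using cong by simp
next
  case (seq U)
  have "Q (\<lambda>x. SUP n. U n x)" by (rule sup) (use seq in auto)
  moreover have "(SUP n. U n) = (\<lambda>x. SUP n. U n x)" by (rule ext) (simp only: SUP_apply)
  ultimately show ?case by simp
qed (use ind cmult add in auto)

lemma space_cemetery_borel [simp]: "space cemetery_borel = UNIV"
  by (simp add: cemetery_borel_def space_measure_of_conv)

lemma cemetery_borel_openin: "openin cemetery_topology V \<Longrightarrow> V \<in> sets cemetery_borel"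
  by (simp add: cemetery_borel_def)

lemma Some_image_borel:
  assumes "B \<in> sets borel"
  shows "Some ` B \<in> sets cemetery_borel"
proof -
  have "B \<in> sigma_sets UNIV {S. open S}" using assms by (simp add: borel_def)
  then show ?thesis
  proof (induction rule: sigma_sets.induct)
    case (Basic A)
    then show ?case by (intro cemetery_borel_openin) simp
  next
    case (Compl A)
    have "Some ` (UNIV - A) = Some ` UNIV - Some ` A" by auto
    moreover have "Some ` (UNIV :: 'a set) \<in> sets cemetery_borel" by (intro cemetery_borel_openin) simp
    ultimately show ?case using Compl by auto
  next
    case (Union A)
    have "Some ` (\<Union>i. A i) = (\<Union>i. Some ` A i)" by auto
    then show ?case using Union by auto
  qed simp
qed

lemma None_cemetery_borel: "{None :: 'a :: topological_space option} \<in> sets cemetery_borel"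
proof -
  have "{None :: 'a option} = UNIV - Some ` UNIV" by (auto simp: image_iff)
  then show ?thesis using Some_image_borel[of "UNIV :: 'a set"] by (metis sets.compl_sets space_borel space_cemetery_borel sets.top)
qed

lemma measurable_Some [measurable]: "Some \<in> measurable borel cemetery_borel"
  unfolding cemetery_borel_def
proof (rule measurable_sigma_sets)
  show "sets (sigma UNIV {V. openin cemetery_topology V}) = sigma_sets UNIV {V. openin cemetery_topology V}" by simp
  fix V :: "'a option set" assume "V \<in> {V. openin cemetery_topology V}"
  then have "openin euclidean {x \<in> topspace euclidean. Some x \<in> V}"
    by (intro openin_continuous_map_preimage[OF continuous_map_Some]) simp
  moreover have "{x \<in> topspace euclidean. Some x \<in> V} = Some -` V \<inter> space borel" by auto
  ultimately show "Some -` V \<inter> space borel \<in> sets borel" by simp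
qed auto

lemma measurable_the [measurable]: "the \<in> measurable cemetery_borel borel"
proof (rule measurableI)
  fix B :: "'a set" assume "B \<in> sets borel"
  then have 1: "Some ` B \<in> sets cemetery_borel" by (rule Some_image_borel)
  \<comment> \<open>\<open>the None\<close> is an unspecified point, so membership of
    \<open>None\<close> in the preimage depends on \<open>B\<close>.\<close>
  have 2: "(if the None \<in> B then {None} else {}) \<in> sets cemetery_borel"
    by (simp add: None_cemetery_borel)
  have 3: "the -` B \<inter> space cemetery_borel = Some ` B \<union> (if the None \<in> B then {None} else {})"
  proof (rule Set.set_eqI)
    fix z :: "'a option"
    show "z \<in> the -` B \<inter> space cemetery_borel \<longleftrightarrow> z \<in> Some ` B \<union> (if the None \<in> B then {None} else {})"
      by (cases z) auto
  qed
  show "the -` B \<inter> space cemetery_borel \<in> sets cemetery_borel"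
    unfolding 3 by (rule sets.Un[OF 1 2])
qed simp

text \<open>An open set of the compactification is an open set of the state space or the complement
  of a compact one. Compact sets are closed in a Hausdorff space, hence Borel, so the open sets of
  the state space suffice.\<close>

lemma measurable_cemeteryI:
  fixes f :: "'b \<Rightarrow> 'a :: t2_space option"
  assumes "\<And>V. open V \<Longrightarrow> {x \<in> space M. f x \<in> Some ` V} \<in> sets M"
  shows "f \<in> measurable M cemetery_borel"
proof -
  have B: "{x \<in> space M. f x \<in> Some ` B} \<in> sets M" if "B \<in> sets borel" for B
  proof -
    have "B \<in> sigma_sets UNIV {S. open S}" using that by (simp add: borel_def)
    then show ?thesis
    proof (induction rule: sigma_sets.induct)
      case (Basic A)
      then show ?case using assms by simp
    next
      case (Compl A)
      have "{x \<in> space M. f x \<in> Some ` (UNIV - A)} = {x \<in> space M. f x \<in> Some ` UNIV} - {x \<in> space M. f x \<in> Some ` A}"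
        by auto
      then show ?case using Compl assms[of UNIV] by auto
    next
      case (Union A)
      have "{x \<in> space M. f x \<in> Some ` (\<Union>i. A i)} = (\<Union>i. {x \<in> space M. f x \<in> Some ` A i})" by auto
      then show ?case using Union by auto
    qed simp
  qed
  show ?thesis
    unfolding cemetery_borel_def
  proof (rule measurable_measure_of)
    fix V :: "'a option set" assume "V \<in> {V. openin cemetery_topology V}"
    then consider U where "open U" "V = Some ` U" | C where "compact C" "V = insert None (Some ` (UNIV - C))"
      by (auto simp: openin_Alexandroff_compactification)
    then show "f -` V \<inter> space M \<in> sets M"
    proof cases
      case 1
      then have "f -` V \<inter> space M = {x \<in> space M. f x \<in> Some ` U}" by auto
      then show ?thesis using assms 1 by simp
    next
      case 2
      have "f -` V \<inter> space M = space M - {x \<in> space M. f x \<in> Some ` C}"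
      proof (rule Set.set_eqI)
        fix x show "x \<in> f -` V \<inter> space M \<longleftrightarrow> x \<in> space M - {x \<in> space M. f x \<in> Some ` C}"
          unfolding 2(2) by (cases "f x") auto
      qed
      then show ?thesis using B[of C] compact_imp_closed[OF 2(1)] by simp
    qed
  qed auto
qed

lemma ext0_alt: "ext0 h z = indicator (range Some) z * h (the z)"
  by (cases z) (auto simp: ext0_def)

lemma range_Some_cemetery_borel [measurable]: "range Some \<in> sets cemetery_borel"
  by (rule Some_image_borel) simp

lemma measurable_ext0 [measurable]:
  assumes [measurable]: "h \<in> borel_measurable borel"
  shows "ext0 h \<in> borel_measurable cemetery_borel"
  unfolding ext0_alt[abs_def] by measurable

section \<open>Approximation of open sets and of times\<close>

text \<open>Along a right continuous path, lying in an open set and lying outside a compact set are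
  properties that persist for a short time. An open set is therefore sandwiched: the open
  \<open>A k\<close> exhaust it, and the compact \<open>C k\<close> between \<open>A k\<close> and
  \<open>V\<close> catch the limits.\<close>

lemma open_compact_exhaustion:
  fixes V :: "'a :: {t2_space, second_countable_topology} set"
  assumes lc: "locally_compact_space (euclidean :: 'a topology)" and V: "open V"
  obtains A C :: "nat \<Rightarrow> 'a set" where "\<And>k. open (A k)" "\<And>k. compact (C k)" "\<And>k. A k \<subseteq> C k" "\<And>k. C k \<subseteq> V"
    "incseq A" "(\<Union>k. A k) = V"
proof -
  have "neighbourhood_base_of (compactin euclidean) (euclidean :: 'a topology)"
  proof (subst locally_compact_space_neighbourhood_base[symmetric])
    have "Hausdorff_space (euclidean :: 'a topology)"
      unfolding Hausdorff_space_def using hausdorff by (fastforce simp: disjnt_def)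
    then show "Hausdorff_space (euclidean :: 'a topology) \<or> regular_space (euclidean :: 'a topology)" ..
  qed (rule lc)
  then have "\<exists>U K. open U \<and> compact K \<and> x \<in> U \<and> U \<subseteq> K \<and> K \<subseteq> V" if "x \<in> V" for x
    using V that by (auto simp: neighbourhood_base_of_def neighbourhood_base_at_def)
  then obtain U K where UK: "\<And>x. x \<in> V \<Longrightarrow> open (U x)" "\<And>x. x \<in> V \<Longrightarrow> compact (K x)"
    "\<And>x. x \<in> V \<Longrightarrow> x \<in> U x" "\<And>x. x \<in> V \<Longrightarrow> U x \<subseteq> K x" "\<And>x. x \<in> V \<Longrightarrow> K x \<subseteq> V" by metis
  obtain F where F: "F \<subseteq> U ` V" "countable F" "\<Union>F = \<Union>(U ` V)"
    using Lindelof_openin[of "U ` V" UNIV] UK(1) by auto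
  then obtain X where X: "X \<subseteq> V" "countable X" "F = U ` X"
    by (metis countable_image_eq_inj countable_subset_image)
  have UX: "(\<Union>x\<in>X. U x) = V"
    using F(3) UK(3,4,5) unfolding X(3) by blast
  show ?thesis
  proof (cases "X = {}")
    case True
    then have "V = {}" using UX by simp
    then show ?thesis by (intro that[of "\<lambda>_. {}" "\<lambda>_. {}"]) auto
  next
    case False
    let ?e = "from_nat_into X"
    have e: "?e i \<in> V" for i using from_nat_into[OF False, of i] X(1) by blast
    have re: "range ?e = X" using False X(2) by (rule range_from_nat_into)
    show ?thesis
    proof (rule that[of "\<lambda>k. \<Union>i\<le>k. U (?e i)" "\<lambda>k. \<Union>i\<le>k. K (?e i)"])
      show "open (\<Union>i\<le>k. U (?e i))" for k using UK(1) e by blast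
      show "compact (\<Union>i\<le>k. K (?e i))" for k using UK(2) e by (intro compact_UN) auto
      show "(\<Union>i\<le>k. U (?e i)) \<subseteq> (\<Union>i\<le>k. K (?e i))" for k using UK(4) e by blast
      show "(\<Union>i\<le>k. K (?e i)) \<subseteq> V" for k using UK(5) e by blast
      show "incseq (\<lambda>k. \<Union>i\<le>k. U (?e i))" by (intro incseq_SucI UN_mono) auto
      have "(\<Union>k. \<Union>i\<le>k. U (?e i)) = (\<Union>x\<in>range ?e. U x)" by auto
      then show "(\<Union>k. \<Union>i\<le>k. U (?e i)) = V" unfolding re UX .
    qed
  qed
qed

text \<open>The added 1 puts the dyadic time strictly above \<open>s\<close>, even if
  \<open>s\<close> is dyadic itself; right limits are taken along strictly greater times.\<close>

definition dyadic_above :: "nat \<Rightarrow> real \<Rightarrow> real" where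
  "dyadic_above n s = (real_of_int \<lfloor>s * 2 ^ n\<rfloor> + 1) / 2 ^ n"

lemma dyadic_above_greater: "s < dyadic_above n s"
proof -
  have "s * 2 ^ n < real_of_int \<lfloor>s * 2 ^ n\<rfloor> + 1" by linarith
  then show ?thesis by (simp only: dyadic_above_def pos_less_divide_eq zero_less_power zero_less_numeral)
qed

lemma dyadic_above_le: "dyadic_above n s \<le> s + (1 / 2) ^ n"
proof -
  have "dyadic_above n s \<le> (s * 2 ^ n + 1) / 2 ^ n"
    unfolding dyadic_above_def by (intro divide_right_mono add_right_mono of_int_floor_le) simp
  also have "\<dots> = s + (1 / 2) ^ n"
    by (simp add: add_divide_distrib power_one_over)
  finally show ?thesis .
qed

lemma dyadic_above_at_right: "filterlim (\<lambda>n. dyadic_above n s) (at_right s) sequentially"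
  unfolding filterlim_at
proof
  show "\<forall>\<^sub>F n in sequentially. dyadic_above n s \<in> {s<..} \<and> dyadic_above n s \<noteq> s"
    using dyadic_above_greater by (intro always_eventually allI) (auto simp: less_imp_neq[symmetric])
  have "(\<lambda>n. s + (1 / 2) ^ n) \<longlonglongrightarrow> s + 0"
    by (intro tendsto_add tendsto_const LIMSEQ_realpow_zero) auto
  show "(\<lambda>n. dyadic_above n s) \<longlonglongrightarrow> s"
  proof (rule tendsto_sandwich[where f="\<lambda>_. s" and h="\<lambda>n. s + (1 / 2) ^ n", rotated 2, OF tendsto_const])
    show "\<forall>\<^sub>F n in sequentially. s \<le> dyadic_above n s"
      by (intro always_eventually allI less_imp_le dyadic_above_greater)
    show "\<forall>\<^sub>F n in sequentially. dyadic_above n s \<le> s + (1 / 2) ^ n"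
      by (intro always_eventually allI dyadic_above_le)
    show "(\<lambda>n. s + (1 / 2) ^ n) \<longlonglongrightarrow> s"
      using \<open>(\<lambda>n. s + (1 / 2) ^ n) \<longlonglongrightarrow> s + 0\<close> by simp
  qed
qed

lemma filterlim_ennreal_at_right:
  assumes "0 \<le> t" "filterlim r (at_right t) F"
  shows "filterlim (\<lambda>n. ennreal (r n)) (at_right (ennreal t)) F"
proof -
  have r: "\<forall>\<^sub>F n in F. t < r n" "(r \<longlongrightarrow> t) F"
    using assms(2) by (auto simp: filterlim_at elim: eventually_mono)
  show ?thesis
    unfolding filterlim_at
  proof
    show "\<forall>\<^sub>F n in F. ennreal (r n) \<in> {ennreal t<..} \<and> ennreal (r n) \<noteq> ennreal t"
      using r(1) by eventually_elim (use assms(1) in \<open>auto simp: ennreal_less_iff\<close>)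
    show "((\<lambda>n. ennreal (r n)) \<longlongrightarrow> ennreal t) F"
      using r(2) by (rule tendsto_ennrealI)
  qed
qed

section \<open>From paths to transition kernels\<close>

context borel_right_process
begin

lemma space_P: "space (P z) = \<Omega>"
  using sets_eq_imp_space_eq[OF law_sets[of z]] by (simp add: space_F)

lemma measurable_Y: "Y t \<in> measurable (P z) cemetery_borel"
proof -
  have "sets (G t) \<subseteq> sets (P z)" using sets_F_mono[of t \<infinity>] by (simp add: law_sets)
  then show ?thesis
    using adapted[of t] by (auto simp: measurable_def space_F space_P)
qed

lemma eventually_Y_openin:
  assumes "\<omega> \<in> \<Omega>" "0 \<le> t" "filterlim r (at_right t) F" "openin cemetery_topology W" "Y (ennreal t) \<omega> \<in> W"
  shows "\<forall>\<^sub>F n in F. Y (ennreal (r n)) \<omega> \<in> W"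
proof -
  have "limitin cemetery_topology (\<lambda>s. Y s \<omega>) (Y (ennreal t) \<omega>) (at_right (ennreal t))"
    using assms(1) by (intro paths_right_continuous) auto
  then have "\<forall>\<^sub>F s in at_right (ennreal t). Y s \<omega> \<in> W"
    using assms(4,5) by (simp add: limitin_def)
  then show ?thesis
    using filterlim_ennreal_at_right[OF assms(2,3)] by (rule eventually_compose_filterlim)
qed

lemma eventually_Y_open:
  assumes "\<omega> \<in> \<Omega>" "0 \<le> t" "filterlim r (at_right t) F" "open V" "Y (ennreal t) \<omega> \<in> Some ` V"
  shows "\<forall>\<^sub>F n in F. Y (ennreal (r n)) \<omega> \<in> Some ` V"
  by (rule eventually_Y_openin[OF assms(1-3)]) (use assms in auto)

text \<open>Compact sets of the state space are closed in the compactification.\<close>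

lemma eventually_Y_compact:
  assumes "\<omega> \<in> \<Omega>" "0 \<le> t" "filterlim r (at_right t) F" "compact C" "Y (ennreal t) \<omega> \<notin> Some ` C"
  shows "\<forall>\<^sub>F n in F. Y (ennreal (r n)) \<omega> \<notin> Some ` C"
proof -
  have "closedin cemetery_topology (Some ` C)"
    using assms(4) by (simp add: compact_imp_closed)
  then have "openin cemetery_topology (topspace cemetery_topology - Some ` C)"
    by (rule openin_diff[OF openin_topspace])
  moreover have "topspace cemetery_topology = (UNIV :: 'a option set)"
    by (auto simp: image_iff)
  ultimately have "openin cemetery_topology (UNIV - Some ` C)" by simp
  from eventually_Y_openin[OF assms(1-3) this] show ?thesis using assms(5) by simp
qed

text \<open>The sub-probability left after discarding the paths in the cemetery, on which
  \<open>the\<close> is meaningless. A negative \<open>s\<close> gives the law at time 0, because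
  \<open>ennreal\<close> truncates.\<close>

definition law :: "real \<Rightarrow> 'a \<Rightarrow> 'a measure" where
  "law s x = distr (density (P (Some x)) (\<lambda>\<omega>. indicator (range Some) (Y (ennreal s) \<omega>))) borel (\<lambda>\<omega>. the (Y (ennreal s) \<omega>))"

lemma sets_law [simp, measurable_cong]: "sets (law s x) = sets borel"
  by (simp add: law_def)

lemma nn_integral_law:
  assumes h: "h \<in> borel_measurable borel"
  shows "(\<integral>\<^sup>+y. h y \<partial>law s x) = transition Y P (ennreal s) h x"
proof -
  have Y: "Y (ennreal s) \<in> measurable (P (Some x)) cemetery_borel" by (rule measurable_Y)
  have 1: "(\<lambda>\<omega>. the (Y (ennreal s) \<omega>)) \<in> measurable (P (Some x)) borel"
    using Y by measurable
  have 2: "(\<lambda>\<omega>. indicator (range Some) (Y (ennreal s) \<omega>) :: ennreal) \<in> borel_measurable (P (Some x))"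
    using Y by measurable
  have 3: "(\<lambda>\<omega>. h (the (Y (ennreal s) \<omega>))) \<in> borel_measurable (P (Some x))"
    by (rule measurable_compose[OF 1 h])
  have "(\<integral>\<^sup>+y. h y \<partial>law s x) = (\<integral>\<^sup>+\<omega>. h (the (Y (ennreal s) \<omega>)) \<partial>density (P (Some x)) (\<lambda>\<omega>. indicator (range Some) (Y (ennreal s) \<omega>)))"
    unfolding law_def by (rule nn_integral_distr) (use 1 h in simp_all)
  also have "\<dots> = (\<integral>\<^sup>+\<omega>. indicator (range Some) (Y (ennreal s) \<omega>) * h (the (Y (ennreal s) \<omega>)) \<partial>P (Some x))"
    by (rule nn_integral_density[OF 2 3])
  finally show ?thesis by (simp add: transition_def ext0_alt)
qed

lemma transition_indicator:
  assumes "B \<in> sets borel"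
  shows "transition Y P t (indicator B) x = emeasure (P (Some x)) {\<omega> \<in> \<Omega>. Y t \<omega> \<in> Some ` B}"
proof -
  have "ext0 (indicator B) z = indicator (Some ` B) z" for z :: "'a option"
    by (cases z) (auto simp: ext0_def indicator_def)
  then have "transition Y P t (indicator B) x = (\<integral>\<^sup>+\<omega>. indicator {\<omega> \<in> \<Omega>. Y t \<omega> \<in> Some ` B} \<omega> \<partial>P (Some x))"
    unfolding transition_def by (intro nn_integral_cong) (simp add: indicator_def space_P)
  also have "\<dots> = emeasure (P (Some x)) {\<omega> \<in> \<Omega>. Y t \<omega> \<in> Some ` B}"
  proof (rule nn_integral_indicator)
    have "Y t -` (Some ` B) \<inter> space (P (Some x)) \<in> sets (P (Some x))"
      by (rule measurable_sets[OF measurable_Y Some_image_borel[OF assms]])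
    moreover have "Y t -` (Some ` B) \<inter> space (P (Some x)) = {\<omega> \<in> \<Omega>. Y t \<omega> \<in> Some ` B}" by (auto simp: space_P)
    ultimately show "{\<omega> \<in> \<Omega>. Y t \<omega> \<in> Some ` B} \<in> sets (P (Some x))" by simp
  qed
  finally show ?thesis .
qed

lemma emeasure_law:
  assumes "B \<in> sets borel"
  shows "emeasure (law s x) B = (\<integral>\<^sup>+\<omega>. indicator (Some ` B) (Y (ennreal s) \<omega>) \<partial>P (Some x))"
proof -
  have "emeasure (law s x) B = (\<integral>\<^sup>+y. indicator B y \<partial>law s x)" using assms by simp
  also have "\<dots> = transition Y P (ennreal s) (indicator B) x"
    using assms by (intro nn_integral_law) simp
  also have "\<dots> = (\<integral>\<^sup>+\<omega>. indicator (Some ` B) (Y (ennreal s) \<omega>) \<partial>P (Some x))"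
    unfolding transition_def by (intro nn_integral_cong) (auto simp: ext0_def indicator_def split: option.split)
  finally show ?thesis .
qed

lemma measurable_indicator_Y:
  "B \<in> sets borel \<Longrightarrow> (\<lambda>\<omega>. indicator (Some ` B) (Y t \<omega>) :: ennreal) \<in> borel_measurable (P z)"
  by (rule measurable_compose[OF measurable_Y borel_measurable_indicator[OF Some_image_borel]])

lemma emeasure_law_le_1: "emeasure (law s x) UNIV \<le> 1"
proof -
  interpret prob_space "P (Some x)" by (rule law_prob_space)
  have "emeasure (law s x) UNIV \<le> (\<integral>\<^sup>+\<omega>. 1 \<partial>P (Some x))"
    unfolding emeasure_law[OF sets.top[of borel, unfolded space_borel]] by (intro nn_integral_mono) (simp add: indicator_def)
  then show ?thesis by (simp add: emeasure_space_1)
qed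

text \<open>Paths from \<open>x\<close> stay in the open set for a short while; dominated
  convergence does the rest.\<close>

lemma law_right_continuous:
  assumes V: "open V" "x \<in> V"
  shows "((\<lambda>s. emeasure (law s x) V) \<longlongrightarrow> 1) (at_right 0)"
proof (rule tendsto_at_right_sequentially[of 0 1])
  fix S :: "nat \<Rightarrow> real" assume S: "\<And>n. 0 < S n" "S \<longlonglongrightarrow> 0"
  interpret prob_space "P (Some x)" by (rule law_prob_space)
  have S': "filterlim S (at_right 0) sequentially"
    using S by (auto simp: filterlim_at intro!: always_eventually less_imp_neq[symmetric])
  have "(\<lambda>n. \<integral>\<^sup>+\<omega>. indicator (Some ` V) (Y (ennreal (S n)) \<omega>) \<partial>P (Some x)) \<longlonglongrightarrow> (\<integral>\<^sup>+\<omega>. 1 \<partial>P (Some x))"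
  proof (rule nn_integral_dominated_convergence[where w="\<lambda>_. 1"])
    show "AE \<omega> in P (Some x). (\<lambda>n. indicator (Some ` V) (Y (ennreal (S n)) \<omega>) :: ennreal) \<longlonglongrightarrow> 1"
      using normal[of "Some x"] AE_space
    proof eventually_elim
      case (elim \<omega>)
      then have "\<forall>\<^sub>F n in sequentially. Y (ennreal (S n)) \<omega> \<in> Some ` V"
        using V by (intro eventually_Y_open[OF _ _ S']) (auto simp: space_P)
      then have "\<forall>\<^sub>F n in sequentially. indicator (Some ` V) (Y (ennreal (S n)) \<omega>) = (1 :: ennreal)"
        by eventually_elim simp
      then show ?case by (rule tendsto_eventually)
    qed
    show "(\<lambda>\<omega>. indicator (Some ` V) (Y (ennreal (S n)) \<omega>) :: ennreal) \<in> borel_measurable (P (Some x))" for n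
      using V by (intro measurable_indicator_Y) simp
    show "AE \<omega> in P (Some x). indicator (Some ` V) (Y (ennreal (S n)) \<omega>) \<le> (1 :: ennreal)" for n
      by (simp add: indicator_def)
  qed (simp_all add: emeasure_space_1)
  then show "(\<lambda>n. emeasure (law (S n) x) V) \<longlonglongrightarrow> 1"
    using V by (simp add: emeasure_law emeasure_space_1)
qed simp

lemma law_max_0: "law (max 0 s) x = law s x"
proof -
  have "ennreal (max 0 s) = ennreal s" by (simp add: max_def ennreal_neg)
  then show ?thesis by (simp add: law_def)
qed

text \<open>Right continuity makes the position at \<open>s\<close> a limit along dyadic times,
  whose values are countable. It lies in \<open>V\<close> if and only if for some \<open>k\<close>
  the dyadic approximations are eventually in \<open>A k\<close>: one direction because
  \<open>A k\<close> is open, the other because a limit of points of \<open>C k\<close> stays in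
  \<open>C k\<close>.\<close>

lemma measurable_Y_pair:
  assumes lc: "locally_compact_space (euclidean :: 'a topology)"
  shows "(\<lambda>z. Y (ennreal (fst z)) (snd z)) \<in> measurable ((borel :: real measure) \<Otimes>\<^sub>M P x) cemetery_borel"
proof (rule measurable_cemeteryI)
  fix V :: "'a set" assume "open V"
  then obtain A C :: "nat \<Rightarrow> 'a set" where AC: "\<And>k. open (A k)" "\<And>k. compact (C k)" "\<And>k. A k \<subseteq> C k" "\<And>k. C k \<subseteq> V"
    "(\<Union>k. A k) = V"
    using open_compact_exhaustion[OF lc] by metis
  have pred: "Measurable.pred ((borel :: real measure) \<Otimes>\<^sub>M P x) (\<lambda>z. Y (ennreal (dyadic_above n (max 0 (fst z)))) (snd z) \<in> Some ` A k)" for n k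
    unfolding dyadic_above_def
  proof (rule measurable_compose_countable[where f="\<lambda>i z. Y (ennreal ((real_of_int i + 1) / 2 ^ n)) (snd z) \<in> Some ` A k"
        and g="\<lambda>z. \<lfloor>max 0 (fst z) * 2 ^ n\<rfloor>"])
    fix i :: int
    have "(\<lambda>z. Y (ennreal ((real_of_int i + 1) / 2 ^ n)) (snd z)) \<in> measurable ((borel :: real measure) \<Otimes>\<^sub>M P x) cemetery_borel"
      by (rule measurable_compose[OF measurable_snd measurable_Y])
    from measurable_sets_Collect[OF this, of "\<lambda>z. z \<in> Some ` A k"]
    show "Measurable.pred ((borel :: real measure) \<Otimes>\<^sub>M P x) (\<lambda>z. Y (ennreal ((real_of_int i + 1) / 2 ^ n)) (snd z) \<in> Some ` A k)"
      using Some_image_borel[of "A k"] AC(1)[of k] by (simp add: Measurable.pred_def)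
  qed measurable
  have eq: "{z \<in> space ((borel :: real measure) \<Otimes>\<^sub>M P x). Y (ennreal (fst z)) (snd z) \<in> Some ` V} =
    {z \<in> space ((borel :: real measure) \<Otimes>\<^sub>M P x). \<exists>k N. \<forall>n\<ge>N. Y (ennreal (dyadic_above n (max 0 (fst z)))) (snd z) \<in> Some ` A k}"
  proof (intro Collect_cong conj_cong refl)
    fix z assume "z \<in> space ((borel :: real measure) \<Otimes>\<^sub>M P x)"
    then have \<omega>: "snd z \<in> \<Omega>" by (auto simp: space_pair_measure space_P)
    let ?s = "max 0 (fst z)"
    have s: "ennreal (fst z) = ennreal ?s" by (simp add: max_def ennreal_neg)
    note up = dyadic_above_at_right[of ?s]
    show "Y (ennreal (fst z)) (snd z) \<in> Some ` V \<longleftrightarrow>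
      (\<exists>k N. \<forall>n\<ge>N. Y (ennreal (dyadic_above n ?s)) (snd z) \<in> Some ` A k)"
    proof
      assume "Y (ennreal (fst z)) (snd z) \<in> Some ` V"
      then obtain k where "Y (ennreal ?s) (snd z) \<in> Some ` A k"
        using AC(5) unfolding s by blast
      from eventually_Y_open[OF \<omega> _ up AC(1) this]
      show "\<exists>k N. \<forall>n\<ge>N. Y (ennreal (dyadic_above n ?s)) (snd z) \<in> Some ` A k"
        unfolding eventually_sequentially by auto
    next
      assume "\<exists>k N. \<forall>n\<ge>N. Y (ennreal (dyadic_above n ?s)) (snd z) \<in> Some ` A k"
      then obtain k where k: "\<forall>\<^sub>F n in sequentially. Y (ennreal (dyadic_above n ?s)) (snd z) \<in> Some ` A k"
        unfolding eventually_sequentially by blast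
      have "Y (ennreal ?s) (snd z) \<in> Some ` C k"
      proof (rule ccontr)
        assume "Y (ennreal ?s) (snd z) \<notin> Some ` C k"
        from eventually_Y_compact[OF \<omega> _ up AC(2) this]
        have "\<forall>\<^sub>F n in sequentially. Y (ennreal (dyadic_above n ?s)) (snd z) \<notin> Some ` C k" by simp
        with k have "\<forall>\<^sub>F n in sequentially. False"
          by eventually_elim (use AC(3)[of k] in auto)
        then show False by simp
      qed
      then show "Y (ennreal (fst z)) (snd z) \<in> Some ` V" using AC(4)[of k] unfolding s by auto
    qed
  qed
  have "Measurable.pred ((borel :: real measure) \<Otimes>\<^sub>M P x)
    (\<lambda>z. \<exists>k N. \<forall>n\<ge>N. Y (ennreal (dyadic_above n (max 0 (fst z)))) (snd z) \<in> Some ` A k)"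
    by (intro pred_intros_countable pred_intros_imp' pred)
  then show "{z \<in> space ((borel :: real measure) \<Otimes>\<^sub>M P x). Y (ennreal (fst z)) (snd z) \<in> Some ` V} \<in> sets ((borel :: real measure) \<Otimes>\<^sub>M P x)"
    unfolding eq Measurable.pred_def .
qed

lemma sigma_finite_P: "sigma_finite_measure (P z)"
  using law_prob_space[of z] by (simp add: prob_space_imp_sigma_finite)

lemma transition_None:
  assumes B: "B \<in> sets borel"
  shows "emeasure (P None) {\<omega> \<in> \<Omega>. Y t \<omega> \<in> Some ` B} = 0"
proof -
  have "AE \<omega> in P None. Y t \<omega> \<notin> Some ` B"
    using normal[of None] AE_space
  proof eventually_elim
    case (elim \<omega>)
    then have "Y t \<omega> = None" by (intro absorbing[of \<omega> 0 t]) (auto simp: space_P)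
    then show ?case by auto
  qed
  moreover have "Y t -` (Some ` B) \<inter> space (P None) \<in> sets (P None)"
    by (rule measurable_sets[OF measurable_Y Some_image_borel[OF B]])
  moreover have "Y t -` (Some ` B) \<inter> space (P None) = {\<omega> \<in> space (P None). \<not> Y t \<omega> \<notin> Some ` B}" by auto
  ultimately have "emeasure (P None) {\<omega> \<in> space (P None). \<not> Y t \<omega> \<notin> Some ` B} = 0"
    using AE_iff_measurable[of "{\<omega> \<in> space (P None). \<not> Y t \<omega> \<notin> Some ` B}" "P None" "\<lambda>\<omega>. Y t \<omega> \<notin> Some ` B"] by simp
  then show ?thesis by (simp add: space_P)
qed

lemma measurable_law_space:
  assumes B: "B \<in> sets borel"
  shows "(\<lambda>x. emeasure (law s x) B) \<in> borel_measurable borel"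
proof -
  have "emeasure (law s x) B = emeasure (P (Some x)) {\<omega> \<in> \<Omega>. Y (ennreal s) \<omega> \<in> Some ` B}" for x
    using nn_integral_law[of "indicator B" s x] transition_indicator[OF B] B by simp
  then show ?thesis
    using measurable_compose[OF measurable_Some borel_transition[OF Some_image_borel[OF B], of "ennreal s"]] by simp
qed

text \<open>The strong Markov property at the constant time \<open>s\<close>; a path in the cemetery
  contributes nothing, as it never returns.\<close>

lemma law_semigroup_indicator:
  assumes st: "0 \<le> s" "0 \<le> t" and B: "B \<in> sets borel"
  shows "(\<integral>\<^sup>+y. emeasure (law t y) B \<partial>law s x) = emeasure (law (s + t) x) B"
proof -
  have law: "emeasure (law r y) B = emeasure (P (Some y)) {\<omega> \<in> \<Omega>. Y (ennreal r) \<omega> \<in> Some ` B}" for r y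
    using nn_integral_law[of "indicator B" r y] transition_indicator[OF B] B by simp
  let ?k = "\<lambda>z. emeasure (P z) {\<omega> \<in> \<Omega>. Y (ennreal t) \<omega> \<in> Some ` B}"
  have T: "stopping_time G (\<lambda>_. ennreal s)" by (rule stopping_time_const)
  have "{\<omega> \<in> \<Omega>. ennreal s \<le> r} \<in> sets (G r)" for r
    using sets.top[of "G r"] by (cases "ennreal s \<le> r") (simp_all add: space_F)
  then have "\<Omega> \<in> sets (pre_sigma (\<lambda>_. ennreal s))"
    by (rule sets_pre_sigmaI[OF T])
  from strong_markov[OF T this Some_image_borel[OF B], of "Some x" "ennreal t"]
  have "emeasure (P (Some x)) {\<omega> \<in> \<Omega>. Y (ennreal s + ennreal t) \<omega> \<in> Some ` B} =
    (\<integral>\<^sup>+\<omega>\<in>\<Omega>. ?k (Y (ennreal s) \<omega>) \<partial>P (Some x))" .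
  also have "\<dots> = (\<integral>\<^sup>+\<omega>. ext0 (\<lambda>y. emeasure (law t y) B) (Y (ennreal s) \<omega>) \<partial>P (Some x))"
  proof (rule nn_integral_cong)
    fix \<omega> assume "\<omega> \<in> space (P (Some x))"
    then show "?k (Y (ennreal s) \<omega>) * indicator \<Omega> \<omega> = ext0 (\<lambda>y. emeasure (law t y) B) (Y (ennreal s) \<omega>)"
      using transition_None[OF B, of "ennreal t"] by (cases "Y (ennreal s) \<omega>") (simp_all add: ext0_def law space_P)
  qed
  also have "\<dots> = (\<integral>\<^sup>+y. emeasure (law t y) B \<partial>law s x)"
    unfolding nn_integral_law[OF measurable_law_space[OF B]] transition_def ..
  finally show ?thesis using st by (simp add: law ennreal_plus)
qed

text \<open>At a fixed dyadic time the law is measurable in \<open>x\<close> by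
  \<open>borel_transition\<close>. For open \<open>V\<close>, Fatou in both directions squeezes the
  \<open>liminf\<close> of the dyadic masses of \<open>A k\<close> between the masses of
  \<open>A k\<close> and of \<open>C k\<close>, so the supremum over \<open>k\<close> is the mass of
  \<open>V\<close>; general Borel sets follow by Dynkin's argument.\<close>

lemma measurable_law_indicator:
  assumes lc: "locally_compact_space (euclidean :: 'a topology)" and B: "B \<in> sets borel"
  shows "(\<lambda>z. emeasure (law (fst z) (snd z)) B) \<in> borel_measurable ((borel :: real measure) \<Otimes>\<^sub>M borel)"
proof -
  have opn: "(\<lambda>z. emeasure (law (fst z) (snd z)) V) \<in> borel_measurable ((borel :: real measure) \<Otimes>\<^sub>M borel)"
    if V: "open V" for V
  proof -
    obtain A C :: "nat \<Rightarrow> 'a set" where AC: "\<And>k. open (A k)" "\<And>k. compact (C k)" "\<And>k. A k \<subseteq> C k" "\<And>k. C k \<subseteq> V"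
      "incseq A" "(\<Union>k. A k) = V"
      using open_compact_exhaustion[OF lc V] by metis
    have Ab: "A k \<in> sets borel" "C k \<in> sets borel" for k
      using AC(1)[of k] compact_imp_closed[OF AC(2)[of k]] by auto
    let ?W = "\<lambda>k n s x. emeasure (law (dyadic_above n (max 0 s)) x) (A k)"
    have meas: "(\<lambda>z. ?W k n (fst z) (snd z)) \<in> borel_measurable ((borel :: real measure) \<Otimes>\<^sub>M borel)" for k n
      unfolding dyadic_above_def
    proof (rule measurable_compose_countable[where f="\<lambda>i z. emeasure (law ((real_of_int i + 1) / 2 ^ n) (snd z)) (A k)"
          and g="\<lambda>z. \<lfloor>max 0 (fst z) * 2 ^ n\<rfloor>"])
      show "(\<lambda>z. emeasure (law ((real_of_int i + 1) / 2 ^ n) (snd z)) (A k)) \<in> borel_measurable ((borel :: real measure) \<Otimes>\<^sub>M borel)" for i :: int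
        by (rule measurable_compose[OF measurable_snd measurable_law_space[OF Ab(1)]])
    qed measurable
    have "emeasure (law s x) V = (SUP k. liminf (\<lambda>n. ?W k n s x))" for s x
    proof (rule antisym)
      interpret prob_space "P (Some x)" by (rule law_prob_space)
      let ?s = "max 0 s"
      note up = dyadic_above_at_right[of ?s]
      have i: "(\<lambda>\<omega>. indicator (Some ` A k) (Y t \<omega>) :: ennreal) \<in> borel_measurable (P (Some x))" for k t
        by (rule measurable_indicator_Y[OF Ab(1)])
      have "emeasure (law s x) (A k) \<le> liminf (\<lambda>n. ?W k n s x)" for k
      proof -
        have "emeasure (law s x) (A k) = (\<integral>\<^sup>+\<omega>. indicator (Some ` A k) (Y (ennreal ?s) \<omega>) \<partial>P (Some x))"
          unfolding emeasure_law[OF Ab(1), symmetric] law_max_0 ..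
        also have "\<dots> \<le> (\<integral>\<^sup>+\<omega>. liminf (\<lambda>n. indicator (Some ` A k) (Y (ennreal (dyadic_above n ?s)) \<omega>)) \<partial>P (Some x))"
        proof (rule nn_integral_mono)
          fix \<omega> assume "\<omega> \<in> space (P (Some x))"
          then have \<omega>: "\<omega> \<in> \<Omega>" by (simp add: space_P)
          show "indicator (Some ` A k) (Y (ennreal ?s) \<omega>) \<le> (liminf (\<lambda>n. indicator (Some ` A k) (Y (ennreal (dyadic_above n ?s)) \<omega>)) :: ennreal)"
          proof (cases "Y (ennreal ?s) \<omega> \<in> Some ` A k")
            case True
            have "\<forall>\<^sub>F n in sequentially. Y (ennreal (dyadic_above n ?s)) \<omega> \<in> Some ` A k"
              by (rule eventually_Y_open[OF \<omega> _ up AC(1) True]) simp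
            then have "\<forall>\<^sub>F n in sequentially. (1::ennreal) \<le> indicator (Some ` A k) (Y (ennreal (dyadic_above n ?s)) \<omega>)"
              by eventually_elim simp
            then have "(1::ennreal) \<le> liminf (\<lambda>n. indicator (Some ` A k) (Y (ennreal (dyadic_above n ?s)) \<omega>))"
              by (rule Liminf_bounded)
            then show ?thesis using True by simp
          qed simp
        qed
        also have "\<dots> \<le> liminf (\<lambda>n. \<integral>\<^sup>+\<omega>. indicator (Some ` A k) (Y (ennreal (dyadic_above n ?s)) \<omega>) \<partial>P (Some x))"
          by (rule nn_integral_liminf[OF i])
        finally show ?thesis unfolding emeasure_law[OF Ab(1), symmetric] .
      qed
      then have "(SUP k. emeasure (law s x) (A k)) \<le> (SUP k. liminf (\<lambda>n. ?W k n s x))"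
        by (intro SUP_mono) auto
      moreover have "(SUP k. emeasure (law s x) (A k)) = emeasure (law s x) (\<Union>k. A k)"
        by (rule SUP_emeasure_incseq) (use Ab AC(5) in auto)
      ultimately show "emeasure (law s x) V \<le> (SUP k. liminf (\<lambda>n. ?W k n s x))" unfolding AC(6) by simp
      show "(SUP k. liminf (\<lambda>n. ?W k n s x)) \<le> emeasure (law s x) V"
      proof (rule SUP_least)
        fix k
        have "liminf (\<lambda>n. ?W k n s x) \<le> limsup (\<lambda>n. ?W k n s x)"
          by (rule Liminf_le_Limsup) simp
        also have "\<dots> \<le> (\<integral>\<^sup>+\<omega>. limsup (\<lambda>n. indicator (Some ` A k) (Y (ennreal (dyadic_above n ?s)) \<omega>)) \<partial>P (Some x))"
          unfolding emeasure_law[OF Ab(1)]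
          by (rule nn_integral_limsup[where w="\<lambda>_. 1", OF i]) (simp_all add: indicator_def emeasure_space_1)
        also have "\<dots> \<le> (\<integral>\<^sup>+\<omega>. indicator (Some ` C k) (Y (ennreal ?s) \<omega>) \<partial>P (Some x))"
        proof (rule nn_integral_mono)
          fix \<omega> assume "\<omega> \<in> space (P (Some x))"
          then have \<omega>: "\<omega> \<in> \<Omega>" by (simp add: space_P)
          show "limsup (\<lambda>n. indicator (Some ` A k) (Y (ennreal (dyadic_above n ?s)) \<omega>)) \<le> (indicator (Some ` C k) (Y (ennreal ?s) \<omega>) :: ennreal)"
          proof (cases "Y (ennreal ?s) \<omega> \<in> Some ` C k")
            case True
            have "limsup (\<lambda>n. indicator (Some ` A k) (Y (ennreal (dyadic_above n ?s)) \<omega>)) \<le> (1::ennreal)"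
              by (intro Limsup_bounded always_eventually allI) (simp add: indicator_def)
            then show ?thesis using True by simp
          next
            case False
            have "\<forall>\<^sub>F n in sequentially. Y (ennreal (dyadic_above n ?s)) \<omega> \<notin> Some ` C k"
              by (rule eventually_Y_compact[OF \<omega> _ up AC(2) False]) simp
            then have "\<forall>\<^sub>F n in sequentially. indicator (Some ` A k) (Y (ennreal (dyadic_above n ?s)) \<omega>) \<le> (0::ennreal)"
              by eventually_elim (use AC(3)[of k] in \<open>auto simp: indicator_def\<close>)
            then have "limsup (\<lambda>n. indicator (Some ` A k) (Y (ennreal (dyadic_above n ?s)) \<omega>)) \<le> (0::ennreal)"
              by (rule Limsup_bounded)
            then show ?thesis by simp
          qed
        qed
        also have "\<dots> = emeasure (law s x) (C k)"
          unfolding emeasure_law[OF Ab(2), symmetric] law_max_0 ..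
        also have "\<dots> \<le> emeasure (law s x) V"
          using AC(4)[of k] V by (intro emeasure_mono) auto
        finally show "liminf (\<lambda>n. ?W k n s x) \<le> emeasure (law s x) V" .
      qed
    qed
    then show ?thesis
      using meas by (simp only:) (intro borel_measurable_SUP borel_measurable_liminf; simp)
  qed
  have fin: "emeasure (law s x) X < \<infinity>" for s x X
  proof -
    have "emeasure (law s x) X \<le> emeasure (law s x) (space (law s x))" by (rule emeasure_space)
    also have "\<dots> \<le> 1" using emeasure_law_le_1[of s x] by (simp add: law_def)
    finally show ?thesis by (rule le_less_trans) simp
  qed
  have sp: "space (law s x) = UNIV" for s x by (simp add: law_def)
  have "Int_stable {S :: 'a set. open S}" "{S :: 'a set. open S} \<subseteq> Pow UNIV" "B \<in> sigma_sets UNIV {S. open S}"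
    using B by (auto simp: Int_stable_def borel_def)
  then show ?thesis
  proof (induction rule: sigma_sets_induct_disjoint)
  case (basic V)
    then show ?case using opn by simp
  next
    case (compl X)
    have Xb: "X \<in> sets borel" using compl(1) by (simp add: borel_def)
    have "emeasure (law s x) (UNIV - X) = emeasure (law s x) UNIV - emeasure (law s x) X" for s x
      using emeasure_compl[of X "law s x"] Xb fin[of s x X] by (simp add: sp)
    then show ?case using compl opn[OF open_UNIV] by simp
  next
    case (union X)
    have Xb: "X i \<in> sets borel" for i using union(2) by (auto simp: borel_def)
    have "emeasure (law s x) (\<Union>i. X i) = (\<Sum>i. emeasure (law s x) (X i))" for s x
      using union(1) Xb by (intro suminf_emeasure[symmetric]) auto
    then show ?case using union by simp
  qed simp
qed

lemma measurable_law:
  assumes lc: "locally_compact_space (euclidean :: 'a topology)" and h: "h \<in> borel_measurable borel"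
  shows "(\<lambda>z. \<integral>\<^sup>+y. h y \<partial>law (fst z) (snd z)) \<in> borel_measurable ((borel :: real measure) \<Otimes>\<^sub>M borel)"
  using h
proof (induction rule: borel_induct_indicator)
  case (indicator B)
  then show ?case using measurable_law_indicator[OF lc indicator] by simp
next
  case (cmult h c)
  then show ?case by (simp add: nn_integral_cmult)
next
  case (add h k)
  then show ?case by (simp add: nn_integral_add)
next
  case (SUP H)
  have "(\<integral>\<^sup>+y. (SUP n. H n y) \<partial>law s x) = (SUP n. \<integral>\<^sup>+y. H n y \<partial>law s x)" for s x
    by (rule nn_integral_monotone_convergence_SUP) (use SUP in simp_all)
  then show ?case using SUP by simp
qed

lemma law_semigroup:
  assumes lc: "locally_compact_space (euclidean :: 'a topology)" and st: "0 \<le> s" "0 \<le> t"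
    and h: "h \<in> borel_measurable borel"
  shows "(\<integral>\<^sup>+y. (\<integral>\<^sup>+z. h z \<partial>law t y) \<partial>law s x) = (\<integral>\<^sup>+z. h z \<partial>law (s + t) x)"
proof -
  have meas: "(\<lambda>y. \<integral>\<^sup>+z. h z \<partial>law t y) \<in> borel_measurable (law s x)" if "h \<in> borel_measurable borel" for h
  proof -
    have "(\<lambda>y. (t, y)) \<in> measurable borel ((borel :: real measure) \<Otimes>\<^sub>M borel)" by measurable
    from measurable_compose[OF this measurable_law[OF lc that]] show ?thesis by simp
  qed
  show ?thesis using h
  proof (induction rule: borel_induct_indicator)
    case (indicator B)
    then show ?case using law_semigroup_indicator[OF st indicator] by simp
  next
    case (cmult h c)
    then show ?case using meas[OF cmult(1)] by (simp add: nn_integral_cmult)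
  next
    case (add h k)
    then show ?case using meas[OF add(1)] meas[OF add(2)] by (simp add: nn_integral_add)
  next
    case (SUP H)
    have sup: "(\<integral>\<^sup>+y. (SUP n. H n y) \<partial>law s x) = (SUP n. \<integral>\<^sup>+y. H n y \<partial>law s x)" for s x
      by (rule nn_integral_monotone_convergence_SUP) (use SUP in simp_all)
    have "(\<integral>\<^sup>+y. (SUP n. \<integral>\<^sup>+z. H n z \<partial>law t y) \<partial>law s x) = (SUP n. \<integral>\<^sup>+y. (\<integral>\<^sup>+z. H n z \<partial>law t y) \<partial>law s x)"
    proof (rule nn_integral_monotone_convergence_SUP)
      show "incseq (\<lambda>n y. \<integral>\<^sup>+z. H n z \<partial>law t y)"
        using SUP(2) by (intro incseq_SucI le_funI nn_integral_mono) (auto simp: incseq_Suc_iff le_fun_def)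
    qed (rule meas[OF SUP(1)])
    then show ?case unfolding sup SUP(3) .
  qed
qed

text \<open>Tonelli, for which the joint measurability of the position in time and sample point was
  prepared.\<close>

lemma potential_law:
  assumes lc: "locally_compact_space (euclidean :: 'a topology)" and h: "h \<in> borel_measurable borel"
  shows "potential Y P h x = (\<integral>\<^sup>+s\<in>{0..}. (\<integral>\<^sup>+y. h y \<partial>law s x) \<partial>lborel)"
proof -
  interpret pair_sigma_finite lborel "P (Some x)"
    by (intro pair_sigma_finite.intro sigma_finite_P lborel.sigma_finite_measure_axioms)
  have Y: "(\<lambda>z. Y (ennreal (fst z)) (snd z)) \<in> measurable (lborel \<Otimes>\<^sub>M P (Some x)) cemetery_borel"
    using measurable_Y_pair[OF lc, of "Some x"] by (simp add: measurable_cong_sets[OF sets_pair_measure_cong[OF sets_lborel refl] refl])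
  have e: "(\<lambda>z. ext0 h (Y (ennreal (fst z)) (snd z))) \<in> borel_measurable (lborel \<Otimes>\<^sub>M P (Some x))"
    by (rule measurable_compose[OF Y measurable_ext0[OF h]])
  have m: "(\<lambda>(t, \<omega>). ext0 h (Y (ennreal t) \<omega>) * indicator {0..} t) \<in> borel_measurable (lborel \<Otimes>\<^sub>M P (Some x))"
    using e unfolding split_beta' by measurable
  have "potential Y P h x = (\<integral>\<^sup>+t. (\<integral>\<^sup>+\<omega>. ext0 h (Y (ennreal t) \<omega>) * indicator {0..} t \<partial>P (Some x)) \<partial>lborel)"
    unfolding potential_def by (rule Fubini'[OF m])
  also have "\<dots> = (\<integral>\<^sup>+s\<in>{0..}. (\<integral>\<^sup>+y. h y \<partial>law s x) \<partial>lborel)"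
  proof (rule nn_integral_cong)
    fix t :: real
    have "(\<lambda>\<omega>. ext0 h (Y (ennreal t) \<omega>)) \<in> borel_measurable (P (Some x))"
      by (rule measurable_compose[OF measurable_Y measurable_ext0[OF h]])
    then show "(\<integral>\<^sup>+\<omega>. ext0 h (Y (ennreal t) \<omega>) * indicator {0..} t \<partial>P (Some x)) = (\<integral>\<^sup>+y. h y \<partial>law t x) * indicator {0..} t"
      unfolding nn_integral_law[OF h] transition_def by (rule nn_integral_multc)
  qed
  finally show ?thesis .
qed

lemma symmetric_semigroup_law:
  assumes lc: "locally_compact_space (euclidean :: 'a topology)"
    and tr: "transient Y P" and ref: "reference_measure Y P m" and lb: "locally_bounded_measure m"
    and sym: "symmetric_process Y P m" and dens: "potential_density Y P m u"
    and cont: "continuous_on UNIV (\<lambda>(x, y). u x y)"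
  shows "\<exists>\<eta>. symmetric_semigroup law m u \<eta>"
proof -
  obtain h where h: "h \<in> borel_measurable borel" "\<And>x. 0 < h x" "\<And>x. potential Y P h x < \<infinity>"
    using tr by (auto simp: transient_def)
  have sets_m: "sets m = sets borel" using ref by (simp add: reference_measure_def)
  have pot: "potential Y P h x = (\<integral>\<^sup>+y. ennreal (u x y) * h y \<partial>m)" if "h \<in> borel_measurable borel" for h x
    using dens that by (auto simp: potential_density_def)
  \<comment> \<open>Transience provides a strictly positive \<open>h\<close> of finite potential;
    cutting it at 1 yields a bounded \<open>\<eta>\<close>.\<close>
  have "symmetric_semigroup law m u (\<lambda>x. min (h x) 1)"
  proof
    show "sets (law s x) = sets borel" for s x by simp
    show "emeasure (law s x) UNIV \<le> 1" for s x by (rule emeasure_law_le_1)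
    show "(\<lambda>(s, x). \<integral>\<^sup>+y. h y \<partial>law s x) \<in> borel_measurable (borel \<Otimes>\<^sub>M borel)" if "h \<in> borel_measurable borel" for h
      using measurable_law[OF lc that] by (simp add: split_beta')
    show "(\<integral>\<^sup>+y. (\<integral>\<^sup>+z. h z \<partial>law t y) \<partial>law s x) = (\<integral>\<^sup>+z. h z \<partial>law (s + t) x)"
      if "0 \<le> s" "0 \<le> t" "h \<in> borel_measurable borel" for s t h x
      by (rule law_semigroup[OF lc that])
    show "((\<lambda>s. emeasure (law s x) V) \<longlongrightarrow> 1) (at_right 0)" if "open V" "x \<in> V" for V x
      by (rule law_right_continuous[OF that])
    show "sets m = sets borel" by (rule sets_m)
    show "\<exists>V. open V \<and> x \<in> V \<and> emeasure m V < \<infinity>" for x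
      using lb by (simp add: locally_bounded_measure_def)
    show "(\<integral>\<^sup>+x. h x * (\<integral>\<^sup>+y. k y \<partial>law s x) \<partial>m) = (\<integral>\<^sup>+x. (\<integral>\<^sup>+y. h y \<partial>law s x) * k x \<partial>m)"
      if "0 \<le> s" "h \<in> borel_measurable borel" "k \<in> borel_measurable borel" for s h k
      unfolding nn_integral_law[OF that(2)] nn_integral_law[OF that(3)]
      using sym that by (simp add: symmetric_process_def less_top[symmetric])
    show "0 \<le> u x y" for x y using dens by (simp add: potential_density_def)
    show "continuous_on UNIV (\<lambda>(x, y). u x y)" by (rule cont)
    show "(\<integral>\<^sup>+s\<in>{0..}. (\<integral>\<^sup>+y. h y \<partial>law s x) \<partial>lborel) = (\<integral>\<^sup>+y. ennreal (u x y) * h y \<partial>m)"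
      if "h \<in> borel_measurable borel" for h x
      unfolding potential_law[OF lc that, symmetric] by (rule pot[OF that])
    show "(\<lambda>x. min (h x) 1) \<in> borel_measurable borel" using h(1) by measurable
    show "0 < min (h x) 1" for x using h(2) by simp
    show "min (h x) 1 \<le> 1" for x by simp
    show "(\<integral>\<^sup>+y. ennreal (u x y) * min (h y) 1 \<partial>m) < \<infinity>" for x
    proof -
      have "(\<integral>\<^sup>+y. ennreal (u x y) * min (h y) 1 \<partial>m) \<le> (\<integral>\<^sup>+y. ennreal (u x y) * h y \<partial>m)"
        by (intro nn_integral_mono mult_left_mono) auto
      also have "\<dots> < \<infinity>" using h(3)[of x] unfolding pot[OF h(1)] .
      finally show ?thesis .
    qed
  qed
  then show ?thesis by blast
qed

text \<open>Under a reference measure an excessive function \<open>f\<close> is Borel measurable: it is the limit of the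
  averages \<open>S t f\<close>, which do not change when \<open>f\<close> is modified on an \<open>m\<close>-null set.\<close>

lemma excessive_lsc:
  assumes ss: "symmetric_semigroup law m u \<eta>" and exc: "excessive Y P F" and fin: "\<And>x. F x < \<infinity>"
  shows "symmetric_semigroup.supermedian law F" "lsc F"
proof -
  interpret symmetric_semigroup law m u \<eta> by (rule ss)
  define \<tau> where "\<tau> s x = transition Y P (ennreal s) F x" for s x
  have dec: "\<tau> t x \<le> \<tau> s x" if "0 < s" "s \<le> t" for s t x
    using exc that by (simp add: \<tau>_def excessive_def ennreal_leI)
  have lim: "((\<lambda>s. \<tau> s x) \<longlongrightarrow> F x) (at_right 0)" for x
  proof -
    have "((\<lambda>t. transition Y P t F x) \<longlongrightarrow> F x) (at_right 0)" using exc by (simp add: excessive_def)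
    moreover have "filterlim ennreal (at_right 0) (at_right 0)"
      using filterlim_ennreal_at_right[of 0 "\<lambda>s. s" "at_right 0"] by (simp add: filterlim_ident)
    ultimately show ?thesis unfolding \<tau>_def by (rule filterlim_compose)
  qed
  have \<tau>_le: "\<tau> s x \<le> F x" if "0 < s" for s x
  proof (rule tendsto_lowerbound[OF lim])
    show "\<forall>\<^sub>F t in at_right 0. \<tau> s x \<le> \<tau> t x"
      using that dec by (auto simp: eventually_at_right_field intro!: exI[of _ s])
  qed simp
  \<comment> \<open>Universal measurability speaks of finite measures; weighting \<open>m\<close>
    with a positive integrable \<open>w\<close> gives a finite measure with the same null
    sets.\<close>
  obtain F' where F': "F' \<in> borel_measurable borel" "AE x in m. F x = F' x"
  proof -
    obtain w :: "'a \<Rightarrow> real" where w: "w \<in> borel_measurable m" "\<And>x. 0 < w x" "integrable m w"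
      by (rule m.obtain_positive_integrable_function) (rule that)
    have "finite_measure (density m (\<lambda>x. ennreal (w x)))"
      using w by (intro finite_measureI) (simp add: emeasure_density nn_integral_eq_integral less_imp_le cong: nn_integral_cong)
    moreover have sd: "sets (density m (\<lambda>x. ennreal (w x))) = sets borel" by (simp add: sets_m)
    ultimately have "F \<in> borel_measurable (completion (density m (\<lambda>x. ennreal (w x))))"
      using exc by (simp add: excessive_def universally_measurable_def)
    from completion_ex_borel_measurable[OF this]
    obtain g where g: "g \<in> borel_measurable (density m (\<lambda>x. ennreal (w x)))" "AE x in density m (\<lambda>x. ennreal (w x)). F x = g x"
      by blast
    show ?thesis
    proof (rule that)
      show "g \<in> borel_measurable borel" using g(1) measurable_cong_sets[OF sd refl] by simp
      show "AE x in m. F x = g x" using g(2) w by (simp add: AE_density)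
    qed
  qed
  obtain N where N: "{x \<in> space m. \<not> F x = F' x} \<subseteq> N" "emeasure m N = 0" "N \<in> sets m"
    using F'(2) by (rule AE_E)
  have Nb: "N \<in> sets borel" using N(3) by (simp add: sets_m)
  \<comment> \<open>The null set \<open>N\<close> has potential zero, so for almost every time
    \<open>s\<close> the law at \<open>s\<close> does not charge it.\<close>
  have eq: "AE s in lborel. 0 \<le> s \<longrightarrow> T s F' x = \<tau> s x" for x
  proof -
    have i: "indicator N \<in> borel_measurable borel" using Nb by simp
    have "U (indicator N) x \<le> (\<integral>\<^sup>+y. \<infinity> * indicator N y \<partial>m)"
      unfolding U_def by (intro nn_integral_mono) (auto simp: indicator_def)
    also have "\<dots> = 0" using N by (subst nn_integral_cmult_indicator) auto
    finally have "(\<integral>\<^sup>+s\<in>{0..}. T s (indicator N) x \<partial>lborel) = 0" by (simp only: U_alt[OF i, of x] le_zero_eq)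
    moreover have "(\<lambda>s. T s (indicator N) x * indicator {0..} s) \<in> borel_measurable lborel"
      using measurable_time[OF i, of x] by measurable
    ultimately have "AE s in lborel. T s (indicator N) x * indicator {0..} s = 0"
      by (simp only: nn_integral_0_iff_AE)
    then show ?thesis
    proof eventually_elim
      case (elim s)
      show ?case
      proof
        assume "0 \<le> s"
        then have "T s (indicator N) x = 0" using elim by simp
        then have "(\<integral>\<^sup>+\<omega>. indicator (Some ` N) (Y (ennreal s) \<omega>) \<partial>P (Some x)) = 0"
          using Nb emeasure_law[OF Nb, of s x] by simp
        then have "AE \<omega> in P (Some x). indicator (Some ` N) (Y (ennreal s) \<omega>) = (0 :: ennreal)"
          using nn_integral_0_iff_AE[OF measurable_indicator_Y[OF Nb]] by blast
        then have "AE \<omega> in P (Some x). ext0 F' (Y (ennreal s) \<omega>) = ext0 F (Y (ennreal s) \<omega>)"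
        proof eventually_elim
          case (elim \<omega>)
          show ?case
          proof (cases "Y (ennreal s) \<omega>")
            case (Some y)
            then have "y \<notin> N" using elim by (auto simp: indicator_def split: if_splits)
            then have "F y = F' y" using N(1) by auto
            then show ?thesis using Some by (simp add: ext0_def)
          qed (simp add: ext0_def)
        qed
        then show "T s F' x = \<tau> s x"
          unfolding nn_integral_law[OF F'(1)] \<tau>_def transition_def by (rule nn_integral_cong_AE)
      qed
    qed
  qed
  have A: "A t F' x = (\<integral>\<^sup>+s\<in>{0..t}. \<tau> s x \<partial>lborel)" for t x
    unfolding A_def using eq[of x] by (intro nn_integral_cong_AE) (auto simp: indicator_def elim!: eventually_mono)
  \<comment> \<open>Monotonicity of \<open>\<tau>\<close> squeezes the average up to
    \<open>t\<close> between \<open>\<tau> t x\<close> and \<open>F x\<close>.\<close>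
  have SF: "(\<lambda>n. S (1 / real (Suc n)) F' x) \<longlonglongrightarrow> F x" for x
  proof (rule order_tendstoI)
    fix c assume "F x < c"
    have le: "S t F' x \<le> F x" if t: "0 < t" for t
    proof -
      have "A t F' x \<le> (\<integral>\<^sup>+s\<in>{0..t}. F x \<partial>lborel)"
        unfolding A
      proof (rule nn_integral_mono_AE)
        show "AE s in lborel. \<tau> s x * indicator {0..t} s \<le> F x * indicator {0..t} s"
          using AE_lborel_singleton[of 0]
        proof eventually_elim
          case (elim s)
          then show ?case using \<tau>_le[of s x] by (cases "s \<in> {0..t}") auto
        qed
      qed
      also have "\<dots> = F x * ennreal t" using t by (subst nn_integral_cmult_indicator) auto
      finally have "S t F' x \<le> ennreal (1 / t) * (F x * ennreal t)" by (intro mult_left_mono) auto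
      also have "\<dots> = F x" using t by (simp add: mult.left_commute[of _ "F x"] ennreal_mult'[symmetric])
      finally show ?thesis .
    qed
    show "\<forall>\<^sub>F n in sequentially. S (1 / real (Suc n)) F' x < c"
    proof (intro always_eventually allI)
      fix n :: nat
      have "S (1 / real (Suc n)) F' x \<le> F x" by (rule le) simp
      then show "S (1 / real (Suc n)) F' x < c" using \<open>F x < c\<close> by (rule le_less_trans)
    qed
  next
    fix c assume "c < F x"
    then obtain d :: real where d: "0 < d" "\<And>s. 0 < s \<Longrightarrow> s < d \<Longrightarrow> c < \<tau> s x"
      using order_tendstoD(1)[OF lim[of x]] unfolding eventually_at_right_field by auto
    have big: "c < S t F' x" if t: "0 < t" "t < d" for t
    proof -
      have "c < \<tau> t x" using d t by simp
      also have "\<tau> t x = ennreal (1 / t) * (\<tau> t x * ennreal t)"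
        using t by (simp add: mult.left_commute[of _ "\<tau> t x"] ennreal_mult'[symmetric])
      also have "\<tau> t x * ennreal t = (\<integral>\<^sup>+s\<in>{0..t}. \<tau> t x \<partial>lborel)"
        using t by (subst nn_integral_cmult_indicator) auto
      also have "\<dots> \<le> A t F' x"
        unfolding A
      proof (rule nn_integral_mono_AE)
        show "AE s in lborel. \<tau> t x * indicator {0..t} s \<le> \<tau> s x * indicator {0..t} s"
          using AE_lborel_singleton[of 0]
        proof eventually_elim
          case (elim s)
          then show ?case using dec[of s t x] by (cases "s \<in> {0..t}") auto
        qed
      qed
      finally show ?thesis by (simp add: mult_left_mono)
    qed
    obtain n0 where n0: "inverse (real (Suc n0)) < d" using reals_Archimedean[OF d(1)] by blast
    show "\<forall>\<^sub>F n in sequentially. c < S (1 / real (Suc n)) F' x"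
      using eventually_ge_at_top[of n0]
    proof eventually_elim
      case (elim n)
      have "1 / real (Suc n) \<le> 1 / real (Suc n0)" using elim by (intro divide_left_mono) auto
      then have "1 / real (Suc n) < d" using n0 by (simp add: inverse_eq_divide)
      then show ?case by (intro big) simp_all
    qed
  qed
  have Fb: "F \<in> borel_measurable borel"
  proof -
    have "F = (\<lambda>x. liminf (\<lambda>n. S (1 / real (Suc n)) F' x))"
      by (rule ext) (rule lim_imp_Liminf[OF sequentially_bot SF, symmetric])
    moreover have "S t F' \<in> borel_measurable borel" for t
      using measurable_A[OF F'(1), of t] by measurable
    ultimately show ?thesis by (simp only:) (intro borel_measurable_liminf)
  qed
  have T\<tau>: "T s F x = \<tau> s x" for s x
    unfolding \<tau>_def by (rule nn_integral_law[OF Fb])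
  \<comment> \<open>Excessivity concerns positive times and their limit; at time 0 the law is the
    point mass at \<open>x\<close>, by normality.\<close>
  have T0: "T 0 F x \<le> F x" for x
  proof -
    interpret prob_space "P (Some x)" by (rule law_prob_space)
    have "T 0 F x = (\<integral>\<^sup>+\<omega>. F x \<partial>P (Some x))"
      unfolding T\<tau> \<tau>_def transition_def
    proof (rule nn_integral_cong_AE)
      show "AE \<omega> in P (Some x). ext0 F (Y (ennreal 0) \<omega>) = F x"
        using normal[of "Some x"] by eventually_elim (simp add: ext0_def)
    qed
    then show ?thesis by (simp add: emeasure_space_1)
  qed
  show sm: "supermedian F"
    unfolding supermedian_def
  proof (intro conjI allI impI)
    show "T s F x \<le> F x" if "0 \<le> s" for s x
      using that T0[of x] \<tau>_le[of s x] by (cases "s = 0") (auto simp: T\<tau>)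
  qed (rule Fb)
  show "lsc F"
    by (rule lsc_excessive[OF sm fin]) (use lim in \<open>simp add: T\<tau>\<close>)
qed

end

theorem theorem1p1:
  fixes \<Omega> :: "'w set"
    and G :: "ennreal \<Rightarrow> 'w measure"
    and Y :: "ennreal \<Rightarrow> 'w \<Rightarrow> 'a :: {t2_space, second_countable_topology} option"
    and \<theta> :: "ennreal \<Rightarrow> 'w \<Rightarrow> 'w"
    and P :: "'a option \<Rightarrow> 'w measure"
    and m :: "'a measure"
    and u :: "'a \<Rightarrow> 'a \<Rightarrow> real"
    and f g :: "'a \<Rightarrow> real"
    and \<alpha> :: real
  assumes "locally_compact_space (euclidean :: 'a topology)"
    and "borel_right_process \<Omega> G Y \<theta> P"
    and "transient Y P"
    and "reference_measure Y P m"
    and "locally_bounded_measure m"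
    and "symmetric_process Y P m"
    and "potential_density Y P m u"
    and "continuous_on UNIV (\<lambda>(x, y). u x y)"
    and "\<And>x. 0 \<le> g x" and "excessive Y P (\<lambda>x. ennreal (g x))"
    and "\<And>x. 0 \<le> f x" and "excessive Y P (\<lambda>x. ennreal (f x))"
    and "0 < \<alpha>"
  shows "permanental_kernel \<alpha> (\<lambda>x y. u x y + g x * f y)"
proof -
  interpret borel_right_process \<Omega> G Y \<theta> P by (rule assms(2))
  obtain \<eta> where ss: "symmetric_semigroup law m u \<eta>"
    using symmetric_semigroup_law[OF assms(1,3,4,5,6,7,8)] by (rule exE)
  interpret symmetric_semigroup law m u \<eta> by (rule ss)
  let ?E = "{f. (\<forall>x. 0 \<le> f x) \<and> supermedian (\<lambda>x. ennreal (f x)) \<and> lsc (\<lambda>x. ennreal (f x))}"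
  interpret balayage_kernel u ?E by (rule balayage_kernel)
  have fin: "ennreal r < \<infinity>" for r by simp
  have gE: "g \<in> ?E" using assms(9) excessive_lsc[OF ss assms(10) fin] by simp
  have fE: "f \<in> ?E" using assms(11) excessive_lsc[OF ss assms(12) fin] by simp
  let ?K = "\<lambda>x y. u x y + g x * f y"
  have K_nonneg: "0 \<le> ?K x y" for x y using u_nonneg[of x y] assms(9)[of x] assms(11)[of y] by simp
  have K_pos: "0 < ?K x x" for x using u_diag_pos[of x] assms(9)[of x] assms(11)[of x] by (simp add: add_pos_nonneg)
  have main: "(\<lambda>s. kernel_det ?K n p s powr - \<alpha>) \<in> laplace_class n \<and> (\<forall>s. (\<forall>i. 0 \<le> s i) \<longrightarrow> 0 < kernel_det ?K n p s)"
    if p: "inj_on p {..<n}" for n p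
  proof -
    have J: "finite (p ` {..<n})" by simp
    obtain A where A: "(\<forall>x\<in>p ` {..<n}. \<forall>y\<in>p ` {..<n}. x \<noteq> y \<longrightarrow> A x y \<le> 0) \<and>
      (\<forall>x\<in>p ` {..<n}. \<forall>z\<in>p ` {..<n}. (\<Sum>y\<in>p ` {..<n}. A x y * ?K y z) = (if x = z then 1 else 0))"
      using inverse_z_matrix[OF J fE assms(11) gE assms(9)] by (rule exE)
    have Z: "A x y \<le> 0" if "x \<in> p ` {..<n}" "y \<in> p ` {..<n}" "x \<noteq> y" for x y
      by (rule bspec[OF bspec[OF conjunct1[OF A] that(1)] that(2), THEN mp, OF that(3)])
    have inv: "(\<Sum>y\<in>p ` {..<n}. A x y * ?K y z) = (if x = z then 1 else 0)" if "x \<in> p ` {..<n}" "z \<in> p ` {..<n}" for x z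
      by (rule bspec[OF bspec[OF conjunct2[OF A] that(1)] that(2)])
    \<comment> \<open>Indices replace points from here on; injectivity of \<open>p\<close> keeps
      distinct indices at distinct points.\<close>
    have Z': "A (p i) (p j) \<le> 0" if "i < n" "j < n" "i \<noteq> j" for i j
      by (rule Z) (use that p in \<open>auto simp: inj_on_def\<close>)
    have inv': "(\<Sum>j<n. A (p i) (p j) * ?K (p j) (p k)) = (if i = k then 1 else 0)" if "i < n" "k < n" for i k
      using inv[of "p i" "p k"] that p by (simp add: sum.reindex inj_on_eq_iff)
    note laplace = inverse_z_matrix_laplace[of n "\<lambda>i j. A (p i) (p j)" "\<lambda>i j. ?K (p i) (p j)",
        OF Z' inv' K_nonneg K_pos assms(13)]
    show ?thesis
    proof (intro conjI allI impI)
      show "(\<lambda>s. kernel_det ?K n p s powr - \<alpha>) \<in> laplace_class n" by (rule laplace(1))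
      fix s :: "nat \<Rightarrow> real" assume s: "\<forall>i. 0 \<le> s i"
      show "0 < kernel_det ?K n p s" by (rule laplace(2)) (use s in simp_all)
    qed
  qed
  show ?thesis
    by (rule permanental_kernelI) (use main in \<open>simp_all\<close>)
qed

end
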